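(* For a sequence ${\boldsymbol{\alpha}}=(\alpha_2,\alpha_3,\ldots)$ of nonnegative integers with finitely many nonzero entries, let $\widetilde{H}({\boldsymbol{\alpha}})$ denote the number of equivalence classes of minimal factorizations of type ${\boldsymbol{\alpha}}$ of the $n$-cycle $(1\,2\,\ldots\,n)$, where $n=1+\langle{\boldsymbol{\alpha}}\rangle$ (with $\widetilde{H}(\boldsymbol{0})=1$). Then the formal power series $$\xi(\boldsymbol{x})=\sum_{{\boldsymbol{\alpha}}}\widetilde{H}({\boldsymbol{\alpha}})\,x_2^{\alpha_2}x_3^{\alpha_3}\cdots,$$ with the sum over all such ${\boldsymbol{\alpha}}$, satisfies $$\xi(\boldsymbol{x})=1+x_2\,\xi(\boldsymbol{x})^3+x_3\,\xi(\boldsymbol{x})^5+\cdots=1+\sum_{j\ge2}x_j\,\xi(\boldsymbol{x})^{2j-1}.$$ Consequently, for every $n\ge 0$, $$\sum_{{\boldsymbol{\alpha}}:\,\langle{\boldsymbol{\alpha}}\rangle=n}(-1)^{|{\boldsymbol{\alpha}}|+n}\,\widetilde{H}({\boldsymbol{\alpha}})=\frac{1}{n+1}\binom{2n}{n},$$ the $n$-th Catalan number.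
   Context: For ${\boldsymbol{\alpha}}=(\alpha_2,\alpha_3,\ldots)$, $|{\boldsymbol{\alpha}}|=\sum_{j\ge2}\alpha_j$ and $\langle{\boldsymbol{\alpha}}\rangle=\sum_{j\ge2}(j-1)\alpha_j$. Permutations are multiplied right to left. A factorization of $(1\,2\,\ldots\,n)$ is an expression $(1\,2\,\ldots\,n)=\sigma_m\cdots\sigma_1$ with each $\sigma_i$ a cycle of length at least $2$; it has type ${\boldsymbol{\alpha}}$ if exactly $\alpha_j$ factors are $j$-cycles, and it is minimal if $\langle{\boldsymbol{\alpha}}\rangle=n-1$. Two factorizations are equivalent if they differ only in the order of commuting factors (one is obtained from the other by repeatedly swapping adjacent commuting factors). *)

theory Defs
  imports Complex_Main "HOL-Combinatorics.Cycles" "HOL-Library.Poly_Mapping"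
begin

definition ncycle :: "nat \<Rightarrow> nat \<Rightarrow> nat" where
  "ncycle n = (\<lambda>i. if 1 \<le> i \<and> i < n then i + 1 else if i = n then 1 else i)"

definition is_kcycle :: "nat \<Rightarrow> nat \<Rightarrow> (nat \<Rightarrow> nat) \<Rightarrow> bool" where
  "is_kcycle n k \<sigma> \<longleftrightarrow> (\<exists>cs. distinct cs \<and> length cs = k \<and> set cs \<subseteq> {1..n} \<and> \<sigma> = cycle_of_list cs)"

definition prod_rl :: "(nat \<Rightarrow> nat) list \<Rightarrow> nat \<Rightarrow> nat" where
  "prod_rl fs = fold (\<lambda>\<sigma> acc. \<sigma> \<circ> acc) fs id"

text \<open>Type vectors alpha = (alpha_2, alpha_3, ...) as finitely supported maps nat =>0 nat
  whose entries at 0 and 1 vanish.\<close>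
definition is_type :: "(nat \<Rightarrow>\<^sub>0 nat) \<Rightarrow> bool" where
  "is_type \<alpha> \<longleftrightarrow> Poly_Mapping.lookup \<alpha> 0 = 0 \<and> Poly_Mapping.lookup \<alpha> 1 = 0"

definition tsize :: "(nat \<Rightarrow>\<^sub>0 nat) \<Rightarrow> nat" where
  "tsize \<alpha> = (\<Sum>j\<in>Poly_Mapping.keys \<alpha>. Poly_Mapping.lookup \<alpha> j)"

definition tweight :: "(nat \<Rightarrow>\<^sub>0 nat) \<Rightarrow> nat" where
  "tweight \<alpha> = (\<Sum>j\<in>Poly_Mapping.keys \<alpha>. (j - 1) * Poly_Mapping.lookup \<alpha> j)"

definition factorizations :: "nat \<Rightarrow> (nat \<Rightarrow>\<^sub>0 nat) \<Rightarrow> (nat \<Rightarrow> nat) list set" where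
  "factorizations n \<alpha> = {fs. (\<forall>\<sigma>\<in>set fs. \<exists>k\<ge>2. is_kcycle n k \<sigma>)
       \<and> prod_rl fs = ncycle n
       \<and> (\<forall>j. length (filter (is_kcycle n j) fs) = Poly_Mapping.lookup \<alpha> j)}"

definition comm_swap :: "(nat \<Rightarrow> nat) list \<Rightarrow> (nat \<Rightarrow> nat) list \<Rightarrow> bool" where
  "comm_swap fs gs \<longleftrightarrow> (\<exists>xs a b ys. fs = xs @ [a, b] @ ys \<and> gs = xs @ [b, a] @ ys \<and> a \<circ> b = b \<circ> a)"

definition fact_equiv :: "((nat \<Rightarrow> nat) list \<times> (nat \<Rightarrow> nat) list) set" where
  "fact_equiv = {(fs, gs). comm_swap\<^sup>*\<^sup>* fs gs}"

definition Htilde :: "(nat \<Rightarrow>\<^sub>0 nat) \<Rightarrow> nat" where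
  "Htilde \<alpha> = card (factorizations (1 + tweight \<alpha>) \<alpha> // fact_equiv)"

text \<open>Formal power series in variables x_0, x_1, x_2, ... with integer coefficients,
  as coefficient functions on monomials (nat =>0 nat).\<close>
type_synonym mps = "(nat \<Rightarrow>\<^sub>0 nat) \<Rightarrow> int"

definition ps_one :: mps where "ps_one m = (if m = 0 then 1 else 0)"

definition ps_var :: "nat \<Rightarrow> mps" where "ps_var j m = (if m = Poly_Mapping.single j 1 then 1 else 0)"

definition ps_mult :: "mps \<Rightarrow> mps \<Rightarrow> mps" where
  "ps_mult f g m = (\<Sum>(a, b)\<in>{(a, b). a + b = m}. f a * g b)"

primrec ps_pow :: "mps \<Rightarrow> nat \<Rightarrow> mps" where
  "ps_pow f 0 = ps_one"
| "ps_pow f (Suc k) = ps_mult f (ps_pow f k)"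

text \<open>Coefficientwise sum of a locally finite family of series (each coefficient receives only
  finitely many nonzero contributions).\<close>
definition ps_sum :: "(nat \<Rightarrow> mps) \<Rightarrow> nat set \<Rightarrow> mps" where
  "ps_sum F J m = (\<Sum>j\<in>{j\<in>J. F j m \<noteq> 0}. F j m)"

definition locally_finite :: "(nat \<Rightarrow> mps) \<Rightarrow> nat set \<Rightarrow> bool" where
  "locally_finite F J \<longleftrightarrow> (\<forall>m. finite {j\<in>J. F j m \<noteq> 0})"

definition xi :: mps where
  "xi \<alpha> = (if is_type \<alpha> then int (Htilde \<alpha>) else 0)"

end

theory Submission
  imports Defs "HOL-Computational_Algebra.Formal_Power_Series"
begin


text \<open>
  In a minimal factorization of the increasing cycle on \<open>V\<close> every factor is itself the increasing
  cycle on its support \<open>U\<close>, and peeling off the first factor cuts \<open>V\<close> into the cyclic arcs that end in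
  the elements of \<open>U\<close>; a rank count forces each remaining factor into one of these arcs. Hence the
  supports form a noncrossing cactus of polygons on \<open>V\<close>, and this cactus determines the order of any two
  factors that share a vertex. So the commutation classes of minimal factorizations are the
  noncrossing cacti.

  In a nontrivial cactus let \<open>P\<close> be the first factor moving the least vertex, with \<open>j\<close> vertices.
  Removing \<open>P\<close> leaves one cactus at the least vertex and, at each of the other \<open>j - 1\<close> vertices, a pair of
  cacti, one on each side of the vertex. This gives a weight-preserving bijection with trees whose
  generating function satisfies the functional equation.

  For the signed count let \<open>T\<close> and \<open>F\<close> be the signed series of trees and of forests (sequences of pairs of
  trees). Then \<open>F * T = 1\<close> and \<open>F = 1 - X * T\<^sup>2 * F\<close>, so \<open>T = 1 + X * T\<^sup>2\<close>.
\<close>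

section \<open>Increasing cycles and cyclic arcs\<close>

text \<open>The given factors are arbitrary cycles, so their being increasing has to be won from
  minimality. The tool is the rank bound for hypergraphs: \<open>card V\<close> is at most the
  number of components plus the sum of \<open>card E - 1\<close> over the edges; a minimal product
  leaves no slack in it. After some factors have been peeled off, the rest is no longer one cycle
  but a product of disjoint increasing cycles, so the induction carries a labelling of
  \<open>V\<close> whose classes are the current arcs. The exponent 2j-1 counts subtrees: two at
  each of j-1 vertices of the polygon and one at the least vertex. In the signed series a polygon
  with k = j-1 further vertices has sign (-1)^(k+1), so T = 1 - T * S, where S is the sum of (-X *
  T^2)^k over k \<ge> 1. The forest series F is the full geometric series 1 + S; introducing it
  turns the infinite sum into two finite equations.\<close>

text \<open>\<open>cceil U x\<close> is the first element of \<open>U\<close> met when going cyclically upwards from \<open>x\<close>, starting with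
  \<open>x\<close> itself; \<open>cnext U\<close> is the increasing cycle on \<open>U\<close>, extended by the identity.\<close>

definition cceil :: "nat set \<Rightarrow> nat \<Rightarrow> nat" where
  "cceil U x = (if \<exists>u\<in>U. x \<le> u then LEAST u. u \<in> U \<and> x \<le> u else LEAST u. u \<in> U)"

definition cnext :: "nat set \<Rightarrow> nat \<Rightarrow> nat" where
  "cnext U x = (if x \<in> U then cceil U (Suc x) else x)"

lemma ex_least_in:
  fixes U :: "nat set"
  assumes "U \<noteq> {}"
  shows "\<exists>m\<in>U. \<forall>u\<in>U. m \<le> u"
proof -
  obtain u where "u \<in> U" using assms by blast
  then show ?thesis by (intro bexI[of _ "LEAST u. u \<in> U"]) (auto intro: Least_le LeastI)
qed

lemma cceil_eqI_ge:
  assumes "s \<in> U" "x \<le> s" "\<And>u. u \<in> U \<Longrightarrow> x \<le> u \<Longrightarrow> s \<le> u"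
  shows "cceil U x = s"
  using assms unfolding cceil_def by (auto intro!: Least_equality)

lemma cceil_eqI_wrap:
  assumes "s \<in> U" "\<And>u. u \<in> U \<Longrightarrow> u < x" "\<And>u. u \<in> U \<Longrightarrow> s \<le> u"
  shows "cceil U x = s"
proof -
  have "\<not> (\<exists>u\<in>U. x \<le> u)" using assms(2) by fastforce
  then show ?thesis using assms unfolding cceil_def by (auto intro!: Least_equality)
qed

lemma cceil_cases [consumes 1, case_names ge wrap]:
  assumes "U \<noteq> {}"
  obtains (ge) "cceil U x \<in> U" "x \<le> cceil U x" "\<And>u. u \<in> U \<Longrightarrow> x \<le> u \<Longrightarrow> cceil U x \<le> u"
  | (wrap) "cceil U x \<in> U" "\<And>u. u \<in> U \<Longrightarrow> u < x" "\<And>u. u \<in> U \<Longrightarrow> cceil U x \<le> u"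
proof (cases "\<exists>u\<in>U. x \<le> u")
  case True
  then obtain u where u: "u \<in> U \<and> x \<le> u" by blast
  have "(LEAST u. u \<in> U \<and> x \<le> u) \<in> U \<and> x \<le> (LEAST u. u \<in> U \<and> x \<le> u)"
    by (rule LeastI[where P="\<lambda>u. u \<in> U \<and> x \<le> u", OF u])
  moreover have "\<And>v. v \<in> U \<Longrightarrow> x \<le> v \<Longrightarrow> (LEAST u. u \<in> U \<and> x \<le> u) \<le> v"
    by (rule Least_le) blast
  ultimately show ?thesis using ge True unfolding cceil_def by auto
next
  case False
  obtain u where u: "u \<in> U" using assms by blast
  have "(LEAST u. u \<in> U) \<in> U" by (rule LeastI[where P="\<lambda>u. u \<in> U", OF u])
  moreover have "\<And>v. v \<in> U \<Longrightarrow> (LEAST u. u \<in> U) \<le> v" by (rule Least_le)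
  moreover have "\<And>v. v \<in> U \<Longrightarrow> v < x" using False by fastforce
  ultimately show ?thesis using wrap False unfolding cceil_def by auto
qed

lemma cceil_in: "U \<noteq> {} \<Longrightarrow> cceil U x \<in> U"
  by (erule cceil_cases[of U x])

lemma cceil_self [simp]: "x \<in> U \<Longrightarrow> cceil U x = x"
  by (rule cceil_eqI_ge) auto

lemma cceil_cong:
  assumes "\<And>u. u \<in> U \<Longrightarrow> (x \<le> u) = (y \<le> u)"
  shows "cceil U x = cceil U y"
proof -
  have "(\<lambda>u. u \<in> U \<and> x \<le> u) = (\<lambda>u. u \<in> U \<and> y \<le> u)" using assms by auto
  then show ?thesis unfolding cceil_def using assms by auto
qed

text \<open>Every point of \<open>U\<close> is a point of \<open>W\<close>, so none is passed on the
  way from \<open>x\<close> to \<open>cceil W x\<close>. If that way leads over the top, both sides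
  are the least element of \<open>U\<close>.\<close>

lemma cceil_cceil:
  assumes "U \<subseteq> W" "U \<noteq> {}"
  shows "cceil U (cceil W x) = cceil U x"
proof -
  have W: "W \<noteq> {}" using assms by auto
  from W show ?thesis
  proof (cases rule: cceil_cases[where x = x])
    case ge
    then have "(cceil W x \<le> u) = (x \<le> u)" if "u \<in> U" for u
      using assms(1) that by (meson order_trans subsetD)
    then show ?thesis by (intro cceil_cong)
  next
    case wrap
    obtain m where m: "m \<in> U" "\<And>u. u \<in> U \<Longrightarrow> m \<le> u"
      using ex_least_in[OF assms(2)] by blast
    have "cceil U x = m" using wrap m assms(1) by (intro cceil_eqI_wrap) auto
    moreover have "cceil U (cceil W x) = m" using wrap m assms(1) by (intro cceil_eqI_ge) auto
    ultimately show ?thesis by simp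
  qed
qed

lemma cceil_Suc: "x \<notin> U \<Longrightarrow> cceil U (Suc x) = cceil U x"
proof -
  assume "x \<notin> U"
  then show ?thesis by (intro cceil_cong) (metis Suc_leD Suc_leI le_neq_implies_less)
qed

lemma cnext_in: "x \<in> U \<Longrightarrow> cnext U x \<in> U"
  unfolding cnext_def by (auto intro: cceil_in)

lemma cnext_out [simp]: "x \<notin> U \<Longrightarrow> cnext U x = x"
  unfolding cnext_def by auto

text \<open>Passing to a subset only skips points outside it, and a step that lands inside skips
  none.\<close>

lemma cnext_subset:
  assumes "W' \<subseteq> W" "x \<in> W'" "cnext W x \<in> W'"
  shows "cnext W' x = cnext W x"
  using assms cceil_cceil[of W' W "Suc x"] unfolding cnext_def by fastforce

text \<open>Multiplying the increasing cycle of \<open>W\<close> by the inverse of the increasing cycle of a subset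
  \<open>U\<close> cuts \<open>W\<close> into the cyclic arcs of \<open>W\<close> that end in the elements of \<open>U\<close>.\<close>

lemma cnext_split:
  assumes "U \<subseteq> W" "U \<noteq> {}" "x \<in> W"
  shows "cnext W x = cnext {v \<in> W. cceil U v = cceil U (cnext U x)} (cnext U x)"
proof (cases "x \<in> U")
  case False
  have 1: "cceil U (cnext W x) = cceil U x"
    using cceil_cceil[OF assms(1,2), of "Suc x"] cceil_Suc[OF False] assms(3)
    by (simp add: cnext_def)
  then show ?thesis
    using False assms cnext_in[of x W]
    by (intro cnext_subset[symmetric, of _ W x, THEN trans]) auto
next
  case True
  define s where "s = cceil U (Suc x)"
  have nx: "cnext U x = s" using True by (simp add: cnext_def s_def)
  have sU: "s \<in> U" unfolding s_def using assms cceil_in by blast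
  define y where "y = cceil W (Suc x)"
  have yW: "y \<in> W" unfolding y_def using assms cceil_in by blast
  have ys: "cceil U y = s" unfolding y_def s_def using cceil_cceil[OF assms(1,2)] by simp
  define Ws where "Ws = {v \<in> W. cceil U v = s}"
  have yWs: "y \<in> Ws" using yW ys Ws_def by auto
  have sWs: "s \<in> Ws" using sU assms Ws_def by auto
  have "cceil Ws (Suc x) = y"
    using cceil_cceil[of Ws W "Suc x"] cceil_self[OF yWs] yWs Ws_def y_def by fastforce
  \<comment> \<open>The arc \<open>Ws\<close> begins after \<open>x\<close> and ends in
    \<open>s\<close>, so on the way round from \<open>s\<close> to \<open>x\<close> none of its
    points is met, and both searches find its first point. The two cases say whether or not
    \<open>s\<close> is reached from \<open>x\<close> by passing the top.\<close>
  moreover have "cceil Ws (Suc s) = cceil Ws (Suc x)"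
    using assms(2)
  proof (cases rule: cceil_cases[where x = "Suc x"])
    case ge
    have a: "Suc x \<le> w \<and> w \<le> s" if "w \<in> Ws" for w
    proof -
      have w: "cceil U w = s" using that Ws_def by auto
      show ?thesis using assms(2)
      proof (cases rule: cceil_cases[where x = w])
        case ge': ge
        then have "\<not> w \<le> x" using ge True w s_def by fastforce
        then show ?thesis using ge' w by simp
      next
        case wrap
        then have "s \<le> x" using True w by auto
        then show ?thesis using ge by (simp add: s_def[symmetric])
      qed
    qed
    obtain m where m: "m \<in> Ws" "\<And>w. w \<in> Ws \<Longrightarrow> m \<le> w"
      using ex_least_in[of Ws] yWs by blast
    have "cceil Ws (Suc s) = m" using m a by (intro cceil_eqI_wrap) (auto simp: less_Suc_eq_le)
    moreover have "cceil Ws (Suc x) = m" using m a by (intro cceil_eqI_ge) auto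
    ultimately show ?thesis by simp
  next
    case wrap
    have a: "w \<le> s \<or> Suc x \<le> w" if "w \<in> Ws" for w
    proof -
      have w: "cceil U w = s" using that Ws_def by auto
      show ?thesis using assms(2)
      proof (cases rule: cceil_cases[where x = w])
        case wrap
        then show ?thesis using True by (simp add: Suc_leI)
      qed (use w in simp)
    qed
    have "s \<le> x" using wrap True s_def by auto
    then have "(Suc s \<le> w) = (Suc x \<le> w)" if "w \<in> Ws" for w using a[OF that] by auto
    then show ?thesis by (rule cceil_cong)
  qed
  ultimately have "cnext Ws s = y" using sWs by (simp add: cnext_def)
  then show ?thesis
    using assms(3) sU unfolding nx Ws_def y_def by (simp add: cnext_def)
qed

text \<open>Cut \<open>insert i U\<close> at \<open>U\<close>: all arcs are singletons except the
  one ending in \<open>j\<close>, which is \<open>{i, j}\<close>. So the correction is a single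
  transposition.\<close>

lemma cnext_insert:
  assumes "i \<notin> U" "cceil U i = j" "U \<noteq> {}"
  shows "cnext (insert i U) = transpose i j \<circ> cnext U"
proof
  fix x
  have jU: "j \<in> U" using assms cceil_in by blast
  then have ij: "i \<noteq> j" using assms by auto
  show "cnext (insert i U) x = (transpose i j \<circ> cnext U) x"
  proof (cases "x \<in> insert i U")
    case False
    then show ?thesis using jU by (auto simp: transpose_def)
  next
    case True
    define s where "s = cceil U (cnext U x)"
    have s: "s = j \<and> x = i \<or> x \<in> U \<and> s = cnext U x"
      using True assms cnext_in by (auto simp: s_def)
    have W: "{v \<in> insert i U. cceil U v = s} = (if s = j then {i,j} else {s})"
      using jU s assms cnext_in by auto
    have 2: "cnext {i,j} i = j \<and> cnext {i,j} j = i"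
    proof (cases "i < j")
      case True
      then show ?thesis
        by (auto simp: cnext_def intro!: cceil_eqI_ge[of j] cceil_eqI_wrap[of i])
    next
      case False
      then show ?thesis using ij
        by (auto simp: cnext_def intro!: cceil_eqI_ge[of i] cceil_eqI_wrap[of j])
    qed
    have 1: "cnext {s} s = s" unfolding cnext_def by (auto intro!: cceil_eqI_wrap)
    show ?thesis
      using cnext_split[OF subset_insertI assms(3) True] cnext_in[of x U] assms s ij 1 2
      unfolding s_def[symmetric] W by (auto simp: transpose_def split: if_splits)
  qed
qed

text \<open>This glues two increasing cycles at one vertex. All of \<open>U2\<close> sits in the arc
  of \<open>U1\<close> that ends in \<open>v\<close>, so cutting the union at \<open>U1\<close>
  leaves \<open>U2\<close> and singletons.\<close>

lemma cnext_union:
  assumes "U1 \<inter> U2 = {v}" "\<And>y. y \<in> U2 \<Longrightarrow> cceil U1 y = v"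
  shows "cnext (U1 \<union> U2) = cnext U2 \<circ> cnext U1"
proof
  fix x
  show "cnext (U1 \<union> U2) x = (cnext U2 \<circ> cnext U1) x"
  proof (cases "x \<in> U1 \<union> U2")
    case False
    then show ?thesis by simp
  next
    case True
    define s where "s = cceil U1 (cnext U1 x)"
    have W: "{w \<in> U1 \<union> U2. cceil U1 w = s} = (if s = v then U2 else {s} \<inter> U1)"
      using assms by (auto; metis cceil_self)
    have 1: "cnext ({s} \<inter> U1) s = s" unfolding cnext_def by (auto intro!: cceil_eqI_wrap)
    show ?thesis
    proof (cases "s = v")
      case True
      then show ?thesis using cnext_split[of U1 "U1 \<union> U2" x] \<open>x \<in> U1 \<union> U2\<close> assms(1)
        unfolding s_def[symmetric] W by auto
    next
      case False
      then have "x \<in> U1" using assms \<open>x \<in> U1 \<union> U2\<close> unfolding s_def by (metis UnE cnext_out)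
      then have s: "cnext U1 x = s" "s \<in> U1" using cnext_in by (auto simp: s_def)
      then have "s \<notin> U2" using False assms by auto
      then show ?thesis using cnext_split[of U1 "U1 \<union> U2" x] \<open>x \<in> U1 \<union> U2\<close> assms(1) False 1 s
        unfolding s_def[symmetric] W by auto
    qed
  qed
qed

text \<open>Transitivity of the increasing cycle: \<open>A\<close> contains whatever lies above one
  of its elements, hence the maximum, whose image is the minimum.\<close>

lemma cnext_closed_all:
  assumes "finite B" "A \<subseteq> B" "A \<noteq> {}" "\<And>x. x \<in> A \<Longrightarrow> cnext B x \<in> A"
  shows "A = B"
proof -
  have up: "b \<in> A" if "a \<in> A" "b \<in> B" "a \<le> b" for a b
    using that
  proof (induction b rule: less_induct)
    case (less b)
    show ?case
    proof (cases "a = b")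
      case False
      \<comment> \<open>\<open>Max C\<close> is the predecessor of \<open>b\<close> in
        \<open>B\<close>; it lies in \<open>A\<close> by induction, and the cycle carries it to
        \<open>b\<close>.\<close>
      define C where "C = {y \<in> B. y < b \<and> a \<le> y}"
      have fC: "finite C" "C \<noteq> {}" using assms(1,2) less False C_def by auto
      have m: "Max C \<in> C" using fC by simp
      have mb: "y \<le> Max C" if "y \<in> B" "y < b" for y
        using that fC m by (cases "a \<le> y") (auto simp: C_def)
      have "Max C \<in> A" using m less by (auto simp: C_def)
      moreover have "cnext B (Max C) = b"
        using m less(3) mb unfolding cnext_def
        by (auto simp: C_def intro!: cceil_eqI_ge) (metis C_def not_less_eq_eq not_le)
      ultimately show ?thesis using assms(4) by metis
    qed (use less in simp)
  qed
  have fB: "finite B" "B \<noteq> {}" using assms by auto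
  have "Max B \<in> A" using up[of _ "Max B"] assms fB by (metis Max_ge Max_in all_not_in_conv subsetD)
  moreover have "cnext B (Max B) = Min B" unfolding cnext_def
    using fB Max_in[OF fB] by (auto intro!: cceil_eqI_wrap Min_in simp: less_Suc_eq_le)
  ultimately have "Min B \<in> A" using assms(4) by metis
  then show ?thesis using up[of "Min B"] assms(2) fB by (meson Min_le subsetI subset_antisym)
qed

text \<open>\<open>cycle_of_list\<close> prepends an entry by a transposition with the next one,
  which is the shape of \<open>cnext_insert\<close>: the head lies below the rest, so its ceiling
  there is the second entry.\<close>

lemma cnext_eq_cycle_of_list:
  "sorted_wrt (<) xs \<Longrightarrow> cnext (set xs) = cycle_of_list xs"
proof (induction xs rule: cycle_of_list.induct)
  case (1 i j cs)
  then have "cceil (set (j#cs)) i = j" by (intro cceil_eqI_ge) auto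
  then have "cnext (insert i (set (j#cs))) = transpose i j \<circ> cnext (set (j#cs))"
    using 1 by (intro cnext_insert) auto
  then show ?case using 1 by simp
next
  case ("2_2" v)
  then show ?case by (auto simp: cnext_def fun_eq_iff intro!: cceil_eqI_wrap)
qed (auto simp: cnext_def)

section \<open>Minimal products of cycles\<close>

lemma prod_rl_Nil [simp]: "prod_rl [] = id"
  by (simp add: prod_rl_def)

lemma prod_rl_append: "prod_rl (xs @ ys) = prod_rl ys \<circ> prod_rl xs"
proof -
  have *: "fold (\<lambda>\<sigma> acc. \<sigma> \<circ> acc) ys g = prod_rl ys \<circ> g" for g :: "nat \<Rightarrow> nat"
    unfolding prod_rl_def
  proof (induction ys arbitrary: g)
    case (Cons y ys)
    show ?case using Cons[of "y \<circ> g"] Cons[of y] by (simp add: comp_assoc)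
  qed simp
  show ?thesis using *[of "prod_rl xs"] by (simp add: prod_rl_def)
qed

lemma prod_rl_Cons: "prod_rl (x # xs) = prod_rl xs \<circ> x"
  using prod_rl_append[of "[x]" xs] by (simp add: prod_rl_def)

text \<open>The rank bound, with the values of \<open>f\<close> in the role of components: making
  \<open>f\<close> constant on one more edge \<open>E\<close> merges at most \<open>card E\<close>
  values and so loses at most \<open>card E - 1\<close> of them.\<close>

lemma ex_monochromatic_labelling:
  assumes "finite V" "\<And>E. E \<in> set Es \<Longrightarrow> E \<subseteq> V \<and> E \<noteq> {}"
  shows "\<exists>f :: 'a \<Rightarrow> 'a. (\<forall>E\<in>set Es. \<forall>x\<in>E. \<forall>y\<in>E. f x = f y)
    \<and> card V \<le> card (f ` V) + (\<Sum>E\<leftarrow>Es. card E - 1)"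
  using assms(2)
proof (induction Es)
  case Nil
  then show ?case by (intro exI[of _ id]) auto
next
  case (Cons E Es)
  then obtain f :: "'a \<Rightarrow> 'a" where f: "\<forall>E\<in>set Es. \<forall>x\<in>E. \<forall>y\<in>E. f x = f y"
    "card V \<le> card (f ` V) + (\<Sum>E\<leftarrow>Es. card E - 1)" by auto
  obtain e where e: "e \<in> E" and EV: "E \<subseteq> V" using Cons.prems by auto
  define f' where "f' x = (if f x \<in> f ` E then f e else f x)" for x
  have fin: "finite E" using EV assms(1) finite_subset by blast
  have "insert (f e) (f ` V - f ` E) \<subseteq> f' ` V"
    using e EV by (auto simp: f'_def)
  then have "card (insert (f e) (f ` V - f ` E)) \<le> card (f' ` V)"
    using assms(1) by (intro card_mono) auto
  moreover have "card (insert (f e) (f ` V - f ` E)) = Suc (card (f ` V - f ` E))"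
    using e assms(1) by (intro card_insert_disjoint) auto
  moreover have "card (f ` V - f ` E) = card (f ` V) - card (f ` E)"
    using EV fin by (intro card_Diff_subset) auto
  moreover have "card (f ` E) \<le> card E" using fin card_image_le by blast
  moreover have "1 \<le> card (f ` E)" using e fin by (auto simp: Suc_le_eq card_gt_0_iff)
  ultimately have "card V \<le> card (f' ` V) + (\<Sum>E\<leftarrow>E # Es. card E - 1)"
    using f(2) by auto
  moreover have "\<forall>F\<in>set (E # Es). \<forall>x\<in>F. \<forall>y\<in>F. f' x = f' y"
    using f(1) unfolding f'_def by (metis image_eqI set_ConsD)
  ultimately show ?case by blast
qed

text \<open>One increasing cycle on each label class: the form of the product that is left after
  factors have been peeled off.\<close>

definition block_perm :: "nat set \<Rightarrow> (nat \<Rightarrow> 'a) \<Rightarrow> nat \<Rightarrow> nat" where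
  "block_perm V \<pi> x = cnext {v \<in> V. \<pi> v = \<pi> x} x"

lemma prod_rl_invariant:
  assumes "\<And>\<sigma> x. \<sigma> \<in> set fs \<Longrightarrow> f (\<sigma> x) = f x"
  shows "f (prod_rl fs x) = f x"
  using assms
proof (induction fs arbitrary: x)
  case (Cons \<sigma> fs)
  then show ?case by (simp add: prod_rl_Cons)
qed simp

text \<open>A labelling that is constant on every factor is constant on the cycles of the product; by
  minimality it has as many values as there are cycles, so each factor stays within one cycle.\<close>

lemma factor_in_block:
  fixes \<pi> :: "nat \<Rightarrow> 'a"
  assumes "finite V" "\<And>cs. cs \<in> set css \<Longrightarrow> set cs \<subseteq> V \<and> cs \<noteq> []"
    and "prod_rl (map cycle_of_list css) = block_perm V \<pi>"
    and "(\<Sum>cs\<leftarrow>css. length cs - 1) + card (\<pi> ` V) \<le> card V"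
    and "cs \<in> set css" "x \<in> set cs" "y \<in> set cs"
  shows "\<pi> x = \<pi> y"
proof -
  obtain f :: "nat \<Rightarrow> nat" where f: "\<forall>E\<in>set (map set css). \<forall>x\<in>E. \<forall>y\<in>E. f x = f y"
    and c: "card V \<le> card (f ` V) + (\<Sum>E\<leftarrow>map set css. card E - 1)"
    using ex_monochromatic_labelling[OF assms(1), of "map set css"] assms(2) by auto
  have "(\<Sum>E\<leftarrow>map set css. card E - 1) \<le> (\<Sum>cs\<leftarrow>css. length cs - 1)"
    by (induction css) (auto intro!: add_mono diff_le_mono card_length)
  then have cge: "card (\<pi> ` V) \<le> card (f ` V)" using c assms(4) by linarith
  have inv: "f (block_perm V \<pi> x) = f x" for x
  proof -
    have "f (\<sigma> x) = f x" if \<sigma>: "\<sigma> \<in> set (map cycle_of_list css)" for \<sigma> x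
    proof -
      obtain cs where cs: "cs \<in> set css" "\<sigma> = cycle_of_list cs" using \<sigma> by auto
      show ?thesis
      proof (cases "x \<in> set cs")
        case True
        then have "\<sigma> x \<in> set cs" using cycle_permutes[of cs] cs permutes_in_image by metis
        moreover have "set cs \<in> set (map set css)" using cs by simp
        ultimately show ?thesis using f True by blast
      qed (use cs in \<open>simp add: id_outside_supp\<close>)
    qed
    then show ?thesis using prod_rl_invariant[of "map cycle_of_list css" f] assms(3) by metis
  qed
  have const: "f v = f w" if "v \<in> V" "w \<in> V" "\<pi> v = \<pi> w" for v w
  proof -
    define B where "B = {u \<in> V. \<pi> u = \<pi> w}"
    have "{u \<in> B. f u = f w} = B"
    proof (rule cnext_closed_all)
      fix u assume u: "u \<in> {u \<in> B. f u = f w}"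
      then have "B = {v \<in> V. \<pi> v = \<pi> u}" by (auto simp: B_def)
      then have "cnext B u = block_perm V \<pi> u" by (simp add: block_perm_def)
      then show "cnext B u \<in> {u \<in> B. f u = f w}" using inv[of u] u cnext_in[of u B] by simp
    qed (use assms(1) that in \<open>auto simp: B_def\<close>)
    then show ?thesis using that by (auto simp: B_def)
  qed
  \<comment> \<open>\<open>f\<close> factors through \<open>\<pi>\<close> as \<open>g\<close>. Since
    \<open>g\<close> maps the values of \<open>\<pi>\<close> onto those of \<open>f\<close>, which
    are at least as many, it is injective, and equal values of \<open>f\<close> force equal
    labels.\<close>
  define g where "g l = f (SOME v. v \<in> V \<and> \<pi> v = l)" for l
  have g: "g (\<pi> v) = f v" if "v \<in> V" for v
  proof -
    have "(SOME u. u \<in> V \<and> \<pi> u = \<pi> v) \<in> V \<and> \<pi> (SOME u. u \<in> V \<and> \<pi> u = \<pi> v) = \<pi> v"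
      by (rule someI[of _ v]) (use that in auto)
    then show ?thesis unfolding g_def using const that by metis
  qed
  have "g ` \<pi> ` V = f ` V" using g by (auto simp: image_image)
  then have "card (g ` \<pi> ` V) = card (\<pi> ` V)"
    using cge card_image_le[of "\<pi> ` V" g] assms(1) by auto
  then have inj: "inj_on g (\<pi> ` V)" using assms(1) by (intro eq_card_imp_inj_on) auto
  have xy: "x \<in> V" "y \<in> V" using assms(2)[OF assms(5)] assms(6,7) by auto
  have "set cs \<in> set (map set css)" using assms(5) by simp
  then have "f x = f y" using f assms(6,7) by blast
  then show ?thesis using g xy inj by (metis image_eqI inj_onD)
qed

text \<open>Labels are lists so that labellings can be refined repeatedly at the same type.\<close>

definition split_label :: "(nat \<Rightarrow> nat list) \<Rightarrow> nat set \<Rightarrow> nat \<Rightarrow> nat list" where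
  "split_label \<pi> U v = (if \<pi> v \<in> \<pi> ` U then cceil U v else 0) # \<pi> v"

text \<open>Only the block containing \<open>U\<close> is cut, by \<open>cnext_split\<close>. On any
  other block the prepended entry is the constant 0, and the old label in the tail keeps the blocks
  apart.\<close>

lemma block_perm_split:
  assumes "U \<subseteq> V" "U \<noteq> {}" "\<And>x y. x \<in> U \<Longrightarrow> y \<in> U \<Longrightarrow> \<pi> x = \<pi> y"
  shows "block_perm V \<pi> = block_perm V (split_label \<pi> U) \<circ> cnext U"
proof
  fix x
  show "block_perm V \<pi> x = (block_perm V (split_label \<pi> U) \<circ> cnext U) x"
  proof (cases "x \<in> V \<and> \<pi> x \<in> \<pi> ` U")
    case False
    then have x: "x \<notin> U" using assms(1) by auto
    show ?thesis
    proof (cases "x \<in> V")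
      case True
      then have "{v \<in> V. split_label \<pi> U v = split_label \<pi> U x} = {v \<in> V. \<pi> v = \<pi> x}"
        using False by (auto simp: split_label_def) (metis image_eqI)
      then show ?thesis using x by (simp add: block_perm_def)
    next
      case F: False
      then have "x \<notin> {v \<in> V. \<pi> v = \<pi> x}" "x \<notin> {v \<in> V. split_label \<pi> U v = split_label \<pi> U x}" by auto
      then show ?thesis using x unfolding block_perm_def by simp
    qed
  next
    case True
    define W where "W = {v \<in> V. \<pi> v = \<pi> x}"
    obtain u where u: "u \<in> U" "\<pi> x = \<pi> u" using True by auto
    have UW: "U \<subseteq> W"
    proof
      fix w assume "w \<in> U"
      then show "w \<in> W" using assms(1) assms(3)[of w u] u by (auto simp: W_def)
    qed
    have xW: "x \<in> W" using True by (simp add: W_def)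
    define y where "y = cnext U x"
    have yW: "y \<in> W" using UW xW cnext_in[of x U] by (cases "x \<in> U") (auto simp: y_def)
    have "{v \<in> V. split_label \<pi> U v = split_label \<pi> U y} = {v \<in> W. cceil U v = cceil U y}"
      using True yW by (auto simp: split_label_def W_def)
    then show ?thesis
      using cnext_split[OF UW assms(2) xW] unfolding block_perm_def W_def[symmetric] y_def[symmetric]
      by (simp add: y_def block_perm_def)
  qed
qed

text \<open>One block breaks into at most \<open>card U\<close> arcs. The gain of at most
  \<open>card U - 1\<close> blocks is what removing the factor releases in the rank sum.\<close>

lemma card_split_label:
  assumes "finite V" "U \<subseteq> V" "U \<noteq> {}" "\<And>x y. x \<in> U \<Longrightarrow> y \<in> U \<Longrightarrow> \<pi> x = \<pi> y"
  shows "card (split_label \<pi> U ` V) + 1 \<le> card (\<pi> ` V) + card U"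
proof -
  obtain u where u: "u \<in> U" using assms(3) by auto
  have "\<pi> ` U = (\<lambda>_. \<pi> u) ` U" using assms(4)[OF _ u] by (rule image_cong[OF refl])
  then have pU: "\<pi> ` U = {\<pi> u}" using u by (simp add: image_constant_conv) blast
  have "split_label \<pi> U ` V \<subseteq> Cons 0 ` (\<pi> ` V - {\<pi> u}) \<union> (\<lambda>w. w # \<pi> u) ` U"
    using cceil_in[OF assms(3)] by (auto simp: split_label_def pU)
  moreover have fin: "finite U" using assms(1,2) finite_subset by auto
  ultimately have "card (split_label \<pi> U ` V)
      \<le> card (Cons (0::nat) ` (\<pi> ` V - {\<pi> u}) \<union> (\<lambda>w. w # \<pi> u) ` U)"
    using assms(1) by (intro card_mono) auto
  also have "\<dots> \<le> card (Cons (0::nat) ` (\<pi> ` V - {\<pi> u})) + card ((\<lambda>w. w # \<pi> u) ` U)"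
    by (rule card_Un_le)
  also have "\<dots> \<le> card (\<pi> ` V - {\<pi> u}) + card U"
    using assms(1) fin by (intro add_mono card_image_le) auto
  finally have "card (split_label \<pi> U ` V) \<le> card (\<pi> ` V - {\<pi> u}) + card U" .
  moreover have "card (\<pi> ` V) = Suc (card (\<pi> ` V - {\<pi> u}))"
    using assms(1,2) u by (intro card.remove) auto
  ultimately show ?thesis by simp
qed

text \<open>The two invariants of all later inductions, a block permutation as product and the rank
  inequality, survive the removal of an increasing first factor. The product follows by cancelling
  that factor, which is surjective.\<close>

lemma peel_increasing_cycle:
  assumes "finite V" "set cs \<subseteq> V" "distinct cs" "cs \<noteq> []"
    and "\<And>ds. ds \<in> set css \<Longrightarrow> set ds \<subseteq> V \<and> ds \<noteq> []"
    and "prod_rl (map cycle_of_list (cs # css)) = block_perm V \<pi>"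
    and "(\<Sum>cs\<leftarrow>cs # css. length cs - 1) + card (\<pi> ` V) \<le> card V"
    and "cycle_of_list cs = cnext (set cs)"
  shows "prod_rl (map cycle_of_list css) = block_perm V (split_label \<pi> (set cs))"
    and "(\<Sum>cs\<leftarrow>css. length cs - 1) + card (split_label \<pi> (set cs) ` V) \<le> card V"
proof -
  have mono: "\<pi> x = \<pi> y" if "x \<in> set cs" "y \<in> set cs" for x y
    by (rule factor_in_block[OF assms(1) _ assms(6,7), of cs]) (use assms(2,4,5) that in auto)
  have ne: "set cs \<noteq> {}" using assms by auto
  have eq: "prod_rl (map cycle_of_list css) \<circ> cycle_of_list cs
      = block_perm V (split_label \<pi> (set cs)) \<circ> cycle_of_list cs"
    using block_perm_split[OF assms(2) ne mono] assms(6,8) by (simp add: prod_rl_Cons)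
  have surj: "surj (cycle_of_list cs)" using permutes_surj[OF cycle_permutes] .
  show "prod_rl (map cycle_of_list css) = block_perm V (split_label \<pi> (set cs))"
  proof
    fix x
    obtain z where "x = cycle_of_list cs z" using surjD[OF surj] by blast
    then show "prod_rl (map cycle_of_list css) x = block_perm V (split_label \<pi> (set cs)) x"
      using fun_cong[OF eq, of z] by simp
  qed
  show "(\<Sum>cs\<leftarrow>css. length cs - 1) + card (split_label \<pi> (set cs) ` V) \<le> card V"
  proof -
    have "1 \<le> length cs" using assms(4) by (cases cs) auto
    moreover have "card (split_label \<pi> (set cs) ` V) + 1 \<le> card (\<pi> ` V) + length cs"
      using card_split_label[of V "set cs" \<pi>, OF assms(1,2) ne mono]
      by (simp add: distinct_card[OF assms(3)])
    moreover have "(length cs - 1) + (\<Sum>cs\<leftarrow>css. length cs - 1) + card (\<pi> ` V) \<le> card V"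
      using assms(7) by simp
    ultimately show ?thesis by linarith
  qed
qed

text \<open>The induction shortens the cycle by moving a transposition into the list of remaining
  factors, where minimality speaks about it. The tail \<open>j # cs\<close> is then increasing by
  induction, and the transposition must fit into one of its arcs, which places \<open>i\<close> just
  where \<open>cnext_insert\<close> wants it.\<close>

lemma cycle_of_list_eq_cnext:
  fixes \<pi> :: "nat \<Rightarrow> nat list"
  assumes "finite V" "set cs \<subseteq> V" "distinct cs" "cs \<noteq> []"
    and "\<And>ds. ds \<in> set css \<Longrightarrow> set ds \<subseteq> V \<and> ds \<noteq> []"
    and "prod_rl (map cycle_of_list (cs # css)) = block_perm V \<pi>"
    and "(\<Sum>cs\<leftarrow>cs # css. length cs - 1) + card (\<pi> ` V) \<le> card V"
  shows "cycle_of_list cs = cnext (set cs)"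
  using assms(2-7)
proof (induction cs arbitrary: css rule: cycle_of_list.induct)
  case (1 i j cs)
  \<comment> \<open>The cycle \<open>i # j # cs\<close> is the cycle \<open>j # cs\<close> followed
    by the transposition of \<open>i\<close> and \<open>j\<close>; this replacement changes neither
    the product nor the rank sum.\<close>
  let ?css = "[i, j] # css" and ?U = "set (j # cs)"
  have p1: "set (j # cs) \<subseteq> V" "distinct (j # cs)" "j # cs \<noteq> []" using 1(2,3) by auto
  have p2: "set ds \<subseteq> V \<and> ds \<noteq> []" if "ds \<in> set ?css" for ds
    using that 1(2) 1(5)[of ds] by auto
  have p3: "prod_rl (map cycle_of_list ((j # cs) # ?css)) = block_perm V \<pi>"
    using 1(6) by (simp only: list.map prod_rl_Cons cycle_of_list.simps comp_assoc comp_id)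
  have p4: "(\<Sum>cs\<leftarrow>(j # cs) # ?css. length cs - 1) + card (\<pi> ` V) \<le> card V"
    using 1(7) by simp
  note p = p1 p2 p3 p4
  have IH: "cycle_of_list (j # cs) = cnext ?U" using 1(1)[OF p] .
  \<comment> \<open>With \<open>j # cs\<close> peeled off, the transposition is a factor of the rest
    and stays in one block. As \<open>j\<close> is the end of its own arc, \<open>i\<close> lies in
    the arc ending in \<open>j\<close>.\<close>
  have "split_label \<pi> ?U i = split_label \<pi> ?U j"
    using factor_in_block[OF assms(1) p2 peel_increasing_cycle[OF assms(1) p IH], of "[i,j]"] by auto
  then have "cceil ?U i = j" by (auto simp: split_label_def split: if_splits)
  then have "cnext (insert i ?U) = transpose i j \<circ> cnext ?U"
    using 1(3) by (intro cnext_insert) auto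
  then show ?case using IH by simp
next
  case ("2_2" v)
  show ?case using cnext_eq_cycle_of_list[of "[v]"] by simp
next
  case "2_1"
  show ?case using "2_1"(3) by simp
qed

text \<open>\<open>U'\<close> lies in a single arc of the circle cut after the points of \<open>U\<close>. For two factors, first \<open>U\<close> and
  then \<open>U'\<close>, this says that they do not cross and records their order around a common vertex.\<close>

definition in_arc :: "nat set \<Rightarrow> nat set \<Rightarrow> bool" where
  "in_arc U U' \<longleftrightarrow> (\<forall>x\<in>U'. \<forall>y\<in>U'. cceil U x = cceil U y)"

text \<open>Arcs of \<open>U\<close> are cyclic intervals: between two points of the arc ending in
  \<open>s'\<close> there is a way that meets no point of an arc with another end, hence no point of
  \<open>A\<close>.\<close>

lemma cceil_const_off_arc:
  assumes "U \<noteq> {}" "\<And>a. a \<in> A \<Longrightarrow> cceil U a = s" "cceil U x = s'" "cceil U y = s'" "s \<noteq> s'"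
  shows "cceil A x = cceil A y"
  using assms(3,4)
proof (induction x y rule: linorder_wlog)
  case (le x y)
  show ?case
  proof (cases "\<exists>u\<in>U. x \<le> u \<and> u < y")
    case False
    have "a \<notin> A" if "x \<le> a" "a < y" for a
    proof
      assume "a \<in> A"
      have "cceil U a = cceil U y" using False that by (intro cceil_cong) force
      then show False using assms(2)[OF \<open>a \<in> A\<close>] le assms(5) by simp
    qed
    then show ?thesis using le(1) by (intro cceil_cong) force
  next
    case True
    then obtain u where u: "u \<in> U" "x \<le> u" "u < y" by blast
    \<comment> \<open>With a point of \<open>U\<close> between \<open>x\<close> and
      \<open>y\<close>, the arc ending in \<open>s'\<close> passes the top of the circle:
      \<open>s'\<close> is the least element of \<open>U\<close> and \<open>y\<close> exceeds all of
      \<open>U\<close>. Then all of \<open>A\<close> lies between \<open>x\<close> and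
      \<open>y\<close>, and both searches find its minimum.\<close>
    have s'y: "s' < y" using assms(1)
    proof (cases rule: cceil_cases[where x = x])
      case ge
      then show ?thesis using u le by (metis le_less_trans)
    qed (use u in force)
    have m: "\<And>v. v \<in> U \<Longrightarrow> s' \<le> v" and y: "\<And>v. v \<in> U \<Longrightarrow> v < y"
      using assms(1) by (cases rule: cceil_cases[where x = y]; use le s'y in force)+
    have s'U: "s' \<in> U" using le cceil_in[OF assms(1)] by metis
    have xs': "x \<le> s'" using assms(1)
      by (cases rule: cceil_cases[where x = x]) (use u le in force)+
    have A: "x \<le> a \<and> a < y" if "a \<in> A" for a
    proof (rule ccontr)
      assume "\<not> (x \<le> a \<and> a < y)"
      then consider "a < x" | "y \<le> a" by linarith
      then have "cceil U a = s'"
      proof cases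
        case 1
        then show ?thesis using m s'U xs' by (intro cceil_eqI_ge) auto
      next
        case 2
        then show ?thesis using m s'U y by (intro cceil_eqI_wrap) force+
      qed
      then show False using assms(2)[OF that] assms(5) by simp
    qed
    show ?thesis
    proof (cases "A = {}")
      case False
      then obtain b where b: "b \<in> A" "\<And>a. a \<in> A \<Longrightarrow> b \<le> a" using ex_least_in by metis
      have "cceil A x = b" using A b by (intro cceil_eqI_ge) auto
      moreover have "cceil A y = b" using A b by (intro cceil_eqI_wrap) auto
      ultimately show ?thesis by simp
    qed (simp add: cceil_def)
  qed
qed auto

text \<open>The order is asserted only for factors in a common block, a form that survives
  refinement of the labels. A later factor in the block of the first one stays in one of its arcs.
  Two later factors either remain in a common block, where induction applies, or have been separated
  by the first factor.\<close>

lemma minimal_factors_in_arcs: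
  fixes \<pi> :: "nat \<Rightarrow> nat list"
  assumes "finite V" "\<And>cs. cs \<in> set css \<Longrightarrow> set cs \<subseteq> V \<and> distinct cs \<and> cs \<noteq> []"
    and "prod_rl (map cycle_of_list css) = block_perm V \<pi>"
    and "(\<Sum>cs\<leftarrow>css. length cs - 1) + card (\<pi> ` V) \<le> card V"
  shows "(\<forall>cs\<in>set css. cycle_of_list cs = cnext (set cs)) \<and>
    sorted_wrt (\<lambda>cs ds. (\<forall>x\<in>set cs. \<forall>y\<in>set ds. \<pi> x = \<pi> y) \<longrightarrow> in_arc (set cs) (set ds)) css"
  using assms(2-4)
proof (induction css arbitrary: \<pi>)
  case (Cons cs css)
  let ?U = "set cs" and ?\<pi> = "split_label \<pi> (set cs)"
  have cs: "set cs \<subseteq> V" "distinct cs" "cs \<noteq> []" using Cons.prems(1) by auto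
  have css: "\<And>ds. ds \<in> set css \<Longrightarrow> set ds \<subseteq> V \<and> ds \<noteq> []" using Cons.prems(1) by auto
  have eq: "cycle_of_list cs = cnext ?U"
    using cycle_of_list_eq_cnext[OF assms(1) cs css Cons.prems(2,3)] .
  note rest = peel_increasing_cycle[OF assms(1) cs css Cons.prems(2,3) eq]
  have IH: "(\<forall>cs\<in>set css. cycle_of_list cs = cnext (set cs)) \<and>
    sorted_wrt (\<lambda>cs ds. (\<forall>x\<in>set cs. \<forall>y\<in>set ds. ?\<pi> x = ?\<pi> y) \<longrightarrow> in_arc (set cs) (set ds)) css"
    using Cons.IH[OF _ rest] Cons.prems(1) by auto
  have mono': "?\<pi> x = ?\<pi> y" if "ds \<in> set css" "x \<in> set ds" "y \<in> set ds" for ds x y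
    using factor_in_block[OF assms(1) css rest that] .
  have mono: "\<pi> x = \<pi> y" if "x \<in> ?U" "y \<in> ?U" for x y
    by (rule factor_in_block[OF assms(1) _ Cons.prems(2,3), of cs]) (use cs css that in auto)
  obtain u where u: "u \<in> ?U" using cs by (cases cs) auto
  have arcU: "in_arc ?U (set ds)"
    if "ds \<in> set css" "\<forall>x\<in>?U. \<forall>y\<in>set ds. \<pi> x = \<pi> y" for ds
    unfolding in_arc_def
  proof (intro ballI)
    fix x y assume xy: "x \<in> set ds" "y \<in> set ds"
    have "\<pi> x \<in> \<pi> ` ?U" "\<pi> y \<in> \<pi> ` ?U" using that(2) xy u by (metis image_eqI)+
    then show "cceil ?U x = cceil ?U y" using mono'[OF that(1) xy] by (simp add: split_label_def)
  qed
  have arc: "in_arc (set ds) (set es)"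
    if ds: "ds \<in> set css" and es: "es \<in> set css"
      and h: "(\<forall>x\<in>set ds. \<forall>y\<in>set es. ?\<pi> x = ?\<pi> y) \<longrightarrow> in_arc (set ds) (set es)"
      and same: "\<forall>x\<in>set ds. \<forall>y\<in>set es. \<pi> x = \<pi> y" for ds es
  proof (cases "\<forall>x\<in>set ds. \<forall>y\<in>set es. ?\<pi> x = ?\<pi> y")
    case False
    then obtain d e where de: "d \<in> set ds" "e \<in> set es" "?\<pi> d \<noteq> ?\<pi> e" by blast
    have "\<pi> d = \<pi> e" using same de by auto
    then have W: "\<pi> d \<in> \<pi> ` ?U" and ne: "cceil ?U d \<noteq> cceil ?U e"
      using de(3) by (auto simp: split_label_def split: if_splits)
    have d: "cceil ?U a = cceil ?U d" if "a \<in> set ds" for a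
      using mono'[OF ds that de(1)] W by (auto simp: split_label_def split: if_splits)
    have e: "cceil ?U a = cceil ?U e" if "a \<in> set es" for a
      using mono'[OF es that de(2)] W \<open>\<pi> d = \<pi> e\<close> by (auto simp: split_label_def split: if_splits)
    have "?U \<noteq> {}" using u by auto
    \<comment> \<open>The two factors lie in different arcs of the first factor, so neither can
      separate points of the other.\<close>
    then show ?thesis unfolding in_arc_def
      using cceil_const_off_arc[of ?U "set ds" "cceil ?U d" _ "cceil ?U e"] d e ne by metis
  qed (use h in simp)
  have "sorted_wrt (\<lambda>cs ds. (\<forall>x\<in>set cs. \<forall>y\<in>set ds. \<pi> x = \<pi> y) \<longrightarrow> in_arc (set cs) (set ds)) css"
    by (rule sorted_wrt_mono_rel[OF _ IH[THEN conjunct2]]) (use arc in blast)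
  then show ?case using IH eq arcU by auto
qed simp

lemma block_perm_const: "block_perm V (\<lambda>_. c) = cnext V"
  by (simp add: block_perm_def fun_eq_iff)

text \<open>Minimal factorizations recorded by the supports of their factors, the factor at the head
  acting first. Supports suffice because all factors are increasing cycles.\<close>

definition min_fact :: "nat set \<Rightarrow> nat set list \<Rightarrow> bool" where
  "min_fact V Es \<longleftrightarrow> (\<forall>E\<in>set Es. E \<subseteq> V \<and> 2 \<le> card E) \<and> prod_rl (map cnext Es) = cnext V
    \<and> (\<Sum>E\<leftarrow>Es. card E - 1) + 1 = card V"

lemma cycles_min_fact:
  assumes "finite V" "\<And>cs. cs \<in> set css \<Longrightarrow> set cs \<subseteq> V \<and> distinct cs \<and> 2 \<le> length cs"
    and "prod_rl (map cycle_of_list css) = cnext V"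
    and "(\<Sum>cs\<leftarrow>css. length cs - 1) + 1 = card V"
  shows "map cycle_of_list css = map cnext (map set css)" "min_fact V (map set css)"
    "sorted_wrt in_arc (map set css)"
proof -
  \<comment> \<open>The constant labelling has the single block \<open>V\<close>, so the restriction
    to a common block becomes vacuous.\<close>
  define \<pi> :: "nat \<Rightarrow> nat list" where "\<pi> = (\<lambda>_. [])"
  have "card (\<pi> ` V) \<le> 1" by (simp add: \<pi>_def card_insert_le_m1 image_constant_conv)
  then have *: "(\<forall>cs\<in>set css. cycle_of_list cs = cnext (set cs)) \<and>
    sorted_wrt (\<lambda>cs ds. (\<forall>x\<in>set cs. \<forall>y\<in>set ds. \<pi> x = \<pi> y) \<longrightarrow> in_arc (set cs) (set ds)) css"
    using assms by (intro minimal_factors_in_arcs[OF assms(1)]) (auto simp: \<pi>_def block_perm_const, force)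
  then show eq: "map cycle_of_list css = map cnext (map set css)" by auto
  show "sorted_wrt in_arc (map set css)" using * by (simp add: \<pi>_def sorted_wrt_map)
  have "(\<Sum>cs\<leftarrow>css. card (set cs) - 1) = (\<Sum>cs\<leftarrow>css. length cs - 1)"
    using assms(2) by (intro arg_cong[where f=sum_list] map_cong) (auto simp: distinct_card)
  then show "min_fact V (map set css)"
    using assms eq unfolding min_fact_def by (auto simp: distinct_card comp_def)
qed

lemma min_fact_sorted:
  assumes "finite V" "min_fact V Es"
  shows "sorted_wrt in_arc Es"
proof -
  define css where "css = map sorted_list_of_set Es"
  have fin: "finite E" "E \<subseteq> V" "2 \<le> card E" if "E \<in> set Es" for E
    using assms that finite_subset by (auto simp: min_fact_def)
  have 1: "map set css = Es" using fin by (auto simp: css_def comp_def intro!: map_idI)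
  have c: "cycle_of_list (sorted_list_of_set E) = cnext E" if "E \<in> set Es" for E
    using cnext_eq_cycle_of_list[of "sorted_list_of_set E"] fin[OF that] by simp
  have "prod_rl (map cycle_of_list css) = cnext V"
  proof -
    have "map cycle_of_list css = map cnext Es" using c by (auto simp: css_def)
    then show ?thesis using assms(2) by (simp add: min_fact_def)
  qed
  moreover have "set cs \<subseteq> V \<and> distinct cs \<and> 2 \<le> length cs" if "cs \<in> set css" for cs
    using that fin by (fastforce simp: css_def)
  moreover have "(\<Sum>cs\<leftarrow>css. length cs - 1) = (\<Sum>E\<leftarrow>Es. card E - 1)"
    by (simp add: css_def comp_def)
  ultimately show ?thesis
    using cycles_min_fact(3)[OF assms(1), of css] assms(2) unfolding 1 by (auto simp: min_fact_def)
qed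

lemma support_cnext:
  assumes "finite U" "2 \<le> card U"
  shows "{x. cnext U x \<noteq> x} = U"
proof -
  have "cnext U x \<noteq> x" if "x \<in> U" for x
  proof
    assume "cnext U x = x"
    then have "{x} = U" using that assms(1) by (intro cnext_closed_all) auto
    then show False using assms(2) by auto
  qed
  then show ?thesis using cnext_out by blast
qed

text \<open>Around a shared vertex \<open>v\<close> only one order is possible: given
  \<open>x\<close> in \<open>U\<close> and \<open>y\<close> in \<open>U'\<close>, both distinct from
  \<open>v\<close>, the one cyclically further below \<open>v\<close> meets the other before it
  meets \<open>v\<close>. So factors that may stand in either order are disjoint and
  commute.\<close>

lemma in_arc_disjoint:
  assumes "finite U" "finite U'" "2 \<le> card U" "2 \<le> card U'" "in_arc U U'" "in_arc U' U"
  shows "U \<inter> U' = {}"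
proof (rule ccontr)
  assume "U \<inter> U' \<noteq> {}"
  then obtain v where v: "v \<in> U" "v \<in> U'" by auto
  have other: "\<exists>x\<in>A. x \<noteq> v" if "2 \<le> card A" for A :: "nat set"
    using that by (metis card_2_iff' card_le_Suc0_iff_eq card.infinite not_less_eq_eq numeral_2_eq_2 zero_le)
  obtain x y where xy: "x \<in> U" "x \<noteq> v" "y \<in> U'" "y \<noteq> v" using other assms(3,4) by meson
  have 1: "cceil U y = v" using assms(5) v xy unfolding in_arc_def by (metis cceil_self)
  have 2: "cceil U' x = v" using assms(6) v xy unfolding in_arc_def by (metis cceil_self)
  have U: "U \<noteq> {}" and U': "U' \<noteq> {}" using v by auto
  from U 1 v xy have c1: "y \<le> v \<and> (x < y \<or> v \<le> x) \<or> (x < y \<and> v < y \<and> v \<le> x)"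
    by (cases rule: cceil_cases[where x = y]) force+
  from U' 2 v xy have c2: "x \<le> v \<and> (y < x \<or> v \<le> y) \<or> (y < x \<and> v < x \<and> v \<le> y)"
    by (cases rule: cceil_cases[where x = x]) force+
  have "x \<noteq> y" using 1 xy by auto
  then show False using c1 c2 xy by linarith
qed

lemma cnext_commute:
  assumes "U \<inter> U' = {}"
  shows "cnext U \<circ> cnext U' = cnext U' \<circ> cnext U"
proof
  fix x
  show "(cnext U \<circ> cnext U') x = (cnext U' \<circ> cnext U) x"
    using assms cnext_in[of x U] cnext_in[of x U']
    by (cases "x \<in> U"; cases "x \<in> U'") (simp_all add: disjoint_iff, (metis cnext_out)+)
qed

section \<open>Commutation classes\<close>

lemma comm_swap_Cons: "comm_swap\<^sup>*\<^sup>* fs gs \<Longrightarrow> comm_swap\<^sup>*\<^sup>* (f # fs) (f # gs)"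
proof (induction rule: rtranclp_induct)
  case (step gs hs)
  then obtain xs a b ys where "gs = xs @ [a, b] @ ys" "hs = xs @ [b, a] @ ys" "a \<circ> b = b \<circ> a"
    by (auto simp: comm_swap_def)
  then have "comm_swap (f # gs) (f # hs)" unfolding comm_swap_def
    by (metis append_Cons)
  then show ?case using step by simp
qed simp

lemma comm_swap_bubble:
  assumes "\<And>g. g \<in> set gs \<Longrightarrow> f \<circ> g = g \<circ> f"
  shows "comm_swap\<^sup>*\<^sup>* (f # gs @ hs) (gs @ f # hs)"
  using assms
proof (induction gs)
  case (Cons g gs)
  have "comm_swap (f # g # gs @ hs) (g # f # gs @ hs)" unfolding comm_swap_def
    by (rule exI[of _ "[]"], rule exI[of _ f], rule exI[of _ g], rule exI[of _ "gs @ hs"])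
      (use Cons.prems[of g] in \<open>simp add: comp_def\<close>)
  moreover have "comm_swap\<^sup>*\<^sup>* (g # f # gs @ hs) (g # gs @ f # hs)"
    using Cons by (intro comm_swap_Cons) auto
  ultimately show ?case by simp
qed simp

text \<open>The standard argument for partially commuting words. The elements in front of
  \<open>f\<close> in \<open>gs\<close> come after it in \<open>fs\<close>, so they are related to
  \<open>f\<close> in both directions and commute with it; \<open>f\<close> can be moved to the
  front.\<close>

lemma comm_swap_of_order:
  assumes "sorted_wrt R fs" "sorted_wrt R gs" "mset fs = mset gs"
    and "\<And>a b. a \<in> set fs \<Longrightarrow> b \<in> set fs \<Longrightarrow> R a b \<Longrightarrow> R b a \<Longrightarrow> a \<circ> b = b \<circ> a"
  shows "comm_swap\<^sup>*\<^sup>* fs gs"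
  using assms
proof (induction fs arbitrary: gs)
  case (Cons f fs)
  have "f \<in> set gs" using Cons.prems(3) by (metis list.set_intros(1) set_mset_mset)
  then obtain g1 g2 where gs: "gs = g1 @ f # g2" by (meson split_list)
  have m: "mset fs = mset (g1 @ g2)" using Cons.prems(3) gs by simp
  have s: "set fs = set (g1 @ g2)" using m by (metis set_mset_mset)
  have "comm_swap\<^sup>*\<^sup>* fs (g1 @ g2)"
    by (rule Cons.IH) (use Cons.prems gs m in \<open>auto simp: sorted_wrt_append\<close>)
  then have "comm_swap\<^sup>*\<^sup>* (f # fs) (f # g1 @ g2)" by (rule comm_swap_Cons)
  moreover have "comm_swap\<^sup>*\<^sup>* (f # g1 @ g2) (g1 @ f # g2)"
  proof (rule comm_swap_bubble)
    fix g assume "g \<in> set g1"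
    then show "f \<circ> g = g \<circ> f"
      using Cons.prems(1,2) gs s by (intro Cons.prems(4)) (auto simp: sorted_wrt_append)
  qed
  ultimately show ?case using gs by simp
qed simp

text \<open>A support occurring twice would lie in an arc of itself and thus be disjoint from
  itself.\<close>

lemma min_fact_distinct:
  assumes "finite V" "min_fact V Es"
  shows "distinct Es"
proof -
  have "\<not> in_arc E E" if "E \<in> set Es" for E
    using in_arc_disjoint[of E E] that assms finite_subset[of E V] by (auto simp: min_fact_def)
  then have "sorted_wrt (\<noteq>) Es"
    by (intro sorted_wrt_mono_rel[OF _ min_fact_sorted[OF assms]]) auto
  then show ?thesis by (induction Es) auto
qed

lemma min_fact_equiv:
  assumes "finite V" "min_fact V Es" "min_fact V Fs" "set Es = set Fs"
  shows "comm_swap\<^sup>*\<^sup>* (map cnext Es) (map cnext Fs)"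
proof -
  \<comment> \<open>Commutation concerns permutations while \<open>in_arc\<close> concerns supports;
    \<open>R\<close> recovers the support as the set of moved points.\<close>
  define R where "R f g = in_arc {x. f x \<noteq> x} {x. g x \<noteq> x}" for f g :: "nat \<Rightarrow> nat"
  have E: "finite E" "2 \<le> card E" "{x. cnext E x \<noteq> x} = E" if "E \<in> set Es" for E
    using that assms(1,2) finite_subset[of E V] support_cnext[of E] by (auto simp: min_fact_def)
  have R: "R (cnext E) (cnext F) = in_arc E F" if "E \<in> set Es" "F \<in> set Es" for E F
    using E[OF that(1)] E[OF that(2)] by (simp add: R_def)
  have s: "sorted_wrt R (map cnext Gs)" if "min_fact V Gs" "set Gs = set Es" for Gs
    unfolding sorted_wrt_map
    by (rule sorted_wrt_mono_rel[OF _ min_fact_sorted[OF assms(1) that(1)]]) (use R that in auto)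
  show ?thesis
  proof (rule comm_swap_of_order[of R])
    show "mset (map cnext Es) = mset (map cnext Fs)"
      using assms min_fact_distinct by (metis mset_map set_eq_iff_mset_eq_distinct)
  next
    fix a b assume "a \<in> set (map cnext Es)" "b \<in> set (map cnext Es)" and ab: "R a b" "R b a"
    then obtain E F where "E \<in> set Es" "F \<in> set Es" and e: "a = cnext E" "b = cnext F" by auto
    then have "E \<inter> F = {}" using E R ab by (intro in_arc_disjoint) auto
    then show "a \<circ> b = b \<circ> a" using e cnext_commute by simp
  qed (use s assms in auto)
qed

section \<open>Trees encoding factorizations\<close>

text \<open>A \<open>Leaf\<close> is a single vertex. In \<open>Node f t\<close> the forest
  \<open>f\<close> has one pair of trees for every vertex of the root polygon except the least one,
  and \<open>t\<close> holds the other polygons at the least vertex.\<close>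

datatype ctree = Leaf | Node cforest ctree
  and cforest = Empty | Grow ctree ctree cforest

primrec flen :: "cforest \<Rightarrow> nat" where
  "flen Empty = 0"
| "flen (Grow l r f) = Suc (flen f)"

primrec ttype :: "ctree \<Rightarrow> (nat \<Rightarrow>\<^sub>0 nat)" and ftype :: "cforest \<Rightarrow> (nat \<Rightarrow>\<^sub>0 nat)" where
  "ttype Leaf = 0"
| "ttype (Node f t) = Poly_Mapping.single (Suc (flen f)) 1 + ftype f + ttype t"
| "ftype Empty = 0"
| "ftype (Grow l r f) = ttype l + ttype r + ftype f"

text \<open>The condition on \<open>Node\<close> excludes polygons with only one vertex, that is,
  factors of length 1.\<close>

primrec twf :: "ctree \<Rightarrow> bool" and fwf :: "cforest \<Rightarrow> bool" where
  "twf Leaf = True"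
| "twf (Node f t) = (f \<noteq> Empty \<and> fwf f \<and> twf t)"
| "fwf Empty = True"
| "fwf (Grow l r f) = (twf l \<and> twf r \<and> fwf f)"

text \<open>The number of vertices of the encoded cactus; in a forest the vertex at which the two trees of a
  pair meet is counted once.\<close>

definition tsz :: "ctree \<Rightarrow> nat" where
  "tsz t = Suc (tweight (ttype t))"

definition fsz :: "cforest \<Rightarrow> nat" where
  "fsz f = flen f + tweight (ftype f)"

section \<open>Weights of type vectors and sizes of trees\<close>

lemma tweight_superset:
  assumes "finite A" "Poly_Mapping.keys \<alpha> \<subseteq> A"
  shows "tweight \<alpha> = (\<Sum>j\<in>A. (j - 1) * Poly_Mapping.lookup \<alpha> j)"
  unfolding tweight_def using assms
  by (intro sum.mono_neutral_left) (auto simp: in_keys_iff)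

lemma tweight_0 [simp]: "tweight 0 = 0"
  by (simp add: tweight_def)

lemma tweight_single [simp]: "tweight (Poly_Mapping.single j k) = (j - 1) * k"
  by (simp add: tweight_def)

lemma tweight_add [simp]: "tweight (\<alpha> + \<beta>) = tweight \<alpha> + tweight \<beta>"
proof -
  let ?A = "Poly_Mapping.keys \<alpha> \<union> Poly_Mapping.keys \<beta>"
  have "Poly_Mapping.keys (\<alpha> + \<beta>) \<subseteq> ?A" by (rule Poly_Mapping.keys_add)
  then show ?thesis
    using tweight_superset[of ?A "\<alpha> + \<beta>"] tweight_superset[of ?A \<alpha>] tweight_superset[of ?A \<beta>]
    by (simp add: lookup_add algebra_simps sum.distrib)
qed

lemma tsz_simps [simp]: "tsz Leaf = 1" "tsz (Node f t) = fsz f + tsz t"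
  by (simp_all add: tsz_def fsz_def)

lemma fsz_simps [simp]: "fsz Empty = 0" "fsz (Grow l r f) = tsz l + tsz r - 1 + fsz f"
  by (simp_all add: tsz_def fsz_def)

lemma tsz_pos: "0 < tsz t"
  by (simp add: tsz_def)

text \<open>The tree \<open>l\<close> occupies the first \<open>tsz l\<close> vertices and
  \<open>r\<close> starts at the last of these. That shared vertex, at index
  \<open>tsz l - 1\<close>, is the marked one, and the pair uses up \<open>tsz l + tsz r - 1\<close>
  vertices.\<close>

fun marks :: "cforest \<Rightarrow> nat list \<Rightarrow> nat set" where
  "marks Empty xs = {}"
| "marks (Grow l r f) xs = insert (xs ! (tsz l - 1)) (marks f (drop (tsz l + tsz r - 1) xs))"

text \<open>The factors of the factorization of the cycle \<open>xs\<close> encoded by a tree. In \<^term>\<open>Node f t\<close>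
  the first factor moving \<open>hd xs\<close> is the polygon on \<open>hd xs\<close> and the marked vertices of \<open>f\<close>; at
  each marked vertex hang a tree of earlier factors (on the vertices that follow) and a tree of
  later factors (on the vertices that precede).\<close>

fun polys :: "ctree \<Rightarrow> nat list \<Rightarrow> nat set list"
  and before :: "cforest \<Rightarrow> nat list \<Rightarrow> nat set list"
  and after :: "cforest \<Rightarrow> nat list \<Rightarrow> nat set list" where
  "polys Leaf xs = []"
| "polys (Node f t) xs = (let ys = take (fsz f) (tl xs) in
     before f ys @ [insert (hd xs) (marks f ys)] @ after f ys @ polys t (hd xs # drop (fsz f) (tl xs)))"
| "before Empty xs = []"
| "before (Grow l r f) xs =
     polys r (take (tsz r) (drop (tsz l - 1) xs)) @ before f (drop (tsz l + tsz r - 1) xs)"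
| "after Empty xs = []"
| "after (Grow l r f) xs = after f (drop (tsz l + tsz r - 1) xs) @ polys l (take (tsz l) xs)"

text \<open>From here on the vertex list is split explicitly instead of by \<open>take\<close> and
  \<open>drop\<close>; the original equations are then removed from the simplifier.\<close>

lemma polys_Node [simp]:
  assumes "length ys = fsz f"
  shows "polys (Node f t) (x # ys @ zs)
    = before f ys @ [insert x (marks f ys)] @ after f ys @ polys t (x # zs)"
  using assms by simp

lemma Grow_simps [simp]:
  assumes "tsz l = Suc (length ls)" "tsz r = Suc (length rs)"
  shows "before (Grow l r f) (ls @ p # rs @ ys) = polys r (p # rs) @ before f ys"
    "after (Grow l r f) (ls @ p # rs @ ys) = after f ys @ polys l (ls @ [p])"
    "marks (Grow l r f) (ls @ p # rs @ ys) = insert p (marks f ys)"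
  using assms by auto

declare polys.simps(2) [simp del] before.simps(2) [simp del] after.simps(2) [simp del]
  marks.simps(2) [simp del]

lemma split_Node:
  assumes "length xs = tsz (Node f t)"
  obtains x ys zs where "xs = x # ys @ zs" "length ys = fsz f" "Suc (length zs) = tsz t"
proof -
  have "xs \<noteq> []" using assms tsz_pos[of t] by auto
  then obtain x xs' where xs: "xs = x # xs'" by (cases xs) auto
  show ?thesis
    by (rule that[of x "take (fsz f) xs'" "drop (fsz f) xs'"]) (use assms xs tsz_pos[of t] in auto)
qed

lemma split_Grow:
  assumes "length xs = fsz (Grow l r f)"
  obtains ls p rs ys where "xs = ls @ p # rs @ ys" "tsz l = Suc (length ls)"
    "tsz r = Suc (length rs)" "length ys = fsz f"
proof -
  obtain a b where ab: "tsz l = Suc a" "tsz r = Suc b" by (simp add: tsz_def)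
  have "drop a xs \<noteq> []" using assms ab by auto
  then obtain p xs' where xs': "drop a xs = p # xs'" by (cases "drop a xs") auto
  have "length xs' = b + fsz f" using assms ab arg_cong[OF xs', of length] by simp
  then show ?thesis
    using that[of "take a xs" p "take b xs'" "drop b xs'"] ab assms xs'
    by (metis (no_types, lifting) append_take_drop_id length_drop length_take min.absorb2
        diff_add_inverse le_add1 add_Suc add.assoc fsz_simps(2) diff_Suc_1 add_Suc_right length_append length_Cons)
qed

lemma marks_props:
  "length xs = fsz f \<Longrightarrow> distinct xs \<Longrightarrow> marks f xs \<subseteq> set xs \<and> card (marks f xs) = flen f"
proof (induction f xs rule: marks.induct)
  case (2 l r f xs)
  obtain ls p rs ys where xs: "xs = ls @ p # rs @ ys" "tsz l = Suc (length ls)"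
    "tsz r = Suc (length rs)" "length ys = fsz f" using split_Grow[OF "2.prems"(1)] .
  have IH: "marks f ys \<subseteq> set ys" "card (marks f ys) = flen f" using 2 xs by auto
  then have "finite (marks f ys)" "p \<notin> marks f ys"
    using xs "2.prems" finite_subset by auto
  then show ?case using IH xs by auto
qed auto

text \<open>In the forest part \<open>R\<close> stands for the vertices of the polygon outside
  \<open>xs\<close>: the root and the marked vertices already passed. They lie above or below all of
  \<open>xs\<close>, so each subtree can be glued on at its marked vertex by
  \<open>cnext_union\<close>.\<close>

lemma polys_prod:
  "\<And>xs. sorted_wrt (<) xs \<Longrightarrow> length xs = tsz t \<Longrightarrow>
     (\<forall>E\<in>set (polys t xs). E \<subseteq> set xs) \<and> prod_rl (map cnext (polys t xs)) = cnext (set xs)"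
  "\<And>xs R. sorted_wrt (<) xs \<Longrightarrow> length xs = fsz f \<Longrightarrow> R \<noteq> {} \<Longrightarrow>
     (\<And>r. r \<in> R \<Longrightarrow> (\<forall>x\<in>set xs. r < x) \<or> (\<forall>x\<in>set xs. x < r)) \<Longrightarrow>
     (\<forall>E\<in>set (before f xs) \<union> set (after f xs). E \<subseteq> set xs) \<and>
     prod_rl (map cnext (after f xs)) \<circ> cnext (R \<union> marks f xs) \<circ> prod_rl (map cnext (before f xs))
       = cnext (R \<union> set xs)"
proof (induction t and f)
  case Leaf
  then obtain x where "xs = [x]" by (auto simp: length_Suc_conv)
  then show ?case using cnext_eq_cycle_of_list[of "[x]"] by simp
next
  case (Node f t)
  obtain x ys zs where xs: "xs = x # ys @ zs" "length ys = fsz f" "Suc (length zs) = tsz t"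
    using split_Node[OF Node.prems(2)] .
  have so: "sorted_wrt (<) ys" "sorted_wrt (<) (x # zs)" "\<forall>y\<in>set ys. x < y"
     "\<forall>y\<in>set ys. \<forall>z\<in>set zs. y < z"
    using Node.prems xs by (auto simp: sorted_wrt_append)
  have F: "\<forall>E\<in>set (before f ys) \<union> set (after f ys). E \<subseteq> set ys"
    "prod_rl (map cnext (after f ys)) \<circ> cnext ({x} \<union> marks f ys) \<circ> prod_rl (map cnext (before f ys))
       = cnext ({x} \<union> set ys)"
    using Node.IH(1)[of ys "{x}"] so xs by (auto simp: comp_def)
  have T: "\<forall>E\<in>set (polys t (x # zs)). E \<subseteq> set (x # zs)"
    "prod_rl (map cnext (polys t (x # zs))) = cnext (set (x # zs))"
    using Node.IH(2)[of "x # zs"] so xs by auto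
  have m: "marks f ys \<subseteq> set ys" using marks_props[of ys f] xs so
    by (metis strict_sorted_iff)
  have "cnext (({x} \<union> set ys) \<union> set (x # zs)) = cnext (set (x # zs)) \<circ> cnext ({x} \<union> set ys)"
  proof (rule cnext_union[where v = x])
    show "({x} \<union> set ys) \<inter> set (x # zs) = {x}" using so by auto
  next
    fix z assume "z \<in> set (x # zs)"
    then consider "z = x" | "z \<in> set zs" by auto
    then show "cceil ({x} \<union> set ys) z = x"
    proof cases
      case 2
      then show ?thesis using so by (intro cceil_eqI_wrap) auto
    qed simp
  qed
  then have "prod_rl (map cnext (polys (Node f t) xs)) = cnext (set xs)"
    using xs T(2) F(2) by (simp add: prod_rl_append prod_rl_Cons comp_assoc Un_commute insert_commute)
  then show ?case using xs T(1) F(1) m by auto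
next
  case Empty
  then show ?case by simp
next
  case (Grow l r f)
  obtain ls p rs ys where xs: "xs = ls @ p # rs @ ys" "tsz l = Suc (length ls)"
    "tsz r = Suc (length rs)" "length ys = fsz f" using split_Grow[OF Grow.prems(2)] .
  have so: "sorted_wrt (<) ys" "sorted_wrt (<) (p # rs)" "sorted_wrt (<) (ls @ [p])"
     "\<forall>x\<in>set ls. x < p" "\<forall>x\<in>set rs. p < x" "\<forall>y\<in>set ys. p < y"
     "\<forall>x\<in>set rs. \<forall>y\<in>set ys. x < y" "\<forall>x\<in>set ls. \<forall>y\<in>set rs. x < y" "\<forall>x\<in>set ls. \<forall>y\<in>set ys. x < y"
    using Grow.prems(1) xs by (auto simp: sorted_wrt_append)
  have L: "\<forall>E\<in>set (polys l (ls @ [p])). E \<subseteq> set (ls @ [p])"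
    "prod_rl (map cnext (polys l (ls @ [p]))) = cnext (set (ls @ [p]))"
    using Grow.IH(1)[of "ls @ [p]"] so xs by auto
  have Rr: "\<forall>E\<in>set (polys r (p # rs)). E \<subseteq> set (p # rs)"
    "prod_rl (map cnext (polys r (p # rs))) = cnext (set (p # rs))"
    using Grow.IH(2)[of "p # rs"] so xs by auto
  have R: "(\<forall>x\<in>set xs. u < x) \<or> (\<forall>x\<in>set xs. x < u)" if "u \<in> R" for u using Grow.prems(4) that .
  have RX: "R \<inter> set xs = {}" using R by (metis disjoint_iff less_irrefl)
  let ?C = "insert p R \<union> set ys"
  have F: "\<forall>E\<in>set (before f ys) \<union> set (after f ys). E \<subseteq> set ys"
    "prod_rl (map cnext (after f ys)) \<circ> cnext (insert p R \<union> marks f ys)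
       \<circ> prod_rl (map cnext (before f ys)) = cnext ?C"
  proof -
    have h: "(\<forall>x\<in>set ys. u < x) \<or> (\<forall>x\<in>set ys. x < u)" if "u \<in> insert p R" for u
      using that R[of u] so xs by auto
    note * = Grow.IH(3)[OF so(1) xs(4) insert_not_empty h, of p R]
    show "\<forall>E\<in>set (before f ys) \<union> set (after f ys). E \<subseteq> set ys" using * by blast
    show "prod_rl (map cnext (after f ys)) \<circ> cnext (insert p R \<union> marks f ys)
       \<circ> prod_rl (map cnext (before f ys)) = cnext ?C" using * by blast
  qed
  \<comment> \<open>The tree above \<open>p\<close> acts first: all of \<open>?C\<close> lies in the
    arc of \<open>p # rs\<close> that ends in \<open>p\<close>.\<close>
  have "cnext (set (p # rs) \<union> ?C) = cnext ?C \<circ> cnext (set (p # rs))"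
  proof (rule cnext_union[where v = p])
    have "set (p # rs) \<inter> R = {}" using RX xs by auto
    moreover have "set (p # rs) \<inter> set ys = {}" using so(6,7) by fastforce
    ultimately show "set (p # rs) \<inter> ?C = {p}" by auto
  next
    fix y assume "y \<in> ?C"
    have "(\<forall>x\<in>set (p # rs). y < x) \<or> (\<forall>x\<in>set (p # rs). x < y)" if "y \<in> R"
      using R[OF that] xs by auto
    moreover have "\<forall>x\<in>set (p # rs). x < y" if "y \<in> set ys" using that so(6,7) by auto
    ultimately consider "y = p" | "\<forall>x\<in>set (p # rs). x < y" | "\<forall>x\<in>set (p # rs). y < x"
      using \<open>y \<in> ?C\<close> by blast
    then show "cceil (set (p # rs)) y = p"
    proof cases
      case 2
      then show ?thesis using so by (intro cceil_eqI_wrap) (auto simp: less_imp_le)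
    next
      case 3
      then show ?thesis using so by (intro cceil_eqI_ge) (auto simp: less_imp_le)
    qed simp
  qed
  \<comment> \<open>Dually, the vertices below \<open>p\<close> lie in the arc of everything else
    that ends in \<open>p\<close>, so their factors act last.\<close>
  moreover have "cnext ((set (p # rs) \<union> ?C) \<union> set (ls @ [p]))
      = cnext (set (ls @ [p])) \<circ> cnext (set (p # rs) \<union> ?C)"
  proof (rule cnext_union[where v = p])
    have "set (ls @ [p]) \<inter> R = {}" using RX xs by auto
    moreover have "set (p # rs @ ys) \<inter> set ls = {}" using so(4,8,9) by fastforce
    ultimately show "(set (p # rs) \<union> ?C) \<inter> set (ls @ [p]) = {p}" by auto
  next
    fix y assume y: "y \<in> set (ls @ [p])"
    have yp: "y \<le> p" using y so by auto
    show "cceil (set (p # rs) \<union> ?C) y = p"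
    proof (rule cceil_eqI_ge)
      fix u assume u: "u \<in> set (p # rs) \<union> ?C" "y \<le> u"
      show "p \<le> u"
      proof (cases "u \<in> R")
        case True
        have "y \<in> set xs" "p \<in> set xs" using y xs by auto
        then show ?thesis using R[OF True] u(2) by force
      qed (use u so in \<open>auto simp: less_imp_le\<close>)
    qed (use yp in auto)
  qed
  moreover have "(set (p # rs) \<union> ?C) \<union> set (ls @ [p]) = R \<union> set xs" using xs by auto
  ultimately have "cnext (R \<union> set xs) = cnext (set (ls @ [p])) \<circ> (cnext ?C \<circ> cnext (set (p # rs)))"
    by simp
  also have "\<dots> = prod_rl (map cnext (after (Grow l r f) xs)) \<circ> cnext (R \<union> marks (Grow l r f) xs)
     \<circ> prod_rl (map cnext (before (Grow l r f) xs))"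
    using xs unfolding F(2)[symmetric] L(2)[symmetric] Rr(2)[symmetric]
    by (simp add: prod_rl_append comp_assoc)
  finally show ?case using xs L(1) Rr(1) F(1) by auto
qed

section \<open>Types of the encoded factorizations\<close>

definition list_type :: "nat set list \<Rightarrow> (nat \<Rightarrow>\<^sub>0 nat)" where
  "list_type Es = (\<Sum>E\<leftarrow>Es. Poly_Mapping.single (card E) 1)"

lemma list_type_simps [simp]:
  "list_type [] = 0" "list_type (E # Es) = Poly_Mapping.single (card E) 1 + list_type Es"
  "list_type (Es @ Fs) = list_type Es + list_type Fs"
  by (simp_all add: list_type_def)

lemma tweight_list_type: "tweight (list_type Es) = (\<Sum>E\<leftarrow>Es. card E - 1)"
  by (induction Es) auto

lemma lookup_list_type:
  "Poly_Mapping.lookup (list_type Es) j = length (filter (\<lambda>E. card E = j) Es)"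
  by (induction Es) (auto simp: lookup_add lookup_single when_def)

lemma list_type_polys:
  "\<And>xs. sorted_wrt (<) xs \<Longrightarrow> length xs = tsz t \<Longrightarrow> list_type (polys t xs) = ttype t"
  "\<And>xs. sorted_wrt (<) xs \<Longrightarrow> length xs = fsz f \<Longrightarrow>
     list_type (before f xs) + list_type (after f xs) = ftype f"
proof (induction t and f)
  case (Node f t)
  obtain x ys zs where xs: "xs = x # ys @ zs" "length ys = fsz f" "Suc (length zs) = tsz t"
    using split_Node[OF Node.prems(2)] .
  have so: "sorted_wrt (<) ys" "sorted_wrt (<) (x # zs)" "x \<notin> set ys"
    using Node.prems xs by (auto simp: sorted_wrt_append)
  have m: "marks f ys \<subseteq> set ys" "card (marks f ys) = flen f"
    using marks_props[of ys f] xs so by (metis strict_sorted_iff)+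
  then have "card (insert x (marks f ys)) = Suc (flen f)"
    using so finite_subset by (subst card_insert_disjoint) auto
  moreover have "list_type (before f ys) + list_type (after f ys) = ftype f"
    "list_type (polys t (x # zs)) = ttype t"
    using Node.IH so xs by auto
  ultimately show ?case using xs by (simp add: ac_simps) (metis add.assoc add.commute)
next
  case (Grow l r f)
  obtain ls p rs ys where xs: "xs = ls @ p # rs @ ys" "tsz l = Suc (length ls)"
    "tsz r = Suc (length rs)" "length ys = fsz f" using split_Grow[OF Grow.prems(2)] .
  have "list_type (polys l (ls @ [p])) = ttype l" "list_type (polys r (p # rs)) = ttype r"
    "list_type (before f ys) + list_type (after f ys) = ftype f"
    using Grow.IH(1)[of "ls @ [p]"] Grow.IH(2)[of "p # rs"] Grow.IH(3)[of ys] Grow.prems xs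
    by (auto simp: sorted_wrt_append)
  then show ?case using xs by (simp add: ac_simps)
qed auto

lemma ttype_wf:
  "\<And>j. twf t \<Longrightarrow> j < 2 \<Longrightarrow> Poly_Mapping.lookup (ttype t) j = 0"
  "\<And>j. fwf f \<Longrightarrow> j < 2 \<Longrightarrow> Poly_Mapping.lookup (ftype f) j = 0"
proof (induction t and f)
  case (Node f t)
  then have "flen f \<noteq> 0" by (cases f) auto
  then show ?case using Node by (auto simp: lookup_add lookup_single when_def)
qed (auto simp: lookup_add)

text \<open>The type of the tree counts the supports by size, and well-formedness leaves no entry
  below 2.\<close>

lemma card_polys:
  assumes "sorted_wrt (<) xs" "length xs = tsz t" "twf t" "E \<in> set (polys t xs)"
  shows "2 \<le> card E"
proof (rule ccontr)
  assume "\<not> 2 \<le> card E"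
  then have "length (filter (\<lambda>F. card F = card E) (polys t xs)) = 0"
    using ttype_wf(1)[OF assms(3), of "card E"] lookup_list_type[of "polys t xs" "card E"]
      list_type_polys(1)[OF assms(1,2)] by simp
  then show False using assms(4) by (auto simp: filter_empty_conv)
qed

lemma min_fact_polys:
  assumes "sorted_wrt (<) xs" "length xs = tsz t" "twf t"
  shows "min_fact (set xs) (polys t xs)"
proof -
  have "card (set xs) = length xs" using assms(1) by (metis distinct_card strict_sorted_iff)
  moreover have "(\<Sum>E\<leftarrow>polys t xs. card E - 1) + 1 = tsz t"
    using tweight_list_type[of "polys t xs"] list_type_polys(1)[OF assms(1,2)] by (simp add: tsz_def)
  ultimately show ?thesis
    using polys_prod(1)[OF assms(1,2)] card_polys[OF assms] assms(2) unfolding min_fact_def by auto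
qed

text \<open>A set that no factor leaves is invariant under the product, and the product is
  transitive on \<open>V\<close>.\<close>

lemma min_fact_connected:
  assumes "finite V" "prod_rl (map cnext Es) = cnext V" "U \<subseteq> V" "U \<noteq> {}" "U \<noteq> V"
  shows "\<exists>E\<in>set Es. E \<inter> U \<noteq> {} \<and> E - U \<noteq> {}"
proof (rule ccontr)
  assume neg: "\<not> ?thesis"
  have "(cnext E x \<in> U) = (x \<in> U)" if E: "E \<in> set Es" for E x
  proof (cases "x \<in> E")
    case True
    then have "cnext E x \<in> E" by (rule cnext_in)
    then show ?thesis using neg E True by blast
  qed simp
  then have "(\<sigma> x \<in> U) = (x \<in> U)" if "\<sigma> \<in> set (map cnext Es)" for \<sigma> x using that by auto
  then have "(prod_rl (map cnext Es) x \<in> U) = (x \<in> U)" for x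
    using prod_rl_invariant[of "map cnext Es" "\<lambda>x. x \<in> U" x] by blast
  then have "U = V" using assms by (intro cnext_closed_all) auto
  then show False using assms by simp
qed

section \<open>Injectivity of the encoding\<close>

text \<open>Connectedness in the form of cuts: every proper nonempty set of vertices is left by some
  edge. Later arguments use it to produce an edge across a chosen border.\<close>

definition hconn :: "'a set \<Rightarrow> 'a set set \<Rightarrow> bool" where
  "hconn V S \<longleftrightarrow> (\<forall>U. U \<subseteq> V \<longrightarrow> U \<noteq> {} \<longrightarrow> U \<noteq> V \<longrightarrow> (\<exists>E\<in>S. E \<inter> U \<noteq> {} \<and> E - U \<noteq> {}))"

lemma hconnD:
  "hconn V S \<Longrightarrow> U \<subseteq> V \<Longrightarrow> U \<noteq> {} \<Longrightarrow> U \<noteq> V \<Longrightarrow> \<exists>E\<in>S. \<exists>e\<in>E. \<exists>g\<in>E. e \<in> U \<and> g \<notin> U"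
  unfolding hconn_def by blast

lemma min_fact_hconn:
  "finite V \<Longrightarrow> prod_rl (map cnext Es) = cnext V \<Longrightarrow> hconn V (set Es)"
  using min_fact_connected unfolding hconn_def by blast

text \<open>The data from which a \<^const>\<open>Node\<close> is recovered: connectedness of the last part \<open>T\<close> pins down
  where \<open>ys\<close> ends.\<close>

definition node_split where
  "node_split x S ys zs Q A T \<longleftrightarrow> S = insert (insert x Q) (A \<union> T) \<and> Q \<subseteq> set ys \<and> Q \<noteq> {}
     \<and> (\<forall>E\<in>A. E \<subseteq> set ys) \<and> (\<forall>E\<in>T. E \<subseteq> insert x (set zs)) \<and> hconn (insert x (set zs)) T"

lemma node_splitD:
  assumes "node_split x S ys zs Q A T"
  shows "S = insert (insert x Q) (A \<union> T)" "Q \<subseteq> set ys" "Q \<noteq> {}" "\<And>E. E \<in> A \<Longrightarrow> E \<subseteq> set ys"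
    "\<And>E. E \<in> T \<Longrightarrow> E \<subseteq> insert x (set zs)" "hconn (insert x (set zs)) T"
  using assms by (simp_all add: node_split_def)

text \<open>If the root polygons differed, each would lie in the last part of the other splitting,
  so \<open>Q'\<close> in \<open>zs\<close> and \<open>Q\<close> in \<open>zs'\<close>. But one of
  \<open>ys\<close>, \<open>ys'\<close> is a prefix of the other, which contradicts one of these
  inclusions.\<close>

lemma node_split_root:
  assumes d: "distinct (x # ys @ zs)" and eq: "ys @ zs = ys' @ zs'"
    and 1: "node_split x S ys zs Q A T" and 2: "node_split x S ys' zs' Q' A' T'"
  shows "Q = Q'"
proof -
  have d': "distinct (x # ys' @ zs')" using d by (simp only: eq)
  have x: "x \<notin> set ys" "x \<notin> set zs" "x \<notin> set ys'" "x \<notin> set zs'"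
    and ds: "set ys \<inter> set zs = {}" "set ys' \<inter> set zs' = {}" using d d' by simp_all
  have Q: "Q \<subseteq> set ys" "Q \<noteq> {}" and Q': "Q' \<subseteq> set ys'" "Q' \<noteq> {}"
    using node_splitD(2,3)[OF 1] node_splitD(2,3)[OF 2] .
  have a: "insert x Q' = insert x Q \<or> Q' \<subseteq> set zs"
  proof -
    have "insert x Q' \<in> insert (insert x Q) (A \<union> T)"
      using node_splitD(1)[OF 2] node_splitD(1)[OF 1] by (metis insertI1)
    then consider "insert x Q' = insert x Q" | "insert x Q' \<in> A" | "insert x Q' \<in> T" by blast
    then show ?thesis using node_splitD(4)[OF 1] node_splitD(5)[OF 1, of "insert x Q'"] x Q'
      by cases (blast, blast, auto)
  qed
  have b: "insert x Q = insert x Q' \<or> Q \<subseteq> set zs'"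
  proof -
    have "insert x Q \<in> insert (insert x Q') (A' \<union> T')"
      using node_splitD(1)[OF 2] node_splitD(1)[OF 1] by (metis insertI1)
    then consider "insert x Q = insert x Q'" | "insert x Q \<in> A'" | "insert x Q \<in> T'" by blast
    then show ?thesis using node_splitD(4)[OF 2] node_splitD(5)[OF 2, of "insert x Q"] x Q
      by cases (blast, blast, auto)
  qed
  have "insert x Q' = insert x Q"
  proof (rule ccontr)
    assume "insert x Q' \<noteq> insert x Q"
    then have s: "Q' \<subseteq> set zs" "Q \<subseteq> set zs'" using a b by auto
    consider us where "ys = ys' @ us" | us where "ys @ us = ys'"
      using eq by (auto simp: append_eq_append_conv2)
    then show False
    proof cases
      case 1
      then have "set ys' \<subseteq> set ys" by auto
      then show False using s Q' ds by blast
    next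
      case 2
      then have "set ys \<subseteq> set ys'" by auto
      then show False using s Q ds by blast
    qed
  qed
  moreover have "x \<notin> Q" "x \<notin> Q'" using Q Q' x by auto
  ultimately show ?thesis by auto
qed

text \<open>If \<open>ys'\<close> exceeded \<open>ys\<close> by \<open>us\<close>, connectedness of
  \<open>T\<close> would give an edge leaving \<open>us\<close> within \<open>x # zs\<close>. In the
  second splitting \<open>us\<close> belongs to \<open>ys'\<close>, and neither the polygon nor an
  edge of \<open>A'\<close> or \<open>T'\<close> can do this.\<close>

lemma node_split_le:
  assumes d: "distinct (x # ys @ zs)" and eq: "ys @ zs = ys' @ zs'"
    and 1: "node_split x S ys zs Q A T" and 2: "node_split x S ys' zs' Q' A' T'"
  shows "length ys' \<le> length ys"
proof (rule ccontr)
  assume "\<not> length ys' \<le> length ys"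
  then obtain us where us: "ys' = ys @ us" "zs = us @ zs'" "us \<noteq> []"
    using eq by (auto simp: append_eq_append_conv2)
  have QQ: "Q = Q'" using node_split_root[OF d eq 1 2] .
  have "hconn (insert x (set zs)) T" using 1 by (simp add: node_split_def)
  then have "\<exists>E\<in>T. \<exists>e\<in>E. \<exists>g\<in>E. e \<in> set us \<and> g \<notin> set us"
    by (rule hconnD) (use us d in auto)
  then obtain E e g where E: "E \<in> T" "e \<in> E" "g \<in> E" "e \<in> set us" "g \<notin> set us" by blast
  have Ez: "E \<subseteq> insert x (set zs)" and "E \<in> S" using node_splitD(5)[OF 1] node_splitD(1)[OF 1] E(1) by auto
  then consider "E = insert x Q" | "E \<in> A'" | "E \<in> T'" using node_splitD(1)[OF 2] QQ by blast
  then show False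
  proof cases
    case 1
    have Q: "Q \<subseteq> set ys" "Q \<noteq> {}" using node_splitD(2,3)[OF assms(3)] .
    then obtain q where "q \<in> Q" by blast
    then have "q \<in> set ys" "q \<in> insert x (set zs)" using 1 Ez Q by blast+
    then show False using d by auto
  next
    case 2
    then have "g \<in> set ys'" using node_splitD(4)[OF assms(4)] E(3) by blast
    moreover have "g \<in> insert x (set zs)" using Ez E(3) by blast
    ultimately show False using E us d by auto
  next
    case 3
    then have "e \<in> insert x (set zs')" using node_splitD(5)[OF assms(4)] E(2) by blast
    then show False using E us d by auto
  qed
qed

text \<open>The data from which a \<open>Grow\<close> is recovered once \<open>p\<close> is known;
  here connectedness of \<open>R\<close> determines where \<open>rs\<close> ends.\<close>

definition grow_split where
  "grow_split S ls p rs ys L R F \<longleftrightarrow> S = L \<union> R \<union> F \<and> (\<forall>E\<in>L. E \<subseteq> set (ls @ [p]))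
     \<and> (\<forall>E\<in>R. E \<subseteq> set (p # rs)) \<and> (\<forall>E\<in>F. E \<subseteq> set ys) \<and> hconn (set (p # rs)) R"

lemma grow_splitD:
  assumes "grow_split S ls p rs ys L R F"
  shows "S = L \<union> R \<union> F" "\<And>E. E \<in> L \<Longrightarrow> E \<subseteq> set (ls @ [p])"
    "\<And>E. E \<in> R \<Longrightarrow> E \<subseteq> set (p # rs)" "\<And>E. E \<in> F \<Longrightarrow> E \<subseteq> set ys" "hconn (set (p # rs)) R"
  using assms by (simp_all add: grow_split_def)

lemma grow_split_le:
  assumes d: "distinct (ls @ p # rs @ ys)" and eq: "rs @ ys = rs' @ ys'"
    and 1: "grow_split S ls p rs ys L R F" and 2: "grow_split S ls p rs' ys' L' R' F'"
  shows "length rs' \<le> length rs"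
proof (rule ccontr)
  assume "\<not> length rs' \<le> length rs"
  then obtain us where us: "rs' = rs @ us" "ys = us @ ys'" "us \<noteq> []"
    using eq by (auto simp: append_eq_append_conv2)
  have "hconn (set (p # rs')) R'" using 2 by (simp add: grow_split_def)
  then have "\<exists>E\<in>R'. \<exists>e\<in>E. \<exists>g\<in>E. e \<in> set us \<and> g \<notin> set us"
    by (rule hconnD) (use us d in auto)
  then obtain E e g where E: "E \<in> R'" "e \<in> E" "g \<in> E" "e \<in> set us" "g \<notin> set us" by blast
  have Ez: "E \<subseteq> set (p # rs')" and "E \<in> S" using grow_splitD(3)[OF 2] grow_splitD(1)[OF 2] E(1) by auto
  then have "e \<in> set (ls @ [p]) \<or> e \<in> set (p # rs) \<or> g \<in> set ys"
    using grow_splitD(1)[OF 1] grow_splitD(2-4)[OF 1, of E] E(2,3) by blast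
  moreover have "g \<in> set (p # rs')" using Ez E(3) by blast
  ultimately show False using E us d by auto
qed

lemma forest_subset:
  assumes "sorted_wrt (<) xs" "length xs = fsz f" "E \<in> set (before f xs) \<union> set (after f xs)"
  shows "E \<subseteq> set xs"
proof -
  \<comment> \<open>\<open>polys_prod\<close> wants a nonempty \<open>R\<close> outside the range of
    \<open>xs\<close>; \<open>Suc (sum_list xs)\<close> exceeds every entry.\<close>
  have "(\<forall>E\<in>set (before f xs) \<union> set (after f xs). E \<subseteq> set xs) \<and>
     prod_rl (map cnext (after f xs)) \<circ> cnext ({Suc (sum_list xs)} \<union> marks f xs)
        \<circ> prod_rl (map cnext (before f xs)) = cnext ({Suc (sum_list xs)} \<union> set xs)"
    by (rule polys_prod(2)[OF assms(1,2)]) (auto simp: less_Suc_eq_le member_le_sum_list)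
  then show ?thesis using assms(3) by blast
qed

lemma card_forest:
  assumes "sorted_wrt (<) xs" "length xs = fsz f" "fwf f" "E \<in> set (before f xs) \<union> set (after f xs)"
  shows "2 \<le> card E"
proof (rule ccontr)
  assume "\<not> 2 \<le> card E"
  then have "length (filter (\<lambda>F. card F = card E) (before f xs @ after f xs)) = 0"
    using ttype_wf(2)[OF assms(3), of "card E"] lookup_list_type[of "before f xs @ after f xs" "card E"]
      list_type_polys(2)[OF assms(1,2)] by (simp del: filter_append)
  then show False using assms(4) by (auto simp: filter_empty_conv)
qed

lemma polys_hconn:
  assumes "sorted_wrt (<) xs" "length xs = tsz t"
  shows "hconn (set xs) (set (polys t xs))"
  using min_fact_hconn[of "set xs" "polys t xs"] polys_prod(1)[OF assms] by simp

text \<open>For forests the marks must be given too, since the polygon they belong to is not among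
  the edges. Once the borders between the parts are known, each subtree gets back its edges as those
  lying in its range of vertices.\<close>

lemma polys_inj:
  "\<And>t' xs. sorted_wrt (<) xs \<Longrightarrow> length xs = tsz t \<Longrightarrow> length xs = tsz t' \<Longrightarrow> twf t \<Longrightarrow> twf t' \<Longrightarrow>
     set (polys t xs) = set (polys t' xs) \<Longrightarrow> t = t'"
  "\<And>f' xs. sorted_wrt (<) xs \<Longrightarrow> length xs = fsz f \<Longrightarrow> length xs = fsz f' \<Longrightarrow> fwf f \<Longrightarrow> fwf f' \<Longrightarrow>
     marks f xs = marks f' xs \<Longrightarrow>
     set (before f xs) \<union> set (after f xs) = set (before f' xs) \<union> set (after f' xs) \<Longrightarrow> f = f'"
proof (induction t and f)
  case Leaf
  then show ?case by (cases t') (auto simp: polys.simps Let_def)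
next
  case (Node f t)
  obtain x ys zs where xs: "xs = x # ys @ zs" "length ys = fsz f" "Suc (length zs) = tsz t"
    using split_Node[OF Node.prems(2)] .
  have "polys (Node f t) xs \<noteq> []" using xs by simp
  then obtain f' u' where t': "t' = Node f' u'" using Node.prems(6) by (cases t') auto
  obtain x' ys' zs' where xs': "xs = x' # ys' @ zs'" "length ys' = fsz f'" "Suc (length zs') = tsz u'"
    using split_Node[of xs f' u'] Node.prems(3) t' by metis
  have eq: "x' = x" "ys @ zs = ys' @ zs'" using xs(1) xs'(1) by simp_all
  have so: "sorted_wrt (<) ys" "sorted_wrt (<) (x # zs)"
    using Node.prems(1) xs by (auto simp: sorted_wrt_append)
  have so': "sorted_wrt (<) ys'" "sorted_wrt (<) (x # zs')"
    using Node.prems(1) xs'(1) eq(1) by (auto simp: sorted_wrt_append)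
  have d: "distinct (x # ys @ zs)" using Node.prems(1) xs(1) by (metis strict_sorted_iff)
  have d': "distinct (x # ys' @ zs')" using d by (simp only: eq)
  have ns: "node_split x (set (polys (Node f t) xs)) ys zs (marks f ys)
      (set (before f ys) \<union> set (after f ys)) (set (polys t (x # zs)))"
  proof -
    have "f \<noteq> Empty" using Node.prems(4) by simp
    then have "marks f ys \<noteq> {}" by (cases f) (simp_all add: marks.simps)
    then show ?thesis
      using marks_props[of ys f] forest_subset[OF so(1) xs(2)] polys_prod(1)[OF so(2), of t]
        polys_hconn[OF so(2), of t] d xs unfolding node_split_def by auto
  qed
  have ns': "node_split x (set (polys (Node f t) xs)) ys' zs' (marks f' ys')
      (set (before f' ys') \<union> set (after f' ys')) (set (polys u' (x # zs')))"
  proof -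
    have "f' \<noteq> Empty" using Node.prems(5) t' by simp
    then have "marks f' ys' \<noteq> {}" by (cases f') (simp_all add: marks.simps)
    moreover have "set (polys (Node f t) xs) = insert (insert x (marks f' ys'))
        (set (before f' ys') \<union> set (after f' ys') \<union> set (polys u' (x # zs')))"
      using Node.prems(6) t' xs' eq(1) by auto
    ultimately show ?thesis
      using marks_props[of ys' f'] forest_subset[OF so'(1) xs'(2)] polys_prod(1)[OF so'(2), of u']
        polys_hconn[OF so'(2), of u'] d' xs' unfolding node_split_def by auto
  qed
  have ys: "ys' = ys" "zs' = zs"
    using node_split_le[OF d eq(2) ns ns'] node_split_le[OF d' eq(2)[symmetric] ns' ns] eq(2) by auto
  have Q: "marks f ys = marks f' ys" using node_split_root[OF d eq(2) ns ns'] ys by simp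
  let ?S = "set (polys (Node f t) xs)"
  have S2: "2 \<le> card E" if "E \<in> ?S" for E
    using card_polys[OF Node.prems(1,2,4)] that .
  have disj: "set ys \<inter> set (x # zs) = {}" using d by auto
  \<comment> \<open>The ranges \<open>ys\<close> and \<open>x # zs\<close> are disjoint and edges
    are nonempty, so an edge fits into at most one of them, and the polygon into neither.\<close>
  have aux: "A = {E \<in> ?S. E \<subseteq> set ys} \<and> T = {E \<in> ?S. E \<subseteq> insert x (set zs)}"
    if n: "node_split x ?S ys zs Q A T" for Q A T
  proof -
    note n' = node_splitD(1-5)[OF n]
    have ne: "E \<noteq> {}" if "E \<in> A \<union> T" for E using S2[of E] that n'(1) by auto
    have "\<not> E \<subseteq> insert x (set zs)" if "E \<in> A" for E using n'(4)[OF that] ne[of E] that disj by auto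
    moreover have "\<not> E \<subseteq> set ys" if "E \<in> T" for E using n'(5)[OF that] ne[of E] that disj by auto
    moreover have "\<not> insert x Q \<subseteq> set ys" using disj by auto
    moreover have "\<not> insert x Q \<subseteq> insert x (set zs)" using n'(2,3) disj by auto
    ultimately show ?thesis using n' by blast
  qed
  note e = aux[OF ns] aux[OF ns'[unfolded ys]]
  have "set (polys t (x # zs)) = set (polys u' (x # zs))"
    by (rule trans[OF e(1)[THEN conjunct2] e(2)[THEN conjunct2, symmetric]])
  then have "t = u'"
    by (intro Node.IH(2)[OF so(2)]) (use xs(3) xs'(3) ys(2) Node.prems(4,5) t' in simp_all)
  moreover have "set (before f ys) \<union> set (after f ys) = set (before f' ys) \<union> set (after f' ys)"
    by (rule trans[OF e(1)[THEN conjunct1] e(2)[THEN conjunct1, symmetric]])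
  then have "f = f'"
    by (intro Node.IH(1)[OF so(1)]) (use xs(2) xs'(2) ys(1) Q Node.prems(4,5) t' in simp_all)
  ultimately show ?case using t' by simp
next
  case Empty
  then show ?case by (cases f') (auto simp: marks.simps)
next
  case (Grow l r f)
  obtain ls p rs ys where xs: "xs = ls @ p # rs @ ys" "tsz l = Suc (length ls)"
    "tsz r = Suc (length rs)" "length ys = fsz f" using split_Grow[OF Grow.prems(2)] .
  obtain l' r' g' where f': "f' = Grow l' r' g'" using Grow.prems(6) by (cases f') (auto simp: marks.simps)
  obtain ls' p' rs' ys' where xs': "xs = ls' @ p' # rs' @ ys'" "tsz l' = Suc (length ls')"
    "tsz r' = Suc (length rs')" "length ys' = fsz g'"
    using split_Grow[of xs l' r' g'] Grow.prems(3) f' by metis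
  have d: "distinct xs" using Grow.prems(1) by (metis strict_sorted_iff)
  have so: "sorted_wrt (<) (ls @ [p])" "sorted_wrt (<) (p # rs)" "sorted_wrt (<) ys" "\<forall>y\<in>set ys. p < y"
    using Grow.prems(1) xs by (auto simp: sorted_wrt_append)
  have so': "sorted_wrt (<) (ls' @ [p'])" "sorted_wrt (<) (p' # rs')" "sorted_wrt (<) ys'" "\<forall>y\<in>set ys'. p' < y"
    using Grow.prems(1) xs'(1) by (auto simp: sorted_wrt_append)
  have m: "marks f ys \<subseteq> set ys" using marks_props[of ys f] xs d by auto
  have m': "marks g' ys' \<subseteq> set ys'" using marks_props[of ys' g'] xs'(1,4) d by auto
  have meq: "insert p (marks f ys) = insert p' (marks g' ys')"
    using Grow.prems(6) Grow_simps(3)[OF xs(2,3)] Grow_simps(3)[OF xs'(2,3)] f' xs(1) xs'(1) by metis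
  \<comment> \<open>Both are the least mark: otherwise each would be a later mark of the other
    splitting and exceed the other.\<close>
  have p: "p' = p"
  proof (rule ccontr)
    assume ne: "p' \<noteq> p"
    have "p \<in> insert p' (marks g' ys')" by (rule subst[OF meq]) simp
    moreover have "p' \<in> insert p (marks f ys)" by (rule subst[OF meq[symmetric]]) simp
    ultimately have "p \<in> set ys'" "p' \<in> set ys" using ne subsetD[OF m] subsetD[OF m'] by auto
    then have "p' < p" "p < p'" using so(4) so'(4) by auto
    then show False by simp
  qed
  have ls: "ls' = ls" "rs @ ys = rs' @ ys'"
  proof -
    have "p \<notin> set ls" "p \<notin> set (rs @ ys)" using d xs(1) by auto
    moreover have "ls @ p # (rs @ ys) = ls' @ p # (rs' @ ys')" using xs(1) xs'(1) p by metis
    ultimately show "ls' = ls" "rs @ ys = rs' @ ys'"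
      using append_Cons_eq_iff[of p ls "rs @ ys" ls' "rs' @ ys'"] by auto
  qed
  let ?S = "set (before (Grow l r f) xs) \<union> set (after (Grow l r f) xs)"
  have gs: "grow_split ?S ls p rs ys (set (polys l (ls @ [p]))) (set (polys r (p # rs)))
     (set (before f ys) \<union> set (after f ys))"
    using xs polys_prod(1)[OF so(1), of l] polys_prod(1)[OF so(2), of r] forest_subset[OF so(3) xs(4)]
      polys_hconn[OF so(2), of r] unfolding grow_split_def by auto
  have "?S = set (before (Grow l' r' g') xs) \<union> set (after (Grow l' r' g') xs)"
    using Grow.prems(7) f' by simp
  then have gs': "grow_split ?S ls p rs' ys' (set (polys l' (ls @ [p]))) (set (polys r' (p # rs')))
     (set (before g' ys') \<union> set (after g' ys'))"
    using xs' polys_prod(1)[OF so'(1), of l'] polys_prod(1)[OF so'(2), of r'] forest_subset[OF so'(3) xs'(4)]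
      polys_hconn[OF so'(2), of r'] p ls(1) unfolding grow_split_def by auto
  have dd: "distinct (ls @ p # rs @ ys)" "distinct (ls @ p # rs' @ ys')"
    using d xs(1) xs'(1)[unfolded p ls(1)] by metis+
  have rs: "rs' = rs" "ys' = ys"
    using grow_split_le[OF dd(1) ls(2) gs gs'] grow_split_le[OF dd(2) ls(2)[symmetric] gs' gs] ls(2) by auto
  have S2: "2 \<le> card E" if "E \<in> ?S" for E using card_forest[OF Grow.prems(1,2,4) that] .
  \<comment> \<open>The ranges of \<open>l\<close> and \<open>r\<close> overlap in \<open>p\<close>,
    so nonemptiness is not enough here; an edge has two vertices and therefore fits into only one
    range.\<close>
  have aux: "L = {E \<in> ?S. E \<subseteq> set (ls @ [p])} \<and> R = {E \<in> ?S. E \<subseteq> set (p # rs)} \<and> F = {E \<in> ?S. E \<subseteq> set ys}"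
    if n: "grow_split ?S ls p rs ys L R F" for L R F
  proof -
    note n' = grow_splitD(1-4)[OF n]
    have big: "\<not> E \<subseteq> {p}" if "E \<in> ?S" for E
      using S2[OF that] card_mono[of "{p}" E] by auto
    have ds: "set (ls @ [p]) \<inter> set (p # rs) \<subseteq> {p}" "set (ls @ [p]) \<inter> set ys \<subseteq> {p}"
      "set (p # rs) \<inter> set ys \<subseteq> {p}" using dd(1) by auto
    have "\<not> E \<subseteq> set (p # rs)" "\<not> E \<subseteq> set ys" if "E \<in> L" for E
      using n'(1) n'(2)[OF that] big[of E] ds that by blast+
    moreover have "\<not> E \<subseteq> set (ls @ [p])" "\<not> E \<subseteq> set ys" if "E \<in> R" for E
      using n'(1) n'(3)[OF that] big[of E] ds that by blast+
    moreover have "\<not> E \<subseteq> set (ls @ [p])" "\<not> E \<subseteq> set (p # rs)" if "E \<in> F" for E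
      using n'(1) n'(4)[OF that] big[of E] ds that by blast+
    ultimately show ?thesis using n' by blast
  qed
  note e = aux[OF gs] aux[OF gs'[unfolded rs]]
  have "set (polys l (ls @ [p])) = set (polys l' (ls @ [p]))"
    by (rule trans[OF e(1)[THEN conjunct1] e(2)[THEN conjunct1, symmetric]])
  then have "l = l'"
    by (intro Grow.IH(1)[OF so(1)]) (use xs(2) xs'(2) ls(1) Grow.prems(4,5) f' in simp_all)
  moreover have "set (polys r (p # rs)) = set (polys r' (p # rs))"
    by (rule trans[OF e(1)[THEN conjunct2, THEN conjunct1] e(2)[THEN conjunct2, THEN conjunct1, symmetric]])
  then have "r = r'"
    by (intro Grow.IH(2)[OF so(2)]) (use xs(3) xs'(3) rs(1) Grow.prems(4,5) f' in simp_all)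
  moreover have "f = g'"
  proof (rule Grow.IH(3)[of ys g'])
    show "marks f ys = marks g' ys"
    proof -
      have "p \<notin> marks f ys" "p \<notin> marks g' ys" using subsetD[OF m, of p] subsetD[OF m', of p] so(4) rs(2) by auto
      then show ?thesis using meq p rs(2) by (metis Diff_insert_absorb)
    qed
    show "set (before f ys) \<union> set (after f ys) = set (before g' ys) \<union> set (after g' ys)"
      by (rule trans[OF e(1)[THEN conjunct2, THEN conjunct2] e(2)[THEN conjunct2, THEN conjunct2, symmetric]])
  qed (use so(3) xs(4) xs'(4) rs(2) Grow.prems(4,5) f' in simp_all)
  ultimately show ?case using f' by simp
qed

section \<open>Noncrossing cacti\<close>

definition noncross :: "nat set \<Rightarrow> nat set \<Rightarrow> bool" where
  "noncross E F \<longleftrightarrow> (\<forall>a\<in>E. \<forall>c\<in>E. \<forall>b\<in>F. \<forall>d\<in>F. \<not> (a < b \<and> b < c \<and> c < d) \<and> \<not> (b < a \<and> a < d \<and> d < c))"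

lemma noncrossD:
  assumes "noncross E F" "a \<in> E" "b \<in> E" "f \<in> F" "g \<in> F" "a < f" "f < b"
  shows "a \<le> g \<and> g \<le> b"
  using assms unfolding noncross_def by (metis not_le)

text \<open>Two points of \<open>F\<close> that are separated by points of \<open>E\<close> lie in
  different arcs of \<open>E\<close>.\<close>

lemma in_arc_noncross:
  assumes "in_arc E F"
  shows "noncross E F"
  unfolding noncross_def
proof (intro ballI conjI notI)
  fix a c b d assume m: "a \<in> E" "c \<in> E" "b \<in> F" "d \<in> F"
  then have eq: "cceil E b = cceil E d" and ne: "E \<noteq> {}" using assms unfolding in_arc_def by blast+
  {
    assume *: "a < b \<and> b < c \<and> c < d"
    from ne have 1: "b \<le> cceil E b \<and> cceil E b \<le> c"
    proof (cases rule: cceil_cases[where x = b])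
      case ge
      show ?thesis using ge(2) ge(3)[OF m(2)] * by simp
    next
      case wrap
      show ?thesis using wrap(2)[OF m(2)] * by simp
    qed
    from ne have "d \<le> cceil E d \<or> cceil E d \<le> a"
    proof (cases rule: cceil_cases[where x = d])
      case wrap
      show ?thesis using wrap(3)[OF m(1)] by simp
    qed simp
    then show False using 1 eq * by linarith
  }
  {
    assume *: "b < a \<and> a < d \<and> d < c"
    from ne have 1: "cceil E b \<le> a"
    proof (cases rule: cceil_cases[where x = b])
      case ge
      show ?thesis using ge(3)[OF m(1)] * by simp
    next
      case wrap
      show ?thesis using wrap(3)[OF m(1)] .
    qed
    from ne have "d \<le> cceil E d"
    proof (cases rule: cceil_cases[where x = d])
      case wrap
      show ?thesis using wrap(2)[OF m(2)] * by simp
    qed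
    then show False using 1 eq * by linarith
  }
qed

lemma noncross_sym: "noncross E F \<Longrightarrow> noncross F E"
  unfolding noncross_def by blast

text \<open>Equality in the rank bound of a connected hypergraph makes it a hypertree. The
  definition mentions no order of the edges, which is what allows it to represent a whole
  commutation class.\<close>

definition cactus :: "nat set \<Rightarrow> nat set set \<Rightarrow> bool" where
  "cactus V S \<longleftrightarrow> finite V \<and> V \<noteq> {} \<and> (\<forall>E\<in>S. E \<subseteq> V \<and> 2 \<le> card E) \<and> hconn V S
     \<and> (\<Sum>E\<in>S. card E - 1) + 1 = card V \<and> pairwise noncross S"

lemma cactus_finite: "cactus V S \<Longrightarrow> finite S"
  unfolding cactus_def by (meson finite_Pow_iff finite_subset PowI subsetI)

lemma cactus_edge:
  assumes "cactus V S" "E \<in> S"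
  shows "E \<subseteq> V" "2 \<le> card E" "finite E" "E \<noteq> {}"
  using assms finite_subset[of E V] unfolding cactus_def by auto

lemma min_fact_cactus:
  assumes "finite V" "min_fact V Es"
  shows "cactus V (set Es)"
proof -
  have "pairwise noncross (set Es)"
    using min_fact_sorted[OF assms]
    by (induction Es) (auto simp: pairwise_insert in_arc_noncross noncross_sym)
  moreover have "(\<Sum>E\<in>set Es. card E - 1) = (\<Sum>E\<leftarrow>Es. card E - 1)"
    using min_fact_distinct[OF assms] by (simp add: sum_list_distinct_conv_sum_set)
  ultimately show ?thesis
    using assms min_fact_hconn[OF assms(1)] unfolding cactus_def min_fact_def by auto
qed

section \<open>Connected hypergraphs and cutting a cactus at a vertex\<close>

lemma hconn_const:
  assumes "hconn V S" "\<And>E. E \<in> S \<Longrightarrow> E \<subseteq> V" "\<And>E x y. E \<in> S \<Longrightarrow> x \<in> E \<Longrightarrow> y \<in> E \<Longrightarrow> f x = f y" "x \<in> V" "y \<in> V"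
  shows "f x = f y"
proof (rule ccontr)
  assume ne: "f x \<noteq> f y"
  have nV: "{v \<in> V. f v = f x} \<noteq> V"
  proof
    assume "{v \<in> V. f v = f x} = V"
    then have "y \<in> {v \<in> V. f v = f x}" using assms(5) by blast
    then show False using ne by simp
  qed
  have "\<exists>E\<in>S. \<exists>e\<in>E. \<exists>g\<in>E. e \<in> {v \<in> V. f v = f x} \<and> g \<notin> {v \<in> V. f v = f x}"
    by (rule hconnD[OF assms(1)]) (use assms(4) nV in blast)+
  then obtain E e g where E: "E \<in> S" "e \<in> E" "g \<in> E" "f e = f x" "g \<notin> V \<or> f g \<noteq> f x" by blast
  have "f g = f x" using assms(3)[OF E(1-3)] E(4) by simp
  moreover have "g \<in> V" using assms(2)[OF E(1)] E(3) by blast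
  ultimately show False using E(5) by simp
qed

lemma card_le_hconn:
  assumes "finite V" "V \<noteq> {}" "hconn V (set Es)" "\<And>E. E \<in> set Es \<Longrightarrow> E \<subseteq> V \<and> E \<noteq> {}"
  shows "card V \<le> (\<Sum>E\<leftarrow>Es. card E - 1) + 1"
proof -
  obtain f :: "'a \<Rightarrow> 'a" where f: "\<forall>E\<in>set Es. \<forall>x\<in>E. \<forall>y\<in>E. f x = f y"
    "card V \<le> card (f ` V) + (\<Sum>E\<leftarrow>Es. card E - 1)"
    using ex_monochromatic_labelling[OF assms(1,4)] by blast
  obtain v where v: "v \<in> V" using assms(2) by blast
  have "f x = f v" if "x \<in> V" for x
    by (rule hconn_const[OF assms(3) _ _ that v]) (use assms(4) f(1) in blast)+
  then have "f ` V \<subseteq> {f v}" by blast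
  then have "card (f ` V) \<le> 1" using card_mono[of "{f v}" "f ` V"] by simp
  then show ?thesis using f(2) by linarith
qed

lemma card_le_hconn_set:
  assumes "finite V" "V \<noteq> {}" "finite S" "hconn V S" "\<And>E. E \<in> S \<Longrightarrow> E \<subseteq> V \<and> E \<noteq> {}"
  shows "card V \<le> (\<Sum>E\<in>S. card E - 1) + 1"
proof -
  obtain Es where Es: "set Es = S" "distinct Es" using finite_distinct_list[OF assms(3)] by blast
  have "card V \<le> (\<Sum>E\<leftarrow>Es. card E - 1) + 1"
    using card_le_hconn[of V Es] assms Es(1) by simp
  then show ?thesis using Es by (simp add: sum_list_distinct_conv_sum_set)
qed

text \<open>It suffices to test sets avoiding a chosen vertex, since an edge crosses the border of a
  set exactly if it crosses that of the complement.\<close>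

lemma hconnI:
  assumes "v \<in> V" "\<And>E. E \<in> S \<Longrightarrow> E \<subseteq> V"
    "\<And>U. U \<subseteq> V \<Longrightarrow> U \<noteq> {} \<Longrightarrow> v \<notin> U \<Longrightarrow> \<exists>E\<in>S. \<exists>e\<in>E. \<exists>g\<in>E. e \<in> U \<and> g \<notin> U"
  shows "hconn V S"
  unfolding hconn_def
proof (intro allI impI)
  fix U assume U: "U \<subseteq> V" "U \<noteq> {}" "U \<noteq> V"
  show "\<exists>E\<in>S. E \<inter> U \<noteq> {} \<and> E - U \<noteq> {}"
  proof (cases "v \<in> U")
    case False
    then show ?thesis using assms(3)[OF U(1,2)] by blast
  next
    case True
    have "\<exists>E\<in>S. \<exists>e\<in>E. \<exists>g\<in>E. e \<in> V - U \<and> g \<notin> V - U"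
      by (rule assms(3)) (use U True in auto)
    then obtain E e g where "E \<in> S" "e \<in> E" "g \<in> E" "e \<in> V - U" "g \<notin> V - U" by blast
    then show ?thesis using assms(2)[of E] by blast
  qed
qed

text \<open>Both halves are connected and satisfy the rank inequality. Their inequalities add up to
  the equality for \<open>V\<close>, since \<open>v\<close> is counted twice and no edge is, so both
  are equalities.\<close>

lemma cactus_split:
  assumes C: "cactus V S" and V: "V = V1 \<union> V2" "V1 \<inter> V2 = {v}"
    and S: "\<And>E. E \<in> S \<Longrightarrow> E \<subseteq> V1 \<or> E \<subseteq> V2"
  shows "cactus V1 {E \<in> S. E \<subseteq> V1} \<and> cactus V2 {E \<in> S. E \<subseteq> V2}"
proof -
  let ?S1 = "{E \<in> S. E \<subseteq> V1}" and ?S2 = "{E \<in> S. E \<subseteq> V2}"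
  have fin: "finite V1" "finite V2" using C V(1) by (simp_all add: cactus_def)
  have v: "v \<in> V1" "v \<in> V2" using V(2) by auto
  have hc: "hconn V S" using C by (simp add: cactus_def)
  have h: "hconn W {E \<in> S. E \<subseteq> W}" if W: "v \<in> W" "W \<union> W' = V" "W \<inter> W' = {v}"
    "\<And>E. E \<in> S \<Longrightarrow> E \<subseteq> W \<or> E \<subseteq> W'" for W W'
  proof (rule hconnI[of v])
    fix U assume U: "U \<subseteq> W" "U \<noteq> {}" "v \<notin> U"
    have "\<exists>E\<in>S. \<exists>e\<in>E. \<exists>g\<in>E. e \<in> U \<and> g \<notin> U"
      by (rule hconnD[OF hc]) (use U W in auto)
    then obtain E e g where E: "E \<in> S" "e \<in> E" "g \<in> E" "e \<in> U" "g \<notin> U" by blast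
    have "\<not> E \<subseteq> W'"
    proof
      assume "E \<subseteq> W'"
      then have "e \<in> W \<inter> W'" using E(2,4) U(1) by blast
      then have "e = v" using W(3) by simp
      then show False using E(4) U(3) by simp
    qed
    then have "E \<subseteq> W" using W(4) E by blast
    then show "\<exists>E\<in>{E \<in> S. E \<subseteq> W}. \<exists>e\<in>E. \<exists>g\<in>E. e \<in> U \<and> g \<notin> U" using E by blast
  qed (use W in auto)
  have h1: "hconn V1 ?S1" by (rule h[OF v(1) V(1)[symmetric] V(2) S])
  have h2: "hconn V2 ?S2" by (rule h[of V2 V1]) (use v V S in auto)
  have fS: "finite S" using cactus_finite[OF C] .
  have l1: "card V1 \<le> (\<Sum>E\<in>?S1. card E - 1) + 1"
    by (rule card_le_hconn_set[OF fin(1) _ _ h1]) (use v fS cactus_edge[OF C] in auto)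
  have l2: "card V2 \<le> (\<Sum>E\<in>?S2. card E - 1) + 1"
    by (rule card_le_hconn_set[OF fin(2) _ _ h2]) (use v fS cactus_edge[OF C] in auto)
  have "?S1 \<inter> ?S2 = {}"
  proof (rule ccontr)
    assume "?S1 \<inter> ?S2 \<noteq> {}"
    then obtain E where E: "E \<in> S" "E \<subseteq> V1" "E \<subseteq> V2" by blast
    then have "E \<subseteq> {v}" using V(2) by blast
    then have "card E \<le> 1" using card_mono[of "{v}" E] by simp
    then show False using cactus_edge(2)[OF C E(1)] by simp
  qed
  moreover have "?S1 \<union> ?S2 = S" using S by blast
  ultimately have s: "(\<Sum>E\<in>S. card E - 1) = (\<Sum>E\<in>?S1. card E - 1) + (\<Sum>E\<in>?S2. card E - 1)"
    using sum.union_disjoint[of ?S1 ?S2 "\<lambda>E. card E - 1"] fS by simp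
  have c: "card V1 + card V2 = card V + 1"
    using card_Un_Int[OF fin] V by simp
  have t: "(\<Sum>E\<in>S. card E - 1) + 1 = card V" using C by (simp add: cactus_def)
  have pw: "pairwise noncross ?S1" "pairwise noncross ?S2"
    using C by (auto simp: cactus_def pairwise_def)
  show ?thesis
    using fin v h1 h2 pw l1 l2 s c t cactus_edge(2)[OF C] unfolding cactus_def by auto
qed

section \<open>Components left after deleting a polygon\<close>

definition hcomp :: "'a set set \<Rightarrow> 'a \<Rightarrow> 'a set" where
  "hcomp S p = {w. (p, w) \<in> {(a, b). \<exists>E\<in>S. a \<in> E \<and> b \<in> E}\<^sup>*}"

lemma hcomp_self [simp]: "p \<in> hcomp S p"
  by (simp add: hcomp_def)

lemma hcomp_step: "a \<in> hcomp S p \<Longrightarrow> E \<in> S \<Longrightarrow> a \<in> E \<Longrightarrow> b \<in> E \<Longrightarrow> b \<in> hcomp S p"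
  unfolding hcomp_def by (auto intro: rtrancl_into_rtrancl)

lemma hcomp_edge: "E \<in> S \<Longrightarrow> E \<subseteq> hcomp S p \<or> E \<inter> hcomp S p = {}"
  using hcomp_step[of _ S p E] by blast

lemma hcomp_induct [consumes 1, case_names self step]:
  assumes "w \<in> hcomp S p" "P p" "\<And>a b E. P a \<Longrightarrow> E \<in> S \<Longrightarrow> a \<in> E \<Longrightarrow> b \<in> E \<Longrightarrow> P b"
  shows "P w"
proof -
  have "(p, w) \<in> {(a, b). \<exists>E\<in>S. a \<in> E \<and> b \<in> E}\<^sup>*" using assms(1) by (simp add: hcomp_def)
  then show ?thesis
    by (induction rule: rtrancl_induct) (use assms(2,3) in blast)+
qed

lemma hcomp_trivial:
  assumes "w \<in> hcomp S p" "\<And>E. E \<in> S \<Longrightarrow> p \<notin> E"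
  shows "w = p"
  using assms(1) by (induction rule: hcomp_induct) (use assms(2) in auto)

lemma hcomp_sym:
  assumes "w \<in> hcomp S p"
  shows "p \<in> hcomp S w"
proof -
  have "sym ({(a, b). \<exists>E\<in>S. a \<in> E \<and> b \<in> E})" by (auto simp: sym_def)
  then show ?thesis using assms unfolding hcomp_def by (auto dest: sym_rtrancl symD)
qed

lemma hcomp_trans: "a \<in> hcomp S p \<Longrightarrow> b \<in> hcomp S a \<Longrightarrow> b \<in> hcomp S p"
  unfolding hcomp_def by auto

text \<open>Otherwise one could drop the vertex \<open>q\<close> from \<open>P\<close> without disconnecting the cactus.\<close>

lemma hcomp_inter:
  assumes C: "cactus V S" and P: "P \<in> S" "p \<in> P"
    and q: "q \<in> P" "q \<in> hcomp (S - {P}) p"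
  shows "q = p"
proof (rule ccontr)
  let ?D = "hcomp (S - {P}) p"
  assume "q \<noteq> p"
  note q = q this
  obtain Es where Es: "set Es = S - {P}" "distinct Es"
    using finite_distinct_list[of "S - {P}"] cactus_finite[OF C] by blast
  have fin: "finite V" "V \<noteq> {}" and hc: "hconn V S" using C by (simp_all add: cactus_def)
  have PV: "P \<subseteq> V" "2 \<le> card P" "finite P" using cactus_edge[OF C P(1)] by auto
  obtain f :: "nat \<Rightarrow> nat" where f: "\<forall>E\<in>set ((P - {q}) # Es). \<forall>x\<in>E. \<forall>y\<in>E. f x = f y"
    and c: "card V \<le> card (f ` V) + (\<Sum>E\<leftarrow>(P - {q}) # Es. card E - 1)"
  proof -
    have "E \<subseteq> V \<and> E \<noteq> {}" if "E \<in> set ((P - {q}) # Es)" for E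
      using that PV(1) P(2) q(3) Es(1) cactus_edge(1,4)[OF C, of E] by auto
    then show ?thesis
      using ex_monochromatic_labelling[OF fin(1), of "(P - {q}) # Es"] that by blast
  qed
  have fe: "f x = f y" if "E \<in> S - {P}" "x \<in> E" "y \<in> E" for E x y
  proof -
    show ?thesis by (rule f[rule_format, of E]) (use that Es(1) in auto)
  qed
  have fD: "f w = f p" if "w \<in> ?D" for w
    using that
  proof (induction rule: hcomp_induct)
    case (step a b E)
    then show ?case using fe[OF step(2-4)] by simp
  qed simp
  have fP: "f x = f p" if "x \<in> P" for x
  proof (cases "x = q")
    case True
    then show ?thesis using fD[OF q(2)] by simp
  next
    case False
    show ?thesis by (rule f[rule_format, of "P - {q}"]) (use that False P q in auto)
  qed
  have const: "f x = f p" if "x \<in> V" for x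
  proof (rule hconn_const[OF hc _ _ that])
    fix E x y assume E: "E \<in> S" "x \<in> E" "y \<in> E"
    show "f x = f y"
    proof (cases "E = P")
      case True
      then show ?thesis using fP[of x] fP[of y] E by simp
    next
      case False
      show ?thesis by (rule fe[of E]) (use E False in auto)
    qed
  qed (use cactus_edge(1)[OF C] PV(1) P(2) in auto)
  have "f ` V \<subseteq> {f p}" using const by blast
  then have "card (f ` V) \<le> 1" using card_mono[of "{f p}" "f ` V"] by simp
  moreover have "card (P - {q}) = card P - 1" using q(1) PV(3) by simp
  moreover have "(\<Sum>E\<leftarrow>Es. card E - 1) = (\<Sum>E\<in>S - {P}. card E - 1)"
    using Es by (simp add: sum_list_distinct_conv_sum_set)
  moreover have "(\<Sum>E\<in>S. card E - 1) = (card P - 1) + (\<Sum>E\<in>S - {P}. card E - 1)"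
    using cactus_finite[OF C] P(1) by (rule sum.remove)
  moreover have "(\<Sum>E\<in>S. card E - 1) + 1 = card V" using C by (simp add: cactus_def)
  ultimately show False using c PV(2) by simp
qed

lemma hcomp_subset:
  assumes "cactus V S" "S' \<subseteq> S" "p \<in> V"
  shows "hcomp S' p \<subseteq> V"
proof
  fix w assume "w \<in> hcomp S' p"
  then show "w \<in> V"
    by (induction rule: hcomp_induct) (use assms cactus_edge(1)[OF assms(1)] in blast)+
qed

text \<open>The vertices reached from no vertex of \<open>P\<close> would be left by some edge. It
  is not \<open>P\<close>, so it would extend a component.\<close>

lemma hcomp_cover:
  assumes C: "cactus V S" and P: "P \<in> S" and y: "y \<in> V"
  shows "\<exists>p\<in>P. y \<in> hcomp (S - {P}) p"
proof (rule ccontr)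
  assume neg: "\<not> ?thesis"
  define U where "U = {y \<in> V. \<forall>p\<in>P. y \<notin> hcomp (S - {P}) p}"
  have yU: "y \<in> U" using neg y by (simp add: U_def)
  obtain p0 where p0: "p0 \<in> P" using cactus_edge(4)[OF C P] by blast
  have PU: "p \<notin> U" if "p \<in> P" for p using that by (auto simp: U_def intro!: bexI[of _ p])
  have "p0 \<notin> U" using PU[OF p0] .
  moreover have "p0 \<in> V" using p0 cactus_edge(1)[OF C P] by blast
  ultimately have "\<exists>E\<in>S. \<exists>e\<in>E. \<exists>g\<in>E. e \<in> U \<and> g \<notin> U"
    using C yU by (intro hconnD[of V S]) (auto simp: cactus_def U_def)
  then obtain E e g where E: "E \<in> S" "e \<in> E" "g \<in> E" "e \<in> U" "g \<notin> U" by blast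
  have "E \<noteq> P" using E(2,4) PU by blast
  then have ES: "E \<in> S - {P}" using E(1) by simp
  have "g \<in> V" using E cactus_edge(1)[OF C E(1)] by blast
  then obtain p where p: "p \<in> P" "g \<in> hcomp (S - {P}) p" using E(5) unfolding U_def by blast
  have "e \<in> hcomp (S - {P}) p" using hcomp_step[OF p(2) ES E(3,2)] .
  then show False using E(4) p(1) unfolding U_def by blast
qed

text \<open>Decomposition at the cut vertex \<open>p\<close>: \<open>D\<close> is what hangs at
  \<open>p\<close> away from \<open>P\<close>, and \<open>V2\<close> is the rest with
  \<open>P\<close>. They share only \<open>p\<close>, so every edge belongs to exactly one of
  them.\<close>

lemma cactus_hcomp:
  assumes C: "cactus V S" and P: "P \<in> S" "p \<in> P"
  defines "D \<equiv> hcomp (S - {P}) p"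
  defines "V2 \<equiv> insert p (V - D)"
  shows "D \<subseteq> V" "p \<in> D" "\<And>q. q \<in> P \<Longrightarrow> q \<in> D \<Longrightarrow> q = p" "P \<subseteq> V2"
    "cactus D {E \<in> S. E \<subseteq> D}" "cactus V2 {E \<in> S. E \<subseteq> V2}"
    "\<And>E. E \<in> S \<Longrightarrow> E \<subseteq> D \<longleftrightarrow> \<not> E \<subseteq> V2"
    "\<And>E. E \<in> S \<Longrightarrow> E \<noteq> P \<Longrightarrow> p \<in> E \<Longrightarrow> E \<subseteq> D"
proof -
  have pV: "p \<in> V" using P cactus_edge(1)[OF C] by blast
  show D: "D \<subseteq> V" unfolding D_def using hcomp_subset[OF C _ pV] by blast
  show pD: "p \<in> D" by (simp add: D_def)
  show PD: "q = p" if "q \<in> P" "q \<in> D" for q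
    using hcomp_inter[OF C P] that unfolding D_def by blast
  show PV2: "P \<subseteq> V2" using PD cactus_edge(1)[OF C P(1)] unfolding V2_def by blast
  have e: "E \<subseteq> D \<or> E \<subseteq> V2" if "E \<in> S" for E
  proof (cases "E = P")
    case False
    then have "E \<subseteq> D \<or> E \<inter> D = {}" unfolding D_def by (intro hcomp_edge) (use that in simp)
    then show ?thesis using cactus_edge(1)[OF C that] unfolding V2_def by blast
  qed (use PV2 in simp)
  have V: "V = D \<union> V2" "D \<inter> V2 = {p}" using D pD unfolding V2_def by auto
  show "cactus D {E \<in> S. E \<subseteq> D}" "cactus V2 {E \<in> S. E \<subseteq> V2}"
    using cactus_split[OF C V e] by blast+
  show "E \<subseteq> D \<longleftrightarrow> \<not> E \<subseteq> V2" if "E \<in> S" for E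
  proof -
    have "\<not> E \<subseteq> {p}" using cactus_edge(2)[OF C that] card_mono[of "{p}" E] by auto
    moreover have "E \<subseteq> {p}" if "E \<subseteq> D" "E \<subseteq> V2" using that V(2) by (metis Int_subset_iff)
    ultimately show ?thesis using e[OF that] by blast
  qed
  show "E \<subseteq> D" if "E \<in> S" "E \<noteq> P" "p \<in> E" for E
  proof -
    have "E \<subseteq> D \<or> E \<inter> D = {}" unfolding D_def by (rule hcomp_edge) (use that in simp)
    then show ?thesis using that(3) pD by blast
  qed
qed

lemma cactus_noncross: "cactus V S \<Longrightarrow> E \<in> S \<Longrightarrow> F \<in> S \<Longrightarrow> E \<noteq> F \<Longrightarrow> noncross E F"
  unfolding cactus_def pairwise_def by blast

lemma neighbours:
  fixes E :: "nat set"
  assumes "finite E" "w \<notin> E" "a0 \<in> E" "a0 < w" "b0 \<in> E" "w < b0"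
  obtains a b where "a \<in> E" "b \<in> E" "a < w" "w < b" "\<And>e. e \<in> E \<Longrightarrow> e \<le> a \<or> b \<le> e"
proof -
  let ?A = "{e \<in> E. e < w}" and ?B = "{e \<in> E. w < e}"
  have f: "finite ?A" "?A \<noteq> {}" "finite ?B" "?B \<noteq> {}" using assms by auto
  have a: "Max ?A \<in> ?A" and b: "Min ?B \<in> ?B" using f Max_in Min_in by blast+
  have "e \<le> Max ?A \<or> Min ?B \<le> e" if "e \<in> E" for e
  proof (cases "e < w")
    case True
    then show ?thesis using f that by simp
  next
    case False
    then have "e \<in> ?B" using that assms(2) by (cases "e = w") auto
    then show ?thesis using f by simp
  qed
  then show ?thesis using that[of "Max ?A" "Min ?B"] a b by blast
qed

text \<open>If \<open>w\<close> outside \<open>D\<close> lay between points of \<open>D\<close>,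
  some edge \<open>E\<close> of \<open>D\<close> would pass over \<open>w\<close>, with consecutive
  vertices \<open>a\<close> and \<open>b\<close> around it. The connected rest \<open>V2\<close>
  must leave the pocket between them by an edge, which then crosses \<open>E\<close>.\<close>

lemma hcomp_convex:
  assumes C: "cactus V S" and P: "P \<in> S" "p \<in> P" and x: "x \<in> P" "x \<noteq> p" "\<And>v. v \<in> V \<Longrightarrow> x \<le> v"
  defines "D \<equiv> hcomp (S - {P}) p"
  assumes u: "u \<in> D" "u' \<in> D" "u < w" "w < u'" "w \<in> V"
  shows "w \<in> D"
proof (rule ccontr)
  assume w: "w \<notin> D"
  define V2 where "V2 = insert p (V - D)"
  note K = cactus_hcomp[OF C P, folded D_def, folded V2_def]
  have "\<exists>E\<in>{E \<in> S. E \<subseteq> D}. \<exists>e\<in>E. \<exists>g\<in>E. e \<in> {d \<in> D. d < w} \<and> g \<notin> {d \<in> D. d < w}"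
  proof (rule hconnD[of D])
    show "hconn D {E \<in> S. E \<subseteq> D}" using K(5) by (simp add: cactus_def)
    have "u \<in> {d \<in> D. d < w}" "u' \<notin> {d \<in> D. d < w}" using u by auto
    then show "{d \<in> D. d < w} \<noteq> {}" "{d \<in> D. d < w} \<noteq> D" using u(2) by blast+
  qed blast
  then obtain E e g where E: "E \<in> S" "E \<subseteq> D" "e \<in> E" "g \<in> E" "e < w" "\<not> g < w" by blast
  have wE: "w \<notin> E" using E w by blast
  have "w < g" using E wE by (cases "g = w") auto
  then obtain a b where ab: "a \<in> E" "b \<in> E" "a < w" "w < b" "\<And>e. e \<in> E \<Longrightarrow> e \<le> a \<or> b \<le> e"
    using neighbours[OF cactus_edge(3)[OF C E(1)] wE E(3,5,4)] by blast
  define U where "U = {v \<in> V - D. a < v \<and> v < b}"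
  have "\<exists>F\<in>{E \<in> S. E \<subseteq> V2}. \<exists>e\<in>F. \<exists>g\<in>F. e \<in> U \<and> g \<notin> U"
  proof (rule hconnD[of V2])
    show "hconn V2 {E \<in> S. E \<subseteq> V2}" using K(6) by (simp add: cactus_def)
    show "U \<subseteq> V2" by (auto simp: U_def V2_def)
    have "w \<in> U" using u ab w by (simp add: U_def)
    then show "U \<noteq> {}" by blast
    have "p \<notin> U" "p \<in> V2" using K(2) by (auto simp: U_def V2_def)
    then show "U \<noteq> V2" by blast
  qed
  then obtain F f g where F: "F \<in> S" "F \<subseteq> V2" "f \<in> F" "g \<in> F" "f \<in> U" "g \<notin> U" by blast
  have xD: "x \<notin> D" using K(3) x by blast
  \<comment> \<open>The exit found may be \<open>p\<close>, which lies in \<open>D\<close> and could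
    be a vertex of \<open>E\<close>. Then \<open>F\<close> is \<open>P\<close>, and the least vertex
    \<open>x\<close> is an exit outside \<open>D\<close>.\<close>
  have "\<exists>g\<in>F. g \<in> V - D \<and> g \<notin> U"
  proof (cases "g = p")
    case False
    then show ?thesis using F unfolding V2_def by blast
  next
    case True
    have "F = P"
    proof (rule ccontr)
      assume "F \<noteq> P"
      then have "F \<subseteq> D" using K(8)[OF F(1)] F(4) True by blast
      then show False using K(7)[OF F(1)] F(2) by blast
    qed
    moreover have "x \<in> V" using x(1) cactus_edge(1)[OF C P(1)] by blast
    moreover have "x \<notin> U"
    proof
      assume "x \<in> U"
      then have "a < x" by (simp add: U_def)
      moreover have "x \<le> a" using x(3)[of a] ab(1) cactus_edge(1)[OF C E(1)] by blast
      ultimately show False by simp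
    qed
    ultimately show ?thesis using x(1) xD by blast
  qed
  then obtain h where h: "h \<in> F" "h \<in> V" "h \<notin> D" "h \<notin> U" by blast
  have EF: "E \<noteq> F" using F(3,5) E(2) unfolding U_def by blast
  have "a \<le> h \<and> h \<le> b"
    using noncrossD[OF cactus_noncross[OF C E(1) F(1) EF] ab(1,2) F(3) h(1)] F(5) by (simp add: U_def)
  moreover have "h \<noteq> a" "h \<noteq> b" using h(3) ab(1,2) E(2) by blast+
  ultimately show False using h by (simp add: U_def)
qed

text \<open>At the least vertex the component comes after everything else. A \<open>w\<close> in
  \<open>D\<close> below some \<open>y\<close> outside would, by convexity of the component of
  \<open>y\<close>, lie in a gap \<open>a\<close>, \<open>b\<close> of \<open>P\<close>.
  Connectedness and noncrossing yield an edge from this gap to a vertex of \<open>P\<close> in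
  \<open>D\<close>, that is, to \<open>x\<close>. So the gap follows \<open>x\<close>, and this edge
  contradicts the choice of \<open>P\<close> expressed by \<open>first\<close>.\<close>

lemma hcomp_root_last:
  assumes C: "cactus V S" and P: "P \<in> S" "x \<in> P" and x: "\<And>v. v \<in> V \<Longrightarrow> x \<le> v"
    and first: "\<And>F f. F \<in> S \<Longrightarrow> x \<in> F \<Longrightarrow> f \<in> F \<Longrightarrow> f \<noteq> x \<Longrightarrow> \<exists>q\<in>P. q \<noteq> x \<and> q \<le> f"
  defines "D \<equiv> hcomp (S - {P}) x"
  assumes w: "w \<in> D" "w \<noteq> x" and y: "y \<in> V - D"
  shows "y < w"
proof (rule ccontr)
  assume "\<not> y < w"
  moreover have "y \<noteq> w" using w y by blast
  ultimately have wy: "w < y" by simp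
  define V2 where "V2 = insert x (V - D)"
  note K = cactus_hcomp[OF C P, folded D_def, folded V2_def]
  have wV: "w \<in> V" using K(1) w by blast
  have wP: "w \<notin> P" using K(3) w by blast
  obtain p where p: "p \<in> P" "y \<in> hcomp (S - {P}) p" using hcomp_cover[OF C P(1)] y by blast
  have px: "p \<noteq> x" using p y unfolding D_def by blast
  have "w < p"
  proof (rule ccontr)
    assume "\<not> w < p"
    then have "p < w" using p(1) wP by (cases "p = w") auto
    then have "w \<in> hcomp (S - {P}) p"
      using hcomp_convex[OF C P(1) p(1) P(2) px[symmetric] x hcomp_self p(2) _ wy wV] by simp
    then have "p \<in> D" using hcomp_trans[OF _ hcomp_sym, of w "S - {P}" x p] w(1) unfolding D_def by blast
    then show False using K(3) p(1) px by blast
  qed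
  moreover have "x < w" using x[OF wV] w(2) by simp
  ultimately obtain a b where ab: "a \<in> P" "b \<in> P" "a < w" "w < b" "\<And>e. e \<in> P \<Longrightarrow> e \<le> a \<or> b \<le> e"
    using neighbours[OF cactus_edge(3)[OF C P(1)] wP P(2) _ p(1)] by blast
  define U where "U = {v \<in> D. a < v \<and> v < b}"
  have "\<exists>F\<in>{E \<in> S. E \<subseteq> D}. \<exists>e\<in>F. \<exists>g\<in>F. e \<in> U \<and> g \<notin> U"
  proof (rule hconnD[of D])
    show "hconn D {E \<in> S. E \<subseteq> D}" using K(5) by (simp add: cactus_def)
    show "U \<subseteq> D" by (auto simp: U_def)
    have "w \<in> U" using w ab by (simp add: U_def)
    then show "U \<noteq> {}" by blast
    have "x \<le> a" using x ab(1) cactus_edge(1)[OF C P(1)] by blast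
    then have "x \<notin> U" by (auto simp: U_def)
    then show "U \<noteq> D" using K(2) by blast
  qed
  then obtain F f g where F: "F \<in> S" "F \<subseteq> D" "f \<in> F" "g \<in> F" "f \<in> U" "g \<notin> U" by blast
  have f: "a < f" "f < b" using F(5) by (simp_all add: U_def)
  have "P \<noteq> F" using K(3) F(2) px p(1) by blast
  then have "a \<le> g \<and> g \<le> b"
    using noncrossD[OF cactus_noncross[OF C P(1) F(1)] ab(1,2) F(3,4)] f by simp
  then have "g = a \<or> g = b" using F by (auto simp: U_def)
  then have "g \<in> P" "g \<in> D" using ab F by blast+
  then have gx: "g = x" by (rule K(3))
  have fx: "f \<noteq> x" using f(1) x[of a] ab(1) cactus_edge(1)[OF C P(1)] by auto
  obtain q where q: "q \<in> P" "q \<noteq> x" "q \<le> f" using first[OF F(1) _ F(3) fx] F(4) gx by blast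
  have "x = a"
  proof -
    have "x < b" using f ab x[of a] cactus_edge(1)[OF C P(1)] by fastforce
    then show ?thesis using \<open>g = a \<or> g = b\<close> gx by auto
  qed
  then have "q \<le> x" using ab(5)[OF q(1)] q(3) f(2) by auto
  then show False using x[of q] q cactus_edge(1)[OF C P(1)] by fastforce
qed

section \<open>Every cactus comes from a tree\<close>

lemma prefix_of_downclosed:
  assumes "sorted_wrt (<) ys" "D \<subseteq> set ys" "\<And>u d. u \<in> set ys \<Longrightarrow> d \<in> D \<Longrightarrow> u < d \<Longrightarrow> u \<in> D"
  shows "\<exists>ds zs. ys = ds @ zs \<and> set ds = (D :: nat set)"
  using assms
proof (induction ys arbitrary: D)
  case (Cons y ys)
  show ?case
  proof (cases "D = {}")
    case False
    then obtain d where d: "d \<in> D" by blast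
    have yD: "y \<in> D"
    proof (cases "d = y")
      case False
      then have "y < d" using Cons.prems(1,2) d by auto
      then show ?thesis using Cons.prems(3)[of y d] d by simp
    qed (use d in simp)
    have "\<exists>ds zs. ys = ds @ zs \<and> set ds = D - {y}"
    proof (rule Cons.IH)
      fix u d assume "u \<in> set ys" "d \<in> D - {y}" "u < d"
      then show "u \<in> D - {y}" using Cons.prems(1) Cons.prems(3)[of u d] by auto
    qed (use Cons.prems in auto)
    then obtain ds zs where ds: "ys = ds @ zs" "set ds = D - {y}" by blast
    have "y # ys = (y # ds) @ zs" "set (y # ds) = D" using ds yD by (simp_all add: insert_absorb)
    then show ?thesis by blast
  next
    case True
    then have "y # ys = [] @ y # ys \<and> set [] = D" by simp
    then show ?thesis by blast
  qed
qed simp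

text \<open>The hypothesis \<open>trees\<close> is the induction hypothesis of the statement for
  trees, with \<open>V0\<close> the vertex set treated there. \<open>Z\<close> holds the vertices of
  \<open>P\<close> already dealt with, which lie on no other edge; the induction runs over the
  remaining ones.\<close>

lemma forest_exists:
  assumes trees: "\<And>W T ws. cactus W T \<Longrightarrow> card W < card V0 \<Longrightarrow> sorted_wrt (<) ws \<Longrightarrow> set ws = W \<Longrightarrow>
      \<exists>t. twf t \<and> tsz t = length ws \<and> set (polys t ws) = T"
    and "cactus V S" "card V \<le> card V0" "P \<in> S" "P = Z \<union> Q" "V = Z \<union> set ys" "Z \<noteq> {}" "Q \<subseteq> set ys"
    and "\<And>z y. z \<in> Z \<Longrightarrow> y \<in> set ys \<Longrightarrow> z < y" "\<And>E z. E \<in> S \<Longrightarrow> E \<noteq> P \<Longrightarrow> z \<in> Z \<Longrightarrow> z \<notin> E"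
    and "sorted_wrt (<) ys"
  shows "\<exists>f. fwf f \<and> fsz f = length ys \<and> marks f ys = Q \<and> set (before f ys) \<union> set (after f ys) = S - {P}"
  using assms(2-11)
proof (induction "card Q" arbitrary: Q Z ys V S)
  case 0
  note C = 0(2)
  have "finite Q" using 0(8) finite_subset by blast
  then have Q: "Q = {}" using 0(1) by simp
  have "set ys = {}"
  proof (rule ccontr)
    assume "set ys \<noteq> {}"
    then obtain y where y: "y \<in> set ys" by (cases ys) auto
    then obtain z where z: "z \<in> P" "y \<in> hcomp (S - {P}) z" using hcomp_cover[OF C 0(4)] 0(6) by blast
    have zZ: "z \<in> Z" using z 0(5) Q by simp
    have "y = z" by (rule hcomp_trivial[OF z(2)]) (use 0(10) zZ in blast)
    then show False using 0(9)[OF zZ y] by simp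
  qed
  moreover have "S - {P} = {}"
  proof (rule ccontr)
    assume "S - {P} \<noteq> {}"
    then obtain E where E: "E \<in> S" "E \<noteq> P" by blast
    obtain e where "e \<in> E" using cactus_edge(4)[OF C E(1)] by blast
    moreover have "e \<in> Z" using \<open>e \<in> E\<close> cactus_edge(1)[OF C E(1)] 0(6) \<open>set ys = {}\<close> by auto
    ultimately show False using 0(10)[OF E] by blast
  qed
  ultimately show ?case using Q by (intro exI[of _ Empty]) simp
next
  case (Suc n)
  note C = Suc.prems(1) and PS = Suc.prems(3) and PZ = Suc.prems(4) and VZ = Suc.prems(5)
    and Zlt = Suc.prems(8) and ZE = Suc.prems(9) and so = Suc.prems(10)
  have finQ: "finite Q" "Q \<noteq> {}" using Suc.hyps(2) by (auto intro: card_ge_0_finite)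
  define p where "p = Min Q"
  have pQ: "p \<in> Q" and pmin: "\<And>q. q \<in> Q \<Longrightarrow> p \<le> q" using finQ by (simp_all add: p_def)
  have pP: "p \<in> P" using pQ PZ by simp
  have pys: "p \<in> set ys" using pQ Suc.prems(7) by blast
  have ZP: "Z \<subseteq> P" using PZ by simp
  define D where "D = hcomp (S - {P}) p"
  define V2 where "V2 = insert p (V - D)"
  note K = cactus_hcomp[OF C PS pP, folded D_def, folded V2_def]
  have finZ: "finite Z" using C VZ by (simp add: cactus_def)
  define x where "x = Min Z"
  have xZ: "x \<in> Z" and xmin: "\<And>z. z \<in> Z \<Longrightarrow> x \<le> z" using finZ Suc.prems(6) by (simp_all add: x_def)
  have xP: "x \<in> P" using xZ ZP by blast
  have xV: "x \<le> v" if "v \<in> V" for v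
    using that xmin[of v] Zlt[OF xZ, of v] VZ by (auto intro: less_imp_le)
  have Zys: "z \<notin> set ys" if "z \<in> Z" for z using Zlt[OF that, of z] by blast
  have ZD: "z \<notin> D" if "z \<in> Z" for z
  proof
    assume "z \<in> D"
    then have "z = p" using K(3) that ZP by blast
    then show False using Zys[OF that] pys by simp
  qed
  have Dys: "D \<subseteq> set ys" using K(1) ZD VZ by blast
  \<comment> \<open>What hangs at the least remaining vertex \<open>p\<close> comes first. A vertex
    below \<open>p\<close> that hangs at a later \<open>q\<close> would by convexity put
    \<open>p\<close> into the component of \<open>q\<close>, which meets \<open>P\<close> only in
    \<open>q\<close>.\<close>
  have "\<exists>ds zs. ys = ds @ zs \<and> set ds = D"
  proof (rule prefix_of_downclosed[OF so Dys])
    fix u d assume u: "u \<in> set ys" "d \<in> D" "u < d"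
    have uV: "u \<in> V" using u VZ by simp
    have xp: "x \<noteq> p" using xZ Zys pys by blast
    show "u \<in> D"
    proof (cases "u < p")
      case False
      show ?thesis
      proof (cases "u = p")
        case False
        then have "p < u" using \<open>\<not> u < p\<close> by simp
        then show ?thesis
          using hcomp_convex[OF C PS pP xP xp xV, folded D_def, of p d u] K(2) u uV by blast
      qed (use K(2) in simp)
    next
      case True
      obtain q where q: "q \<in> P" "u \<in> hcomp (S - {P}) q" using hcomp_cover[OF C PS uV] by blast
      have qZ: "q \<notin> Z"
      proof
        assume qZ: "q \<in> Z"
        have "u = q" by (rule hcomp_trivial[OF q(2)]) (use ZE qZ in blast)
        then show False using Zys[OF qZ] u(1) by simp
      qed
      then have qQ: "q \<in> Q" using q(1) PZ by blast
      have xq: "x \<noteq> q" using xZ qZ by blast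
      show ?thesis
      proof (cases "q = p")
        case True
        then show ?thesis using q(2) by (simp add: D_def)
      next
        case False
        then have "p < q" using pmin[OF qQ] by simp
        then have "p \<in> hcomp (S - {P}) q"
          using hcomp_convex[OF C PS q(1) xP xq xV q(2) hcomp_self True] pP cactus_edge(1)[OF C PS] by blast
        then show ?thesis using hcomp_inter[OF C PS q(1)] pP False by blast
      qed
    qed
  qed
  then obtain ds zs where ds: "ys = ds @ zs" "set ds = D" by blast
  then obtain ls rs where lr: "ds = ls @ p # rs" using K(2) split_list by metis
  have ord: "sorted_wrt (<) (ls @ [p])" "sorted_wrt (<) (p # rs)" "sorted_wrt (<) zs"
    "\<And>a. a \<in> set ls \<Longrightarrow> a < p" "\<And>a. a \<in> set rs \<Longrightarrow> p < a" "\<And>a. a \<in> set zs \<Longrightarrow> p < a"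
    "\<And>a b. a \<in> D \<Longrightarrow> b \<in> set zs \<Longrightarrow> a < b"
    using so ds lr by (auto simp: sorted_wrt_append)
  have side: "E \<subseteq> set (ls @ [p]) \<or> E \<subseteq> set (p # rs)" if "E \<in> S" "E \<subseteq> D" for E
  proof (rule ccontr)
    assume "\<not> ?thesis"
    \<comment> \<open>an edge on both sides of \<open>p\<close> would cross the chord from \<open>x\<close> to \<open>p\<close>\<close>
    then obtain a b where ab: "a \<in> E" "b \<in> E" "a \<notin> set (p # rs)" "b \<notin> set (ls @ [p])" by blast
    then have "a \<in> set ls" "b \<in> set rs" using that(2) ds(2) lr by auto
    then have "a < p" "p < b" using ord(4,5) by auto
    moreover have "x < a" using Zlt[OF xZ] ab(1) that(2) Dys by blast
    moreover have "P \<noteq> E" using xP ZD[OF xZ] that(2) by blast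
    ultimately show False
      using noncrossD[OF cactus_noncross[OF C PS that(1)] xP pP ab(1,2)] by simp
  qed
  have DS: "cactus (set (ls @ [p])) {E \<in> {E \<in> S. E \<subseteq> D}. E \<subseteq> set (ls @ [p])} \<and>
     cactus (set (p # rs)) {E \<in> {E \<in> S. E \<subseteq> D}. E \<subseteq> set (p # rs)}"
  proof (rule cactus_split[OF K(5)])
    show "D = set (ls @ [p]) \<union> set (p # rs)" using ds(2) lr by auto
    show "set (ls @ [p]) \<inter> set (p # rs) = {p}" using ord(4,5) by fastforce
    show "E \<subseteq> set (ls @ [p]) \<or> E \<subseteq> set (p # rs)" if "E \<in> {E \<in> S. E \<subseteq> D}" for E
      using side that by blast
  qed
  \<comment> \<open>\<open>D\<close> omits \<open>x\<close>, so both parts of it are small enough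
    for \<open>trees\<close>.\<close>
  have "D \<subset> V" using K(1) ZD[OF xZ] xZ VZ by blast
  then have cD: "card D < card V" using C by (intro psubset_card_mono) (simp_all add: cactus_def)
  have "card (set (ls @ [p])) \<le> card D" "card (set (p # rs)) \<le> card D"
    using ds(2) lr by (auto intro!: card_mono)
  then have cl: "card (set (ls @ [p])) < card V0" "card (set (p # rs)) < card V0"
    using cD Suc.prems(2) by linarith+
  obtain l where l: "twf l" "tsz l = length (ls @ [p])"
      "set (polys l (ls @ [p])) = {E \<in> {E \<in> S. E \<subseteq> D}. E \<subseteq> set (ls @ [p])}"
    using trees[OF DS[THEN conjunct1] cl(1) ord(1) refl] by blast
  obtain r where r: "twf r" "tsz r = length (p # rs)"
      "set (polys r (p # rs)) = {E \<in> {E \<in> S. E \<subseteq> D}. E \<subseteq> set (p # rs)}"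
    using trees[OF DS[THEN conjunct2] cl(2) ord(2) refl] by blast
  let ?S2 = "{E \<in> S. E \<subseteq> V2}"
  have "\<exists>f. fwf f \<and> fsz f = length zs \<and> marks f zs = Q - {p} \<and>
     set (before f zs) \<union> set (after f zs) = ?S2 - {P}"
  \<comment> \<open>The polygon stays an edge of the smaller cactus, while \<open>p\<close> moves
    from \<open>Q\<close> to \<open>Z\<close>: its other edges have all gone into
    \<open>D\<close>.\<close>
  proof (rule Suc.hyps(1)[of "Q - {p}" V2 ?S2 "insert p Z" zs])
    show "n = card (Q - {p})" using Suc.hyps(2) pQ finQ by simp
    show "cactus V2 ?S2" by (rule K(6))
    show "card V2 \<le> card V0"
    proof -
      have "V2 \<subseteq> V" using K(1,2) by (auto simp: V2_def)
      then have "card V2 \<le> card V" using C by (intro card_mono) (simp_all add: cactus_def)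
      then show ?thesis using Suc.prems(2) by simp
    qed
    show "P \<in> ?S2" using PS K(4) by simp
    show "P = insert p Z \<union> (Q - {p})" using PZ pQ by auto
    have disj: "D \<inter> set zs = {}" using ord(7) by blast
    show "V2 = insert p Z \<union> set zs"
      using VZ ds ZD disj unfolding V2_def by auto
    show "insert p Z \<noteq> {}" by simp
    show "Q - {p} \<subseteq> set zs"
    proof
      fix q assume q: "q \<in> Q - {p}"
      then have "q \<notin> D" using K(3) PZ by blast
      moreover have "q \<in> set ys" using q Suc.prems(7) by blast
      ultimately show "q \<in> set zs" using ds by auto
    qed
    show "z < y" if "z \<in> insert p Z" "y \<in> set zs" for z y
      using that ord(6) Zlt[of z y] ds(1) by auto
    show "z \<notin> E" if "E \<in> ?S2" "E \<noteq> P" "z \<in> insert p Z" for E z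
    proof (cases "z = p")
      case True
      have "\<not> E \<subseteq> D" using K(7)[of E] that(1) by blast
      then show ?thesis using K(8)[of E] that True by blast
    next
      case False
      then show ?thesis using ZE[of E z] that by blast
    qed
    show "sorted_wrt (<) zs" by (rule ord(3))
  qed
  then obtain f where f: "fwf f" "fsz f = length zs" "marks f zs = Q - {p}"
    "set (before f zs) \<union> set (after f zs) = ?S2 - {P}" by blast
  have ysq: "ys = ls @ p # rs @ zs" using ds(1) lr by simp
  have l': "tsz l = Suc (length ls)" and r': "tsz r = Suc (length rs)" using l r by simp_all
  have edges: "{E \<in> {E \<in> S. E \<subseteq> D}. E \<subseteq> set (p # rs)} \<union> {E \<in> {E \<in> S. E \<subseteq> D}. E \<subseteq> set (ls @ [p])}
     \<union> (?S2 - {P}) = S - {P}"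
  proof -
    have "\<not> P \<subseteq> D" using xP ZD[OF xZ] by blast
    moreover have "E \<subseteq> D \<or> E \<subseteq> V2" if "E \<in> S" for E using K(7)[OF that] by blast
    ultimately show ?thesis using side by blast
  qed
  show ?case
  proof (intro exI[of _ "Grow l r f"] conjI)
    show "fwf (Grow l r f)" using l r f by simp
    show "fsz (Grow l r f) = length ys" using l r f ysq by simp
    show "marks (Grow l r f) ys = Q" using Grow_simps(3)[OF l' r'] f(3) pQ ysq by auto
    have "set (before (Grow l r f) ys) \<union> set (after (Grow l r f) ys)
      = set (polys r (p # rs)) \<union> set (polys l (ls @ [p])) \<union> (set (before f zs) \<union> set (after f zs))"
      unfolding ysq Grow_simps(1,2)[OF l' r'] by auto
    then show "set (before (Grow l r f) ys) \<union> set (after (Grow l r f) ys) = S - {P}"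
      unfolding l(3) r(3) f(4) edges .
  qed
qed

lemma tree_exists:
  "cactus V S \<Longrightarrow> sorted_wrt (<) xs \<Longrightarrow> set xs = V \<Longrightarrow>
     \<exists>t. twf t \<and> tsz t = length xs \<and> set (polys t xs) = S"
proof (induction "card V" arbitrary: V S xs rule: less_induct)
  case less
  note C = less.prems(1) and so = less.prems(2) and xsV = less.prems(3)
  have "xs \<noteq> []" using C xsV by (auto simp: cactus_def)
  then obtain x xs' where xs: "xs = x # xs'" by (cases xs) auto
  have xV: "x \<in> V" and xmin: "\<And>v. v \<in> V \<Longrightarrow> x \<le> v" using xs so xsV by auto
  show ?case
  proof (cases "xs' = []")
    case True
    have "S = {}"
    proof (rule ccontr)
      assume "S \<noteq> {}"
      then obtain E where E: "E \<in> S" by blast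
      then have "E \<subseteq> {x}" using cactus_edge(1)[OF C E] xsV xs True by simp
      then show False using cactus_edge(2)[OF C E] card_mono[of "{x}" E] by simp
    qed
    then show ?thesis using True xs by (intro exI[of _ Leaf]) simp
  next
    case False
    have "x \<notin> set xs'" using so xs by auto
    then have "V \<noteq> {x}" using xsV xs False by (cases xs') auto
    then have "\<exists>E\<in>S. \<exists>e\<in>E. \<exists>g\<in>E. e \<in> {x} \<and> g \<notin> {x}"
      using C xV by (intro hconnD[of V]) (auto simp: cactus_def)
    then obtain P0 where P0: "P0 \<in> S \<and> x \<in> P0" by blast
    \<comment> \<open>\<open>Min (F - {x})\<close> is the second vertex of \<open>F\<close>. The
      factor acting first at the least vertex is the one whose second vertex is least.\<close>
    obtain P where P: "P \<in> S" "x \<in> P" and least: "\<And>F. F \<in> S \<Longrightarrow> x \<in> F \<Longrightarrow> Min (P - {x}) \<le> Min (F - {x})"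
      using ex_has_least_nat[of "\<lambda>F. F \<in> S \<and> x \<in> F" P0 "\<lambda>F. Min (F - {x})"] P0 by blast
    have fP: "finite (F - {x})" "F - {x} \<noteq> {}" if "F \<in> S" for F
    proof -
      show "finite (F - {x})" using cactus_edge(3)[OF C that] by simp
      have "\<not> F \<subseteq> {x}" using cactus_edge(2)[OF C that] card_mono[of "{x}" F] by auto
      then show "F - {x} \<noteq> {}" by blast
    qed
    have first: "\<exists>q\<in>P. q \<noteq> x \<and> q \<le> f" if F: "F \<in> S" "x \<in> F" "f \<in> F" "f \<noteq> x" for F f
    proof -
      have "Min (P - {x}) \<in> P - {x}" using fP[OF P(1)] by (rule Min_in)
      moreover have "Min (F - {x}) \<le> f" using fP[OF F(1)] F by simp
      ultimately show ?thesis
        using least[OF F(1,2)] by (intro bexI[of _ "Min (P - {x})"]) auto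
    qed
    define D where "D = hcomp (S - {P}) x"
    define V2 where "V2 = insert x (V - D)"
    note K = cactus_hcomp[OF C P, folded D_def, folded V2_def]
    have last: "y < w" if "w \<in> D" "w \<noteq> x" "y \<in> V - D" for w y
      by (rule hcomp_root_last[OF C P, folded D_def]) (use xmin first that in blast)+
    have sub: "V - D \<subseteq> set xs'" using xsV xs K(2) by auto
    have "\<exists>ds zs. xs' = ds @ zs \<and> set ds = V - D"
    proof (rule prefix_of_downclosed[OF _ sub])
      show "sorted_wrt (<) xs'" using so xs by simp
      fix u d assume u: "u \<in> set xs'" "d \<in> V - D" "u < d"
      have "u \<noteq> x" using u(1) \<open>x \<notin> set xs'\<close> by blast
      moreover have "u \<in> V" using u(1) xs xsV by auto
      ultimately show "u \<in> V - D" using last[of u d] u by fastforce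
    qed
    then obtain ys zs where yz: "xs' = ys @ zs" "set ys = V - D" by blast
    have xeq: "xs = x # ys @ zs" using xs yz by simp
    have dist: "distinct xs" using so by (metis strict_sorted_iff)
    have ord: "sorted_wrt (<) ys" "sorted_wrt (<) (x # zs)" "\<And>y. y \<in> set ys \<Longrightarrow> x < y"
      using so xeq by (auto simp: sorted_wrt_append)
    have zsD: "set (x # zs) = D"
    proof
      show "set (x # zs) \<subseteq> D" using dist xeq yz(2) xsV K(2) by auto
      show "D \<subseteq> set (x # zs)" using K(1) xeq xsV yz(2) by auto
    qed
    obtain q where q: "q \<in> P" "q \<noteq> x" using fP(2)[OF P(1)] by blast
    have "q \<notin> D" "q \<in> V" using q K(3) cactus_edge(1)[OF C P(1)] by blast+
    then have "card D < card V"
      using C K(1) by (intro psubset_card_mono) (auto simp: cactus_def)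
    then obtain t where t: "twf t" "tsz t = length (x # zs)" "set (polys t (x # zs)) = {E \<in> S. E \<subseteq> D}"
      using less.hyps[OF _ K(5) ord(2) zsD] by blast
    let ?S2 = "{E \<in> S. E \<subseteq> V2}"
    have "\<exists>f. fwf f \<and> fsz f = length ys \<and> marks f ys = P - {x} \<and>
        set (before f ys) \<union> set (after f ys) = ?S2 - {P}"
    proof (rule forest_exists[of V V2 ?S2 P "{x}" "P - {x}" ys])
      show "\<exists>t. twf t \<and> tsz t = length ws \<and> set (polys t ws) = T"
        if "cactus W T" "card W < card V" "sorted_wrt (<) ws" "set ws = W" for W T ws
        using less.hyps[OF that(2,1,3,4)] .
      show "cactus V2 ?S2" by (rule K(6))
      have "V2 \<subseteq> V" using K(1,2) by (auto simp: V2_def)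
      then show "card V2 \<le> card V" using C by (intro card_mono) (simp_all add: cactus_def)
      show "P \<in> ?S2" using P(1) K(4) by simp
      show "P = {x} \<union> (P - {x})" using P(2) by blast
      show "V2 = {x} \<union> set ys" using yz(2) by (simp add: V2_def)
      show "P - {x} \<subseteq> set ys" using yz(2) K(3) cactus_edge(1)[OF C P(1)] by blast
      show "z < y" if "z \<in> {x}" "y \<in> set ys" for z y using that ord(3) by simp
      show "z \<notin> E" if "E \<in> ?S2" "E \<noteq> P" "z \<in> {x}" for E z
        using K(7)[of E] K(8)[of E] that by blast
      show "sorted_wrt (<) ys" by (rule ord(1))
    qed simp
    then obtain f where f: "fwf f" "fsz f = length ys" "marks f ys = P - {x}"
      "set (before f ys) \<union> set (after f ys) = ?S2 - {P}" by blast
    have "f \<noteq> Empty"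
    proof
      assume "f = Empty"
      then have "P - {x} = {}" using f(3) by simp
      then show False using q by blast
    qed
    moreover have "set (polys (Node f t) xs) = S"
    proof -
      have "set (polys (Node f t) xs) = insert (insert x (marks f ys))
         ((set (before f ys) \<union> set (after f ys)) \<union> set (polys t (x # zs)))"
        unfolding xeq polys_Node[OF f(2)[symmetric]] by auto
      also have "\<dots> = insert P ((?S2 - {P}) \<union> {E \<in> S. E \<subseteq> D})"
        unfolding f(3,4) t(3) using P(2) by (simp add: insert_absorb)
      also have "\<dots> = S"
      proof -
        have "E \<subseteq> V2 \<or> E \<subseteq> D" if "E \<in> S" for E using K(7)[OF that] by blast
        then show ?thesis using P(1) by blast
      qed
      finally show ?thesis .
    qed
    ultimately show ?thesis using f t xeq by (intro exI[of _ "Node f t"]) auto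
  qed
qed

section \<open>Counting commutation classes\<close>

lemma ncycle_eq_cnext: "1 \<le> n \<Longrightarrow> ncycle n = cnext {1..n}"
proof
  fix i assume n: "1 \<le> n"
  consider "1 \<le> i" "i < n" | "i = n" | "i = 0 \<or> n < i" by linarith
  then show "ncycle n i = cnext {1..n} i"
  proof cases
    case 1
    then have "cceil {1..n} (Suc i) = Suc i" by simp
    then show ?thesis using 1 by (simp add: ncycle_def cnext_def)
  next
    case 2
    have "cceil {1..n} (Suc n) = 1" using n by (intro cceil_eqI_wrap) auto
    then show ?thesis using 2 n by (simp add: ncycle_def cnext_def)
  next
    case 3
    then show ?thesis using n by (auto simp: ncycle_def cnext_def)
  qed
qed

lemma cycle_of_list_no_fixpoint:
  assumes "distinct cs" "2 \<le> length cs" "x \<in> set cs"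
  shows "cycle_of_list cs x \<noteq> x"
proof -
  obtain i where i: "i < length cs" "x = cs ! i" using assms(3) by (auto simp: in_set_conv_nth)
  have "map (cycle_of_list cs) cs = rotate1 cs"
    using cyclic_rotation[OF assms(1), of 1] by simp
  then have "cycle_of_list cs x = rotate1 cs ! i" using i by (metis nth_map)
  also have "\<dots> = cs ! (Suc i mod length cs)" using i by (simp add: nth_rotate1)
  finally have e: "cycle_of_list cs x = cs ! (Suc i mod length cs)" .
  have "Suc i mod length cs \<noteq> i"
    using i assms(2) by (cases "Suc i = length cs") auto
  moreover have "Suc i mod length cs < length cs" using i by (intro mod_less_divisor) auto
  ultimately show ?thesis using e i assms(1) nth_eq_iff_index_eq by metis
qed

lemma support_cycle_of_list:
  assumes "distinct cs" "2 \<le> length cs"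
  shows "{x. cycle_of_list cs x \<noteq> x} = set cs"
  using cycle_of_list_no_fixpoint[OF assms] id_outside_supp[of _ cs] by blast

text \<open>From length 2 on, the length is the number of moved points and so depends only on the
  permutation. Shorter lists all give the identity, which moves none.\<close>

lemma is_kcycle_iff:
  assumes "distinct cs" "2 \<le> length cs" "set cs \<subseteq> {1..n}"
  shows "is_kcycle n j (cycle_of_list cs) \<longleftrightarrow> length cs = j"
proof
  assume "is_kcycle n j (cycle_of_list cs)"
  then obtain ds where ds: "distinct ds" "length ds = j" "cycle_of_list cs = cycle_of_list ds"
    by (auto simp: is_kcycle_def)
  have ne: "set cs \<noteq> {}" using assms(2) by auto
  have "2 \<le> length ds"
  proof (rule ccontr)
    assume "\<not> 2 \<le> length ds"
    then have "cycle_of_list ds = id"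
      by (cases ds rule: cycle_of_list.cases) auto
    then show False using support_cycle_of_list[OF assms(1,2)] ds(3) ne by auto
  qed
  then have "set cs = set ds"
    using support_cycle_of_list[OF assms(1,2)] support_cycle_of_list[OF ds(1)] ds(3) by simp
  then show "length cs = j" using ds(1,2) assms(1) by (metis distinct_card)
qed (use assms in \<open>auto simp: is_kcycle_def\<close>)

lemma cnext_eq_sorted_cycle:
  "finite E \<Longrightarrow> cnext E = cycle_of_list (sorted_list_of_set E)"
  using cnext_eq_cycle_of_list[of "sorted_list_of_set E"] by simp

lemma is_kcycle_cnext_iff:
  assumes "E \<subseteq> {1..n}" "2 \<le> card E"
  shows "is_kcycle n j (cnext E) \<longleftrightarrow> card E = j"
proof -
  have "finite E" using assms finite_subset by blast
  then show ?thesis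
    using is_kcycle_iff[of "sorted_list_of_set E" n j] cnext_eq_sorted_cycle[of E] assms by simp
qed

text \<open>The choice of \<open>n\<close> makes the type alone fix the rank sum at
  \<open>n - 1\<close>, so every factorization counted here is minimal and consists of increasing
  cycles.\<close>

lemma factorizations_eq:
  assumes "n = 1 + tweight \<alpha>"
  shows "factorizations n \<alpha> = map cnext ` {Es. min_fact {1..n} Es \<and> list_type Es = \<alpha>}"
proof (intro equalityI subsetI)
  fix fs assume fs: "fs \<in> factorizations n \<alpha>"
  have "\<forall>\<sigma>\<in>set fs. \<exists>cs. distinct cs \<and> set cs \<subseteq> {1..n} \<and> 2 \<le> length cs \<and> \<sigma> = cycle_of_list cs"
    using fs unfolding factorizations_def is_kcycle_def by blast
  then obtain g where g: "\<And>\<sigma>. \<sigma> \<in> set fs \<Longrightarrow> distinct (g \<sigma>) \<and> set (g \<sigma>) \<subseteq> {1..n}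
      \<and> 2 \<le> length (g \<sigma>) \<and> \<sigma> = cycle_of_list (g \<sigma>)" by metis
  define css where "css = map g fs"
  have fs_eq: "fs = map cycle_of_list css"
    unfolding css_def map_map by (rule map_idI[symmetric]) (use g in auto)
  have css: "set cs \<subseteq> {1..n} \<and> distinct cs \<and> 2 \<le> length cs" if "cs \<in> set css" for cs
    using that g by (auto simp: css_def)
  have "length (filter (is_kcycle n j) fs) = length (filter (\<lambda>E. card E = j) (map set css))" for j
  proof -
    have "filter (is_kcycle n j \<circ> cycle_of_list) css = filter ((\<lambda>E. card E = j) \<circ> set) css"
      using css is_kcycle_iff by (intro filter_cong) (auto simp: distinct_card)
    then show ?thesis unfolding fs_eq filter_map by simp
  qed
  then have "Poly_Mapping.lookup (list_type (map set css)) j = Poly_Mapping.lookup \<alpha> j" for j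
    using fs unfolding lookup_list_type factorizations_def by simp
  then have type: "list_type (map set css) = \<alpha>" by (rule poly_mapping_eqI)
  have "(\<Sum>cs\<leftarrow>css. length cs - 1) = (\<Sum>E\<leftarrow>map set css. card E - 1)"
    using css by (auto intro!: arg_cong[where f = sum_list] simp: distinct_card)
  then have sum: "(\<Sum>cs\<leftarrow>css. length cs - 1) + 1 = card {1..n}"
    using type tweight_list_type[of "map set css"] assms by simp
  have prod: "prod_rl (map cycle_of_list css) = cnext {1..n}"
    using fs ncycle_eq_cnext[of n] assms unfolding fs_eq factorizations_def by simp
  have "fs = map cnext (map set css)" "min_fact {1..n} (map set css)"
    using cycles_min_fact(1,2)[OF _ css prod sum] fs_eq by auto
  then show "fs \<in> map cnext ` {Es. min_fact {1..n} Es \<and> list_type Es = \<alpha>}" using type by blast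
next
  fix fs assume "fs \<in> map cnext ` {Es. min_fact {1..n} Es \<and> list_type Es = \<alpha>}"
  then obtain Es where Es: "fs = map cnext Es" "min_fact {1..n} Es" "list_type Es = \<alpha>" by blast
  have E: "E \<subseteq> {1..n}" "2 \<le> card E" if "E \<in> set Es" for E
    using Es(2) that by (auto simp: min_fact_def)
  have "length (filter (is_kcycle n j) fs) = Poly_Mapping.lookup \<alpha> j" for j
  proof -
    have "filter (is_kcycle n j \<circ> cnext) Es = filter (\<lambda>E. card E = j) Es"
      by (rule filter_cong[OF refl]) (use E is_kcycle_cnext_iff in simp)
    then show ?thesis unfolding Es(1) filter_map Es(3)[symmetric] lookup_list_type by simp
  qed
  moreover have "\<exists>k\<ge>2. is_kcycle n k \<sigma>" if "\<sigma> \<in> set fs" for \<sigma>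
    using that E is_kcycle_cnext_iff unfolding Es(1) by auto
  moreover have "prod_rl fs = ncycle n"
    using Es(1,2) ncycle_eq_cnext[of n] assms by (simp add: min_fact_def)
  ultimately show "fs \<in> factorizations n \<alpha>" by (simp add: factorizations_def)
qed

lemma comm_swap_sym: "comm_swap fs gs \<Longrightarrow> comm_swap gs fs"
  unfolding comm_swap_def by metis

lemma equiv_fact_equiv: "equiv UNIV fact_equiv"
proof -
  have "symp comm_swap" by (auto intro: sympI comm_swap_sym)
  then have "symp comm_swap\<^sup>*\<^sup>*" by (rule symp_rtranclp)
  then show ?thesis
    by (intro equivI) (auto simp: fact_equiv_def refl_on_def sym_def trans_def dest: sympD)
qed

text \<open>The set of factors is the invariant that separates the classes.\<close>

lemma fact_equiv_set: "(fs, gs) \<in> fact_equiv \<Longrightarrow> set fs = set gs"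
proof -
  assume "(fs, gs) \<in> fact_equiv"
  then have "comm_swap\<^sup>*\<^sup>* fs gs" by (simp add: fact_equiv_def)
  then show ?thesis
  proof (induction rule: rtranclp_induct)
    case (step gs hs)
    then obtain xs a b ys where "gs = xs @ [a, b] @ ys" "hs = xs @ [b, a] @ ys"
      unfolding comm_swap_def by blast
    then have "set gs = set hs" by auto
    then show ?case using step.IH by simp
  qed simp
qed

definition trees :: "(nat \<Rightarrow>\<^sub>0 nat) \<Rightarrow> ctree set" where
  "trees \<alpha> = {t. twf t \<and> ttype t = \<alpha>}"

lemma inj_polys: "inj_on (\<lambda>t. set (polys t [1..<Suc n])) {t. twf t \<and> tsz t = n}"
proof (rule inj_onI)
  fix t t' assume t: "t \<in> {t. twf t \<and> tsz t = n}" "t' \<in> {t. twf t \<and> tsz t = n}"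
    "set (polys t [1..<Suc n]) = set (polys t' [1..<Suc n])"
  show "t = t'" by (rule polys_inj(1)[OF sorted_wrt_upt _ _ _ _ t(3)]) (use t(1,2) in auto)
qed

text \<open>The encoding injects these trees into the sets of subsets of
  \<open>{1..n}\<close>.\<close>

lemma finite_twf_tsz: "finite {t. twf t \<and> tsz t = n}"
proof (rule finite_imageD[OF _ inj_polys])
  have "set (polys t [1..<Suc n]) \<subseteq> Pow {1..n}" if "tsz t = n" for t
    using polys_prod(1)[OF sorted_wrt_upt, of 1 "Suc n" t] that by (auto simp del: upt_Suc) fastforce+
  then have "(\<lambda>t. set (polys t [1..<Suc n])) ` {t. twf t \<and> tsz t = n} \<subseteq> Pow (Pow {1..n})" by blast
  then show "finite ((\<lambda>t. set (polys t [1..<Suc n])) ` {t. twf t \<and> tsz t = n})"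
    by (rule finite_subset) simp
qed

lemma finite_trees: "finite (trees \<alpha>)"
  by (rule finite_subset[OF _ finite_twf_tsz[of "Suc (tweight \<alpha>)"]]) (auto simp: trees_def tsz_def)

lemma list_type_distinct:
  "distinct Es \<Longrightarrow> list_type Es = (\<Sum>E\<in>set Es. Poly_Mapping.single (card E) 1)"
  by (simp add: list_type_def sum_list_distinct_conv_sum_set)

lemma inj_on_cnext: "inj_on cnext {E. finite E \<and> 2 \<le> card E}"
proof (rule inj_onI)
  fix E F assume EF: "E \<in> {E. finite E \<and> 2 \<le> card E}" "F \<in> {E. finite E \<and> 2 \<le> card E}"
    "cnext E = cnext F"
  have "E = {x. cnext E x \<noteq> x}" "F = {x. cnext F x \<noteq> x}" using support_cnext EF(1,2) by auto
  then show "E = F" using EF(3) by simp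
qed

text \<open>A tree is sent to the class of its factorization. Equivalent factorizations have the
  same supports, hence the same tree; conversely the supports of any minimal factorization form a
  cactus, which comes from a tree, and equal supports mean equivalence.\<close>

lemma Htilde_eq_card_trees: "Htilde \<alpha> = card (trees \<alpha>)"
proof -
  define n where "n = 1 + tweight \<alpha>"
  define xs where "xs = [1..<Suc n]"
  have xs: "sorted_wrt (<) xs" "length xs = n" "set xs = {1..n}"
    by (auto simp: xs_def sorted_wrt_upt simp del: upt_Suc)
  define \<Phi> where "\<Phi> t = fact_equiv `` {map cnext (polys t xs)}" for t
  have t: "length xs = tsz t" "twf t" "min_fact {1..n} (polys t xs)" "list_type (polys t xs) = \<alpha>"
    if "t \<in> trees \<alpha>" for t
  proof -
    show l: "length xs = tsz t" "twf t" using that xs(2) by (auto simp: trees_def tsz_def n_def)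
    show "min_fact {1..n} (polys t xs)" using min_fact_polys[OF xs(1) l] xs(3) by simp
    show "list_type (polys t xs) = \<alpha>" using list_type_polys(1)[OF xs(1) l(1)] that by (simp add: trees_def)
  qed
  have "inj_on \<Phi> (trees \<alpha>)"
  proof (rule inj_onI)
    fix t t' assume tt: "t \<in> trees \<alpha>" "t' \<in> trees \<alpha>" "\<Phi> t = \<Phi> t'"
    then have "(map cnext (polys t xs), map cnext (polys t' xs)) \<in> fact_equiv"
      unfolding \<Phi>_def using eq_equiv_class_iff[OF equiv_fact_equiv] by blast
    then have "cnext ` set (polys t xs) = cnext ` set (polys t' xs)" using fact_equiv_set by fastforce
    moreover have sub: "set (polys u xs) \<subseteq> {E. finite E \<and> 2 \<le> card E}" if "u \<in> trees \<alpha>" for u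
    proof
      fix E assume "E \<in> set (polys u xs)"
      then have "E \<subseteq> {1..n}" "2 \<le> card E" using t(3)[OF that] by (auto simp: min_fact_def)
      then show "E \<in> {E. finite E \<and> 2 \<le> card E}" using finite_subset by blast
    qed
    ultimately have "set (polys t xs) = set (polys t' xs)"
      using inj_on_image_eq_iff[OF inj_on_cnext sub[OF tt(1)] sub[OF tt(2)]] by simp
    then show "t = t'"
      using polys_inj(1)[OF xs(1) t(1)[OF tt(1)] t(1)[OF tt(2)] t(2)[OF tt(1)] t(2)[OF tt(2)]] by blast
  qed
  moreover have "\<Phi> ` trees \<alpha> = factorizations n \<alpha> // fact_equiv"
  proof (intro equalityI subsetI)
    fix c assume "c \<in> \<Phi> ` trees \<alpha>"
    then obtain u where u: "u \<in> trees \<alpha>" "c = \<Phi> u" by blast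
    then have "map cnext (polys u xs) \<in> factorizations n \<alpha>"
      using t(3,4)[OF u(1)] unfolding factorizations_eq[OF n_def] by blast
    then show "c \<in> factorizations n \<alpha> // fact_equiv" using u(2) unfolding \<Phi>_def by (simp add: quotientI)
  next
    fix c assume "c \<in> factorizations n \<alpha> // fact_equiv"
    then obtain Es where Es: "c = fact_equiv `` {map cnext Es}" "min_fact {1..n} Es" "list_type Es = \<alpha>"
      unfolding factorizations_eq[OF n_def] by (auto elim!: quotientE)
    obtain u where u: "twf u" "tsz u = length xs" "set (polys u xs) = set Es"
      using tree_exists[OF min_fact_cactus[OF _ Es(2)] xs(1,3)] by auto
    have mf: "min_fact {1..n} (polys u xs)" using min_fact_polys[OF xs(1) u(2)[symmetric] u(1)] xs(3) by simp
    have "ttype u = list_type (polys u xs)" using list_type_polys(1)[OF xs(1) u(2)[symmetric]] by simp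
    also have "\<dots> = list_type Es"
      using u(3) min_fact_distinct[OF _ mf] min_fact_distinct[OF _ Es(2)] by (simp add: list_type_distinct)
    finally have "u \<in> trees \<alpha>" using u(1) Es(3) by (simp add: trees_def)
    moreover have "(map cnext (polys u xs), map cnext Es) \<in> fact_equiv"
      using min_fact_equiv[OF _ mf Es(2) u(3)] by (simp add: fact_equiv_def)
    then have "\<Phi> u = c" unfolding \<Phi>_def Es(1) using equiv_class_eq[OF equiv_fact_equiv] by blast
    ultimately show "c \<in> \<Phi> ` trees \<alpha>" by blast
  qed
  ultimately show ?thesis
    unfolding Htilde_def n_def[symmetric] by (metis card_image)
qed

text \<open>Off the types both sides vanish, because well-formed trees have no entries at 0 and
  1.\<close>

lemma xi_eq_card_trees: "xi \<alpha> = int (card (trees \<alpha>))"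
proof (cases "is_type \<alpha>")
  case False
  then have "trees \<alpha> = {}" using ttype_wf(1) by (fastforce simp: trees_def is_type_def)
  then show ?thesis using False by (simp add: xi_def)
qed (simp add: xi_def Htilde_eq_card_trees)

section \<open>Coefficients of power series as cardinalities\<close>

lemma finite_poly_mapping_le: "finite {\<alpha> :: nat \<Rightarrow>\<^sub>0 nat. \<forall>j. Poly_Mapping.lookup \<alpha> j \<le> h j}"
  if "finite {j. h j \<noteq> 0}" for h :: "nat \<Rightarrow> nat"
proof (rule finite_imageD)
  let ?A = "{j. h j \<noteq> 0}"
  let ?F = "{f :: nat \<Rightarrow> nat. \<forall>j. (j \<in> ?A \<longrightarrow> f j \<in> {..Max (h ` ?A)}) \<and> (j \<notin> ?A \<longrightarrow> f j = 0)}"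
  show "finite (Poly_Mapping.lookup ` {\<alpha> :: nat \<Rightarrow>\<^sub>0 nat. \<forall>j. Poly_Mapping.lookup \<alpha> j \<le> h j})"
  proof (rule finite_subset)
    show "finite ?F" by (rule finite_set_of_finite_funs[OF that]) simp
    show "Poly_Mapping.lookup ` {\<alpha> :: nat \<Rightarrow>\<^sub>0 nat. \<forall>j. Poly_Mapping.lookup \<alpha> j \<le> h j} \<subseteq> ?F"
    proof (rule image_subsetI)
      fix \<alpha> :: "nat \<Rightarrow>\<^sub>0 nat" assume "\<alpha> \<in> {\<alpha>. \<forall>j. Poly_Mapping.lookup \<alpha> j \<le> h j}"
      then have a: "Poly_Mapping.lookup \<alpha> j \<le> h j" for j by simp
      have "Poly_Mapping.lookup \<alpha> j \<le> Max (h ` ?A)" if "j \<in> ?A" for j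
        by (rule order_trans[OF a Max_ge]) (use \<open>finite ?A\<close> that in auto)
      moreover have "Poly_Mapping.lookup \<alpha> j = 0" if "j \<notin> ?A" for j using a[of j] that by simp
      ultimately show "Poly_Mapping.lookup \<alpha> \<in> ?F" by simp
    qed
  qed
qed (simp add: inj_on_def poly_mapping_eqI)

lemma finite_splits: "finite {(a, b). a + b = (m :: nat \<Rightarrow>\<^sub>0 nat)}"
proof (rule finite_subset)
  let ?B = "{\<alpha> :: nat \<Rightarrow>\<^sub>0 nat. \<forall>j. Poly_Mapping.lookup \<alpha> j \<le> Poly_Mapping.lookup m j}"
  show "{(a, b). a + b = m} \<subseteq> ?B \<times> ?B" by (auto simp: lookup_add)
  have "finite ?B" by (rule finite_poly_mapping_le) (simp add: keys.rep_eq[symmetric])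
  then show "finite (?B \<times> ?B)" by simp
qed

text \<open>The product rule of enumeration: sort the pairs by the weights of their components.
  Finiteness is part of the conclusion so that the rule can be applied to its own result.\<close>

lemma ps_mult_card:
  fixes wa :: "'a \<Rightarrow> (nat \<Rightarrow>\<^sub>0 nat)" and wb :: "'b \<Rightarrow> (nat \<Rightarrow>\<^sub>0 nat)"
  assumes "\<And>m. f m = int (card {a \<in> A. wa a = m})" "\<And>m. finite {a \<in> A. wa a = m}"
    and "\<And>m. g m = int (card {b \<in> B. wb b = m})" "\<And>m. finite {b \<in> B. wb b = m}"
  shows "ps_mult f g m = int (card {p \<in> A \<times> B. wa (fst p) + wb (snd p) = m})"
    and "finite {p \<in> A \<times> B. wa (fst p) + wb (snd p) = m}"
proof -
  let ?Z = "{(a, b). a + b = m}" and ?S = "{p \<in> A \<times> B. wa (fst p) + wb (snd p) = m}"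
  let ?fib = "\<lambda>z. {a \<in> A. wa a = fst z} \<times> {b \<in> B. wb b = snd z}"
  have S: "?S = (\<Union>z\<in>?Z. ?fib z)" by auto
  show "finite ?S" unfolding S using finite_splits assms(2,4) by blast
  have "card ?S = (\<Sum>z\<in>?Z. card (?fib z))"
    unfolding S
  proof (rule card_UN_disjoint[OF finite_splits])
    show "\<forall>z\<in>?Z. finite (?fib z)" using assms(2,4) by blast
    show "\<forall>z\<in>?Z. \<forall>z'\<in>?Z. z \<noteq> z' \<longrightarrow> ?fib z \<inter> ?fib z' = {}" by auto
  qed
  then show "ps_mult f g m = int (card ?S)"
    unfolding ps_mult_def assms(1,3) by (simp add: case_prod_beta card_cartesian_product)
qed

definition forests :: "nat \<Rightarrow> cforest set" where
  "forests k = {f. fwf f \<and> flen f = k}"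

lemma forests_0: "forests 0 = {Empty}"
proof (rule set_eqI)
  fix f
  show "f \<in> forests 0 \<longleftrightarrow> f \<in> {Empty}" by (cases f) (simp_all add: forests_def)
qed

lemma finite_forests: "finite {f \<in> forests k. ftype f = m}"
proof (cases k)
  case 0
  then show ?thesis by (simp add: forests_0)
next
  case (Suc k')
  have "(\<lambda>f. Node f Leaf) ` {f \<in> forests k. ftype f = m} \<subseteq> trees (Poly_Mapping.single (Suc k) 1 + m)"
    using Suc by (auto simp: forests_def trees_def)
  then have "finite ((\<lambda>f. Node f Leaf) ` {f \<in> forests k. ftype f = m})"
    using finite_trees finite_subset by blast
  then show ?thesis by (rule finite_imageD) (simp add: inj_on_def)
qed

lemma trees_alt: "trees m = {t \<in> {t. twf t}. ttype t = m}"
  by (auto simp: trees_def)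

text \<open>Each \<open>Grow\<close> adds a pair of trees, which accounts for two factors
  \<open>xi\<close>.\<close>

lemma ps_pow_forests: "ps_pow xi (2 * k) m = int (card {f \<in> forests k. ftype f = m})"
proof (induction k arbitrary: m)
  case 0
  have "{f \<in> {Empty}. ftype f = m} = (if m = 0 then {Empty} else {})" by auto
  then show ?case unfolding forests_0 by (simp add: ps_one_def)
next
  case (Suc k)
  let ?T = "{t. twf t}"
  have xi: "\<And>m. xi m = int (card {t \<in> ?T. ttype t = m})" "\<And>m. finite {t \<in> ?T. ttype t = m}"
    using xi_eq_card_trees finite_trees unfolding trees_alt by auto
  note 2 = ps_mult_card[OF xi Suc.IH finite_forests]
  have "ps_pow xi (2 * Suc k) m = ps_mult xi (ps_mult xi (ps_pow xi (2 * k))) m" by simp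
  also have "\<dots> = int (card {p \<in> ?T \<times> (?T \<times> forests k).
      ttype (fst p) + (ttype (fst (snd p)) + ftype (snd (snd p))) = m})"
    by (rule ps_mult_card(1)[OF xi 2])
  also have "card {p \<in> ?T \<times> (?T \<times> forests k).
      ttype (fst p) + (ttype (fst (snd p)) + ftype (snd (snd p))) = m}
      = card {f \<in> forests (Suc k). ftype f = m}"
    (is "card ?L = card ?R")
  proof (rule bij_betw_same_card)
    let ?g = "\<lambda>p. Grow (fst p) (fst (snd p)) (snd (snd p))"
    have "?g ` ?L \<subseteq> ?R" by (rule image_subsetI) (simp add: forests_def add.assoc mem_Times_iff)
    moreover have "f \<in> ?g ` ?L" if f: "f \<in> ?R" for f
    proof (cases f)
      case Empty
      then show ?thesis using f by (simp add: forests_def)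
    next
      case (Grow l r g)
      show ?thesis
        by (rule image_eqI[of _ _ "(l, r, g)"]) (use f Grow in \<open>simp_all add: forests_def add.assoc\<close>)
    qed
    ultimately have "?g ` ?L = ?R" by blast
    moreover have "inj_on ?g ?L" by (rule inj_onI) (simp add: prod_eq_iff)
    ultimately show "bij_betw ?g ?L ?R" by (simp add: bij_betw_def)
  qed
  finally show ?case .
qed

definition node_trees :: "nat \<Rightarrow> (nat \<Rightarrow>\<^sub>0 nat) \<Rightarrow> ctree set" where
  "node_trees j m = {Node f t | f t. f \<in> forests (j - 1) \<and> twf t \<and> ttype (Node f t) = m}"

lemma ps_summand:
  assumes "2 \<le> j"
  shows "ps_mult (ps_var j) (ps_pow xi (2 * j - 1)) m = int (card (node_trees j m))"
proof -
  let ?T = "{t. twf t}"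
  obtain k where k: "j = Suc k" using assms by (cases j) auto
  have xi: "\<And>m. xi m = int (card {t \<in> ?T. ttype t = m})" "\<And>m. finite {t \<in> ?T. ttype t = m}"
    using xi_eq_card_trees finite_trees unfolding trees_alt by auto
  note 2 = ps_mult_card[OF xi ps_pow_forests[where k = k] finite_forests[where k = k]]
  \<comment> \<open>The variable is the counting series of a single object whose weight is one
    j-cycle.\<close>
  have v: "ps_var j m = int (card {u \<in> {()}. Poly_Mapping.single j 1 = m})"
    "finite {u \<in> {()}. Poly_Mapping.single j (1::nat) = m}" for m
    by (auto simp: ps_var_def)
  have "ps_mult (ps_var j) (ps_pow xi (2 * j - 1)) m = ps_mult (ps_var j) (ps_mult xi (ps_pow xi (2 * k))) m"
    using k by simp
  also have "\<dots> = int (card {p \<in> {()} \<times> (?T \<times> forests k).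
      Poly_Mapping.single j 1 + (ttype (fst (snd p)) + ftype (snd (snd p))) = m})"
    by (rule ps_mult_card(1)[OF v 2])
  also have "card {p \<in> {()} \<times> (?T \<times> forests k).
      Poly_Mapping.single j 1 + (ttype (fst (snd p)) + ftype (snd (snd p))) = m} = card (node_trees j m)"
    (is "card ?L = card ?R")
  proof (rule bij_betw_same_card)
    let ?g = "\<lambda>p :: unit \<times> ctree \<times> cforest. Node (snd (snd p)) (fst (snd p))"
    have "?g p \<in> ?R" if "p \<in> ?L" for p
      unfolding node_trees_def mem_Collect_eq
      by (rule exI[of _ "snd (snd p)"], rule exI[of _ "fst (snd p)"])
        (use that k in \<open>simp add: forests_def ac_simps mem_Times_iff\<close>)
    then have "?g ` ?L \<subseteq> ?R" by (rule image_subsetI)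
    moreover have "t \<in> ?g ` ?L" if "t \<in> ?R" for t
    proof -
      obtain f u where fu: "t = Node f u" "f \<in> forests (j - 1)" "twf u" "ttype (Node f u) = m"
        using \<open>t \<in> ?R\<close> unfolding node_trees_def by blast
      show ?thesis
        by (rule image_eqI[of _ _ "((), u, f)"]) (use fu k in \<open>simp_all add: forests_def ac_simps\<close>)
    qed
    ultimately have "?g ` ?L = ?R" by blast
    moreover have "inj_on ?g ?L" by (rule inj_onI) (simp add: prod_eq_iff)
    ultimately show "bij_betw ?g ?L ?R" by (simp add: bij_betw_def)
  qed
  finally show ?thesis .
qed

text \<open>The root polygon itself puts \<open>j\<close> into the type, so each coefficient
  involves only finitely many \<open>j\<close>.\<close>

lemma node_trees_keys:
  assumes "node_trees j m \<noteq> {}" "2 \<le> j"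
  shows "j \<in> Poly_Mapping.keys m"
  using assms by (auto simp: node_trees_def forests_def lookup_add lookup_single in_keys_iff)

lemma trees_decomp:
  assumes "finite J" "\<And>j. 2 \<le> j \<Longrightarrow> node_trees j m \<noteq> {} \<Longrightarrow> j \<in> J" "J \<subseteq> {2..}"
  shows "card (trees m) = (if m = 0 then 1 else 0) + (\<Sum>j\<in>J. card (node_trees j m))"
proof -
  have sub: "node_trees j m \<subseteq> trees m" if "2 \<le> j" for j
    using that by (auto simp: node_trees_def trees_def forests_def)
  have eq: "trees m = (if m = 0 then {Leaf} else {}) \<union> (\<Union>j\<in>J. node_trees j m)"
  proof (intro equalityI subsetI)
    fix t assume t: "t \<in> trees m"
    show "t \<in> (if m = 0 then {Leaf} else {}) \<union> (\<Union>j\<in>J. node_trees j m)"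
    proof (cases t)
      case Leaf
      then show ?thesis using t by (simp add: trees_def)
    next
      case (Node f u)
      then have "t \<in> node_trees (Suc (flen f)) m"
        using t by (auto simp: node_trees_def trees_def forests_def)
      moreover have "f \<noteq> Empty" using t Node by (simp add: trees_def)
      then have "flen f \<noteq> 0" by (cases f) auto
      ultimately show ?thesis using assms(2)[of "Suc (flen f)"] by auto
    qed
  next
    fix t assume "t \<in> (if m = 0 then {Leaf} else {}) \<union> (\<Union>j\<in>J. node_trees j m)"
    then show "t \<in> trees m" using sub assms(3) by (auto simp: trees_def split: if_splits)
  qed
  have fin: "finite (node_trees j m)" if "j \<in> J" for j
    using finite_subset[OF sub finite_trees] assms(3) that by auto
  have "card (\<Union>j\<in>J. node_trees j m) = (\<Sum>j\<in>J. card (node_trees j m))"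
  proof (rule card_UN_disjoint[OF assms(1)])
    show "\<forall>i\<in>J. \<forall>j\<in>J. i \<noteq> j \<longrightarrow> node_trees i m \<inter> node_trees j m = {}"
      using assms(3) by (auto simp: node_trees_def forests_def)
  qed (use fin in simp)
  moreover have "(if m = 0 then {Leaf} else {}) \<inter> (\<Union>j\<in>J. node_trees j m) = {}"
    by (auto simp: node_trees_def)
  ultimately show ?thesis
    unfolding eq using fin assms(1) by (subst card_Un_disjoint) auto
qed

section \<open>The signed count\<close>

lemma tsize_superset:
  assumes "finite A" "Poly_Mapping.keys \<alpha> \<subseteq> A"
  shows "tsize \<alpha> = (\<Sum>j\<in>A. Poly_Mapping.lookup \<alpha> j)"
  unfolding tsize_def using assms
  by (intro sum.mono_neutral_left) (auto simp: in_keys_iff)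

lemma tsize_0 [simp]: "tsize 0 = 0"
  by (simp add: tsize_def)

lemma tsize_single [simp]: "tsize (Poly_Mapping.single j k) = k"
  by (simp add: tsize_def)

lemma tsize_add [simp]: "tsize (\<alpha> + \<beta>) = tsize \<alpha> + tsize \<beta>"
proof -
  let ?A = "Poly_Mapping.keys \<alpha> \<union> Poly_Mapping.keys \<beta>"
  have "Poly_Mapping.keys (\<alpha> + \<beta>) \<subseteq> ?A" by (rule Poly_Mapping.keys_add)
  then show ?thesis
    using tsize_superset[of ?A "\<alpha> + \<beta>"] tsize_superset[of ?A \<alpha>] tsize_superset[of ?A \<beta>]
    by (simp add: lookup_add sum.distrib)
qed

unbundle fps_syntax

definition wgf :: "'a set \<Rightarrow> ('a \<Rightarrow> nat) \<Rightarrow> ('a \<Rightarrow> real) \<Rightarrow> real fps" where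
  "wgf A w s = Abs_fps (\<lambda>n. \<Sum>a\<in>{a \<in> A. w a = n}. s a)"

lemma wgf_mult:
  assumes "\<And>n. finite {a \<in> A. w a = n}" "\<And>n. finite {b \<in> B. v b = n}"
  shows "wgf A w s * wgf B v u = wgf (A \<times> B) (\<lambda>p. w (fst p) + v (snd p)) (\<lambda>p. s (fst p) * u (snd p))"
    and "finite {p \<in> A \<times> B. w (fst p) + v (snd p) = n}"
proof -
  let ?S = "\<lambda>n. {p \<in> A \<times> B. w (fst p) + v (snd p) = n}"
  let ?fib = "\<lambda>n i. {a \<in> A. w a = i} \<times> {b \<in> B. v b = n - i}"
  have S: "?S n = (\<Union>i\<in>{0..n}. ?fib n i)" for n by auto
  show fin: "finite (?S n)" for n unfolding S using assms by blast
  show "wgf A w s * wgf B v u = wgf (A \<times> B) (\<lambda>p. w (fst p) + v (snd p)) (\<lambda>p. s (fst p) * u (snd p))"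
  proof (rule fps_ext)
    fix n
    have "(\<Sum>p\<in>?S n. s (fst p) * u (snd p)) = (\<Sum>i\<in>{0..n}. \<Sum>p\<in>?fib n i. s (fst p) * u (snd p))"
      unfolding S by (rule sum.UNION_disjoint) (use assms in auto)
    also have "\<dots> = (\<Sum>i\<in>{0..n}. (\<Sum>a\<in>{a \<in> A. w a = i}. s a) * (\<Sum>b\<in>{b \<in> B. v b = n - i}. u b))"
      by (simp add: sum_product sum.cartesian_product case_prod_beta')
    finally show "(wgf A w s * wgf B v u) $ n
        = wgf (A \<times> B) (\<lambda>p. w (fst p) + v (snd p)) (\<lambda>p. s (fst p) * u (snd p)) $ n"
      by (simp add: wgf_def fps_mult_nth)
  qed
qed

definition tsign :: "ctree \<Rightarrow> real" where
  "tsign t = (-1) ^ (tsize (ttype t) + tweight (ttype t))"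

text \<open>The weight is \<open>fsz\<close>, not that of the type: every marked vertex adds 1 to
  the weight of the polygon it belongs to, and this is already charged to the forest.\<close>

definition fsign :: "cforest \<Rightarrow> real" where
  "fsign f = (-1) ^ (tsize (ftype f) + fsz f)"

abbreviation "tgf \<equiv> wgf {t. twf t} (\<lambda>t. tweight (ttype t)) tsign"
abbreviation "fgf \<equiv> wgf {f. fwf f} fsz fsign"

lemma finite_tree_level: "finite {t \<in> {t. twf t}. tweight (ttype t) = n}"
  using finite_twf_tsz[of "Suc n"] by (simp add: tsz_def)

lemma finite_forest_level: "finite {f \<in> {f. fwf f}. fsz f = n}"
proof -
  have "(\<lambda>f. Node f Leaf) ` {f. f \<noteq> Empty \<and> fwf f \<and> fsz f = n} \<subseteq> {t \<in> {t. twf t}. tweight (ttype t) = n}"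
    by (auto simp: fsz_def)
  then have "finite ((\<lambda>f. Node f Leaf) ` {f. f \<noteq> Empty \<and> fwf f \<and> fsz f = n})"
    using finite_tree_level finite_subset by blast
  then have "finite {f. f \<noteq> Empty \<and> fwf f \<and> fsz f = n}"
    by (rule finite_imageD) (simp add: inj_on_def)
  then show ?thesis by (rule finite_subset[of _ "insert Empty _", rotated, OF finite.insertI]) auto
qed

lemma sign_Grow: "fsign (Grow l r f) = - (tsign l * (tsign r * fsign f))"
  by (simp add: fsign_def tsign_def fsz_def tsz_def power_add)

text \<open>The weight of the root polygon is contained in \<open>fsz f\<close>; the sign left over
  comes from counting the polygon as one factor.\<close>

lemma sign_Node: "tsign (Node f t) = - (fsign f * tsign t)"
  by (simp add: fsign_def tsign_def fsz_def power_add)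

text \<open>The pairs of a forest and a tree with non-empty forest are the trees other than
  \<^const>\<open>Leaf\<close>, with the opposite sign.\<close>

lemma fgf_tgf: "fgf * tgf = 1"
proof (rule fps_ext)
  fix n
  let ?P = "{p \<in> {f. fwf f} \<times> {t. twf t}. fsz (fst p) + tweight (ttype (snd p)) = n}"
  let ?s = "\<lambda>p. fsign (fst p) * tsign (snd p)"
  let ?T = "{t \<in> {t. twf t}. tweight (ttype t) = n}"
  have fin: "finite ?P" by (rule wgf_mult(2)[OF finite_forest_level finite_tree_level])
  have "(fgf * tgf) $ n = (\<Sum>p\<in>?P. ?s p)"
    unfolding wgf_mult(1)[OF finite_forest_level finite_tree_level] by (simp add: wgf_def)
  also have "\<dots> = (\<Sum>p\<in>{p \<in> ?P. fst p = Empty}. ?s p) + (\<Sum>p\<in>{p \<in> ?P. fst p \<noteq> Empty}. ?s p)"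
  proof -
    have f: "finite {p \<in> ?P. fst p = Empty}" "finite {p \<in> ?P. fst p \<noteq> Empty}"
      by (rule finite_subset[OF _ fin], blast)+
    have P: "?P = {p \<in> ?P. fst p = Empty} \<union> {p \<in> ?P. fst p \<noteq> Empty}" by blast
    have d: "{p \<in> ?P. fst p = Empty} \<inter> {p \<in> ?P. fst p \<noteq> Empty} = {}" by blast
    show ?thesis by (rule trans[OF arg_cong[OF P, of "sum ?s"] sum.union_disjoint[OF f d]])
  qed
  also have "(\<Sum>p\<in>{p \<in> ?P. fst p = Empty}. ?s p) = (\<Sum>t\<in>?T. tsign t)"
    by (rule sum.reindex_bij_witness[of _ "\<lambda>t. (Empty, t)" snd]) (auto simp: fsign_def)
  also have "(\<Sum>p\<in>{p \<in> ?P. fst p \<noteq> Empty}. ?s p) = (\<Sum>t\<in>?T - {Leaf}. - tsign t)"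
    by (rule sum.reindex_bij_witness[of _ "\<lambda>t. case t of Node f u \<Rightarrow> (f, u)" "\<lambda>(f, u). Node f u"])
      (auto simp: sign_Node fsz_def split: ctree.splits)
  \<comment> \<open>All trees cancel except \<open>Leaf\<close>, which has weight 0.\<close>
  also have "(\<Sum>t\<in>?T. tsign t) + (\<Sum>t\<in>?T - {Leaf}. - tsign t) = (if n = 0 then 1 else 0)"
    using finite_tree_level[of n]
    by (cases "n = 0") (auto simp: sum_negf sum_diff1 tsign_def)
  finally show "(fgf * tgf) $ n = 1 $ n" by simp
qed

text \<open>A nonempty forest is a pair of trees and a shorter forest; its first marked vertex
  contributes the factor \<open>fps_X\<close> and the sign.\<close>

lemma fgf_eq: "fgf = 1 - fps_X * (tgf * (tgf * fgf))"
proof (rule fps_ext)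
  fix n
  have tf: "tgf * fgf = wgf ({t. twf t} \<times> {f. fwf f}) (\<lambda>p. tweight (ttype (fst p)) + fsz (snd p))
     (\<lambda>p. tsign (fst p) * fsign (snd p))"
    by (rule wgf_mult(1)[OF finite_tree_level finite_forest_level])
  note ttf = wgf_mult(1)[OF finite_tree_level wgf_mult(2)[OF finite_tree_level finite_forest_level]]
  show "fgf $ n = (1 - fps_X * (tgf * (tgf * fgf))) $ n"
  proof (cases n)
    case 0
    have "{f \<in> {f. fwf f}. fsz f = 0} = {Empty}"
    proof (rule set_eqI)
      fix f
      show "f \<in> {f \<in> {f. fwf f}. fsz f = 0} \<longleftrightarrow> f \<in> {Empty}" by (cases f) (simp_all add: tsz_def)
    qed
    then show ?thesis using 0 by (simp add: wgf_def fsign_def)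
  next
    case (Suc m)
    have "(\<Sum>f\<in>{f \<in> {f. fwf f}. fsz f = Suc m}. fsign f)
      = (\<Sum>p\<in>{p \<in> {t. twf t} \<times> ({t. twf t} \<times> {f. fwf f}).
          tweight (ttype (fst p)) + (tweight (ttype (fst (snd p))) + fsz (snd (snd p))) = m}.
          - (tsign (fst p) * (tsign (fst (snd p)) * fsign (snd (snd p)))))"
      by (rule sum.reindex_bij_witness[of _ "\<lambda>(l, r, f). Grow l r f" "\<lambda>f. case f of Grow l r g \<Rightarrow> (l, r, g)"])
        (auto simp: sign_Grow tsz_def split: cforest.splits)
    then show ?thesis
      unfolding tf ttf using Suc by (simp add: wgf_def sum_negf)
  qed
qed

text \<open>Multiply the equation for \<open>fgf\<close> by \<open>tgf\<close> and replace
  \<open>fgf * tgf\<close> by 1 on both sides.\<close>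

lemma tgf_eq: "tgf = 1 + fps_X * tgf^2"
proof -
  have "tgf * fgf = tgf - fps_X * (tgf * tgf) * (fgf * tgf)"
    by (subst (1) fgf_eq) (simp add: algebra_simps)
  then show ?thesis using fgf_tgf by (simp add: mult.commute power2_eq_square algebra_simps)
qed

text \<open>\<open>R = 1 - 2 X T\<close> is a square root of \<open>1 - 4 X\<close>, hence \<open>(1 - 4 X) R' = -2 R\<close>.\<close>

lemma fps_catalan:
  fixes T :: "real fps"
  assumes "T = 1 + fps_X * T^2"
  shows "T $ n = real ((2 * n) choose n) / real (n + 1)"
proof -
  define R where "R = 1 - 2 * fps_X * T"
  have "R * R = 1 - 4 * fps_X * (T - fps_X * T^2)"
    by (simp add: R_def algebra_simps power2_eq_square)
  also have "T - fps_X * T^2 = 1" using assms by (simp add: algebra_simps)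
  finally have RR: "R * R = 1 - 4 * fps_X" by simp
  have "fps_deriv (R * R) = fps_deriv (1 - 4 * fps_X)" using RR by simp
  then have "2 * (R * fps_deriv R) = 2 * (-2)" by (simp add: algebra_simps)
  then have RD: "R * fps_deriv R = -2" by (subst (asm) mult_cancel_left) simp
  have "(1 - 4 * fps_X) * fps_deriv R = R * (R * fps_deriv R)" unfolding RR[symmetric] by (rule mult.assoc)
  then have "(1 - 4 * fps_X) * fps_deriv R = -2 * R" unfolding RD by simp
  then have coeff: "((1 - 4 * fps_X) * fps_deriv R) $ k = (-2 * R) $ k" for k by simp
  have R: "R $ Suc k = - 2 * T $ k" for k
    by (simp add: R_def mult.assoc fps_numeral_nth numeral_fps_const)
  \<comment> \<open>Coefficient \<open>n + 1\<close> of the differential equation, divided by -2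
    after rewriting the coefficients of \<open>R\<close> through those of \<open>T\<close>.\<close>
  have rec: "real (n + 2) * T $ Suc n = real (4 * n + 2) * T $ n" for n
    using coeff[of "Suc n"] R
    by (simp add: left_diff_distrib mult.assoc numeral_fps_const algebra_simps)
  show ?thesis
  proof (induction n)
    case 0
    have "T $ 0 = (1 + fps_X * T^2) $ 0" using assms by simp
    then show ?case by simp
  next
    case (Suc n)
    have "(Suc n) * ((2 * Suc n) choose (Suc n)) = (2 * Suc n) * ((2 * n + 1) choose n)"
      using Suc_times_binomial_eq[of "2 * n + 1" n] by (simp add: mult.commute)
    moreover have "(Suc n) * ((2 * n + 1) choose n) = (2 * n + 1) * ((2 * n) choose n)"
      using Suc_times_binomial_add[of n n] binomial_absorb_comp[of "2 * n + 1" n] by (simp add: mult.commute)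
    ultimately have b: "(Suc n) * ((2 * Suc n) choose (Suc n)) = 2 * ((2 * n + 1) * ((2 * n) choose n))"
      by (metis mult.assoc mult.commute mult.left_commute)
    have "real (Suc n) * real ((2 * Suc n) choose (Suc n)) = real (4 * n + 2) * real ((2 * n) choose n)"
      using arg_cong[OF b, of real] by (simp add: algebra_simps)
    then have "real ((2 * Suc n) choose (Suc n)) = real (4 * n + 2) * (real ((2 * n) choose n) / real (n + 1))"
      by (simp add: field_simps)
    also have "\<dots> = real (n + 2) * T $ Suc n" using rec[of n] Suc by simp
    finally show ?case by (simp add: field_simps)
  qed
qed

section \<open>From trees to the sum over types\<close>

lemma finite_types: "finite {\<alpha>. is_type \<alpha> \<and> tweight \<alpha> = n}"
proof (rule finite_subset)
  let ?h = "\<lambda>j. if j \<le> Suc n then n else 0"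
  show "finite {\<alpha> :: nat \<Rightarrow>\<^sub>0 nat. \<forall>j. Poly_Mapping.lookup \<alpha> j \<le> ?h j}"
    by (rule finite_poly_mapping_le) (rule finite_subset[of _ "{..Suc n}"], auto)
  \<comment> \<open>For \<open>j\<close> in the support both \<open>j - 1\<close> and the entry are
    at least 1, and their product is at most \<open>n\<close>; this bounds either of them.\<close>
  have "Poly_Mapping.lookup \<alpha> j \<le> ?h j" if \<alpha>: "is_type \<alpha>" "tweight \<alpha> = n" for \<alpha> j
  proof (cases "j \<in> Poly_Mapping.keys \<alpha>")
    case True
    have "j \<noteq> 0 \<and> j \<noteq> 1" using \<alpha>(1) True unfolding is_type_def in_keys_iff by metis
    then have j: "1 \<le> j - 1" by linarith
    have l: "1 \<le> Poly_Mapping.lookup \<alpha> j" using True by (simp add: in_keys_iff Suc_le_eq)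
    have le: "(j - 1) * Poly_Mapping.lookup \<alpha> j \<le> n"
      unfolding \<alpha>(2)[symmetric] tweight_def using True by (intro member_le_sum) auto
    have "j - 1 \<le> n" using order_trans[OF _ le] mult_le_mono2[OF l, of "j - 1"] by simp
    moreover have "Poly_Mapping.lookup \<alpha> j \<le> n" using order_trans[OF _ le] mult_le_mono1[OF j] by simp
    ultimately show ?thesis by simp
  qed (simp add: in_keys_iff)
  then show "{\<alpha>. is_type \<alpha> \<and> tweight \<alpha> = n} \<subseteq> {\<alpha>. \<forall>j. Poly_Mapping.lookup \<alpha> j \<le> ?h j}" by blast
qed

lemma signed_sum_Htilde:
  "(\<Sum>\<alpha>\<in>{\<alpha>. is_type \<alpha> \<and> tweight \<alpha> = n}. (-1::real) ^ (tsize \<alpha> + n) * real (Htilde \<alpha>)) = tgf $ n"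
proof -
  let ?A = "{\<alpha>. is_type \<alpha> \<and> tweight \<alpha> = n}" and ?T = "{t \<in> {t. twf t}. tweight (ttype t) = n}"
  have "ttype ` ?T \<subseteq> ?A" using ttype_wf(1) by (auto simp: is_type_def)
  then have "tgf $ n = (\<Sum>\<alpha>\<in>?A. \<Sum>t\<in>{t \<in> ?T. ttype t = \<alpha>}. tsign t)"
    using sum.group[OF finite_tree_level finite_types, of ttype n n tsign] by (simp add: wgf_def)
  also have "\<dots> = (\<Sum>\<alpha>\<in>?A. (-1::real) ^ (tsize \<alpha> + n) * real (Htilde \<alpha>))"
  proof (rule sum.cong[OF refl])
    fix \<alpha> assume \<alpha>: "\<alpha> \<in> ?A"
    have "{t \<in> ?T. ttype t = \<alpha>} = trees \<alpha>" using \<alpha> by (auto simp: trees_def)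
    moreover have "(\<Sum>t\<in>trees \<alpha>. tsign t) = (\<Sum>t\<in>trees \<alpha>. (-1) ^ (tsize \<alpha> + n))"
      using \<alpha> by (intro sum.cong) (auto simp: trees_def tsign_def)
    ultimately show "(\<Sum>t\<in>{t \<in> ?T. ttype t = \<alpha>}. tsign t) = (-1::real) ^ (tsize \<alpha> + n) * real (Htilde \<alpha>)"
      by (simp add: Htilde_eq_card_trees mult.commute)
  qed
  finally show ?thesis by simp
qed

theorem theorem2:
  shows "locally_finite (\<lambda>j. ps_mult (ps_var j) (ps_pow xi (2 * j - 1))) {2..}
    \<and> xi = (\<lambda>m. ps_one m + ps_sum (\<lambda>j. ps_mult (ps_var j) (ps_pow xi (2 * j - 1))) {2..} m)
    \<and> (\<forall>n::nat. (\<Sum>\<alpha>\<in>{\<alpha>. is_type \<alpha> \<and> tweight \<alpha> = n}.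
          (-1::real) ^ (tsize \<alpha> + n) * real (Htilde \<alpha>))
        = real ((2 * n) choose n) / real (n + 1))"
proof (intro conjI allI)
  let ?F = "\<lambda>j. ps_mult (ps_var j) (ps_pow xi (2 * j - 1))"
  let ?J = "\<lambda>m. {j \<in> {2..}. ?F j m \<noteq> 0}"
  have keys: "?J m \<subseteq> Poly_Mapping.keys m" for m
  proof
    fix j assume "j \<in> ?J m"
    then have j: "2 \<le> j" "?F j m \<noteq> 0" by auto
    then have "node_trees j m \<noteq> {}" using ps_summand[OF j(1), of m] by auto
    then show "j \<in> Poly_Mapping.keys m" using node_trees_keys j(1) by blast
  qed
  have fin: "finite (?J m)" for m using finite_subset[OF keys] by simp
  then show "locally_finite ?F {2..}" by (simp add: locally_finite_def)
  show "xi = (\<lambda>m. ps_one m + ps_sum ?F {2..} m)"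
  proof
    fix m
    \<comment> \<open>The index set of \<open>ps_sum\<close> consists of the nonzero summands; it
      has to contain every root size that occurs among the trees of type \<open>m\<close>.\<close>
    have "j \<in> ?J m" if "2 \<le> j" "node_trees j m \<noteq> {}" for j
    proof -
      have "node_trees j m \<subseteq> trees m" using that(1) by (auto simp: node_trees_def trees_def forests_def)
      then have "finite (node_trees j m)" using finite_trees finite_subset by blast
      then show ?thesis using that ps_summand[OF that(1), of m] by simp
    qed
    then have "card (trees m) = (if m = 0 then 1 else 0) + (\<Sum>j\<in>?J m. card (node_trees j m))"
      by (intro trees_decomp[OF fin]) auto
    moreover have "(\<Sum>j\<in>?J m. ?F j m) = (\<Sum>j\<in>?J m. int (card (node_trees j m)))"
    proof (rule sum.cong[OF refl])
      fix j assume "j \<in> ?J m"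
      then have "2 \<le> j" by simp
      then show "?F j m = int (card (node_trees j m))" by (rule ps_summand)
    qed
    ultimately show "xi m = ps_one m + ps_sum ?F {2..} m"
      by (simp add: xi_eq_card_trees ps_one_def ps_sum_def)
  qed
  fix n
  show "(\<Sum>\<alpha>\<in>{\<alpha>. is_type \<alpha> \<and> tweight \<alpha> = n}. (-1::real) ^ (tsize \<alpha> + n) * real (Htilde \<alpha>))
        = real ((2 * n) choose n) / real (n + 1)"
    unfolding signed_sum_Htilde by (rule fps_catalan[OF tgf_eq])
qed

end
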